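(* Let $\{\boldsymbol X_t,\ t\in\mathbb Z\}$ be a strictly stationary, $E$-valued, jointly regularly varying time series with tail process $\{\boldsymbol Y_t,\ t\in\mathbb Z\}$ such that the mixing condition (M) and the anti-clustering condition (AC) hold. Let $u>0$ satisfy $$r^{(s)}(\boldsymbol x)\le u\,\|\boldsymbol x\|\qquad\text{for all }\boldsymbol x\in E,\ s\in\mathcal S,$$ and let $$N_n(u)=\sum_{s\in\mathcal S}\sum_{j=1}^{n}\delta_{(j/n,\,s,\,a_n^{-1}\boldsymbol X_j)}\,\mathbf 1\{r^{(s)}(\boldsymbol X_j)>a_nu\},\qquad n\ge 1.$$ Then, as $n\to\infty$, $N_n(u)$ converges weakly to a point process $N(u)$ on $[0,1]\times\mathcal X_u$ which has the same distribution as the superposition of a random number of independent and identically distributed cluster processes: $$N(u)\overset{d}{=}\sum_{i=1}^{T}\sum_{s\in\mathcal S}\sum_{j=0}^{\infty}\delta_{(V_i,\,s,\,\boldsymbol Z_{ij})}\,\mathbf 1\{r^{(s)}(\boldsymbol Z_{ij})>u\},$$ where $T$ is a Poisson random variable with mean $\theta$ and $\Big(\sum_{s\in\mathcal S}\sum_{j=-\infty}^{\infty}\delta_{(V_i,\,s,\,\boldsymbol Z_{ij})}\Big)_{i=1}^{\infty}$ are i.i.d. copies of the cluster process $C=\sum_{s\in\mathcal S}\sum_{j=-\infty}^{\infty}\delta_{(V,\,s,\,\boldsymbol Z_j)}$, independent of $T$.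
   Context: **Spaces.** $\mathcal S$ is a finite set (of sites), $E=[0,\infty)^{\mathcal S}$, $\|\boldsymbol x\|=\max_{s\in\mathcal S}x(s)$. $\overline E_0=[0,\infty]^{\mathcal S}\setminus\{\boldsymbol 0\}$ is the locally compact space (topology inherited from the product topology of $[0,\infty]^{\mathcal S}$) in which a set $A$ is relatively compact iff $\inf\{\|\boldsymbol x\|:\boldsymbol x\in A\}>0$. For finite $I\subset\mathbb Z$, $\overline E_0^{I}=([0,\infty]^{\mathcal S})^{I}\setminus\{\boldsymbol 0\}$, where $A$ is relatively compact iff $\inf\{\max_{t\in I}\|\boldsymbol x_t\|:\boldsymbol x\in A\}>0$. The time series $\boldsymbol X_t=(X_t(s))_{s\in\mathcal S}$, $t\in\mathbb Z$, takes values in $E$. **Joint regular variation.** A stationary $\{\boldsymbol X_t\}$ is jointly regularly varying with index $\alpha>0$ if (i) $\lim_{x\to\infty}\mathbb P(\|\boldsymbol X_0\|>xt\mid\|\boldsymbol X_0\|>x)=t^{-\alpha}$ for all $t>1$, and (ii) for all integers $t_1<t_2$, with $I=\{t_1,\dots,t_2\}$, there is a non-zero measure $\mu_I$ on $\overline E_0^I$, finite on relatively compact sets, such that $\mathbb P((\boldsymbol X_{t_1}/x,\dots,\boldsymbol X_{t_2}/x)\in A)/\mathbb P(\|\boldsymbol X_0\|>x)\to\mu_I(A)$ as $x\to\infty$ for every relatively compact $A\subset\overline E_0^I$ with $\mu_I(\partial A)=0$. In this case there is a process $\{\boldsymbol\Theta_t,\ t\in\mathbb Z\}$ (the spectral tail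 process; $\|\boldsymbol\Theta_0\|=1$ a.s.) such that for all $t_1<t_2$ the conditional law of $(\boldsymbol X_{t_1}/\|\boldsymbol X_0\|,\dots,\boldsymbol X_{t_2}/\|\boldsymbol X_0\|)$ given $\|\boldsymbol X_0\|>x$ converges weakly, as $x\to\infty$, to the law of $(\boldsymbol\Theta_{t_1},\dots,\boldsymbol\Theta_{t_2})$. The tail process is $\boldsymbol Y_t=P_\alpha\boldsymbol\Theta_t$, $t\in\mathbb Z$, where $P_\alpha$ is $\alpha$-Pareto distributed ($\mathbb P(P_\alpha>y)=y^{-\alpha}$, $y\ge1$) and independent of $\{\boldsymbol\Theta_t\}$. **Risk functionals.** For each $s\in\mathcal S$, $r^{(s)}:E\to[0,\infty)$ is continuous at the origin and positively homogeneous: $r^{(s)}(c\boldsymbol x)=c\,r^{(s)}(\boldsymbol x)$ for all $c>0$, $\boldsymbol x\in E$. $\mathcal X_u=\{(s,\boldsymbol x)\in\mathcal S\times(E\setminus\{\boldsymbol 0\}):r^{(s)}(\boldsymbol x)>u\}$. **Sequences.** $(a_n)$ is a positive sequence with $n\,\mathbb P(\|\boldsymbol X_0\|>a_n)\to1$. $(r_n)$ is a sequence of positive integers with $r_n\to\infty$ and $r_n/n\to0$; $k_n=\lfloor n/r_n\rfloor$. **Condition (M).** For every non-negative, bounded and compactly supported function $f:[0,1]\times\mathcal S\times\overline E_0\to[0,\infty)$ (with $f$ read as $0$ when the last argument is $\boldsymbol 0$), $$\mathbb E\Big[\exp\Big\{-\sum_{s\in\mathcal S}\sum_{j=1}^{n}f(j/n,s,a_n^{-1}\boldsymbol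 X_j)\Big\}\Big]-\prod_{i=1}^{k_n}\mathbb E\Big[\exp\Big\{-\sum_{s\in\mathcal S}\sum_{j=(i-1)r_n+1}^{ir_n}f(j/n,s,a_n^{-1}\boldsymbol X_j)\Big\}\Big]\longrightarrow0\quad(n\to\infty).$$ **Condition (AC).** For every $u\in(0,\infty)$, $\displaystyle\lim_{m\to\infty}\limsup_{n\to\infty}\mathbb P\Big(\max_{m\le|t|\le r_n}\|\boldsymbol X_t\|>a_nu\,\Big|\,\|\boldsymbol X_0\|>a_nu\Big)=0.$ **Extremal index.** $\theta=\lim_{n\to\infty}\lim_{x\to\infty}\mathbb P(\max_{1\le j\le r_n}\|\boldsymbol X_j\|\le x\mid\|\boldsymbol X_0\|>x)=\mathbb P(\sup_{j\ge1}\|\boldsymbol Y_j\|\le1)$, which is positive under (AC). **Cluster process.** In $C$, $V$ is uniform on $(0,1)$ and, independently of $V$, $\{\boldsymbol Z_j,\ j\in\mathbb Z\}$ has the law of $\{\boldsymbol Y_j,\ j\in\mathbb Z\}$ conditional on $\sup_{j\le-1}\|\boldsymbol Y_j\|\le1$. **Weak convergence.** The processes are regarded as point processes on $[0,1]\times\mathcal S\times\overline E_0$ (supported in $[0,1]\times\mathcal X_u$). $N_n(u)$ converges weakly to $N(u)$ iff $\mathbb E[\exp(-\int g\,\mathrm dN_n(u))]\to\mathbb E[\exp(-\int g\,\mathrm dN(u))]$ for every non-negative continuous compactly supported $g:[0,1]\times\mathcal S\times\overline E_0\to[0,\infty)$. $\delta_x$ is the Dirac measure at $x$.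
   Formalization: Each r^(s) is also assumed measurable and, for every t≥0, almost surely continuous at Y_t; with continuity at the origin alone the claim fails, e.g. X_t=(R_t−1,R_t) with R_t i.i.d. Pareto, u=1, r(x)=x(1) if x(1)=x(2), else 0. *)

theory Defs
  imports "HOL-Probability.Probability"
begin

text \<open>
  The site set is the finite type \<open>'s\<close>. A vector in \<open>[0,\<infinity>)\<^sup>S\<close> is a
  function \<open>'s \<Rightarrow> real\<close> in \<open>nonneg_cone\<close>, a vector in \<open>[0,\<infinity>]\<^sup>S\<close> is an arbitrary
  function \<open>'s \<Rightarrow> ennreal\<close>; both function types carry the product topology.
\<close>

definition nonneg_cone :: "('s \<Rightarrow> real) set" where
  "nonneg_cone = {x. \<forall>s. 0 \<le> x s}"

definition maxnorm :: "('s::finite \<Rightarrow> 'b::linorder) \<Rightarrow> 'b" where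
  "maxnorm x = Max (range x)"

definition embed :: "('s \<Rightarrow> real) \<Rightarrow> 's \<Rightarrow> ennreal" where
  "embed x = (\<lambda>s. ennreal (x s))"

definition punctured_window :: "int set \<Rightarrow> (int \<Rightarrow> 's \<Rightarrow> ennreal) topology" where
  "punctured_window I =
     subtopology (product_topology (\<lambda>_. euclidean) I) (- {\<lambda>t\<in>I. \<lambda>s. 0})"

definition mark_space :: "(real \<times> 's \<times> ('s \<Rightarrow> ennreal)) topology" where
  "mark_space =
     prod_topology (top_of_set {0..1})
       (prod_topology (discrete_topology UNIV) (top_of_set (- {\<lambda>s. 0})))"

definition borel_of :: "'a topology \<Rightarrow> 'a measure" where
  "borel_of T = sigma (topspace T) {U. openin T U}"

definition relatively_compact_in :: "'a topology \<Rightarrow> 'a set \<Rightarrow> bool" where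
  "relatively_compact_in T A \<longleftrightarrow> A \<subseteq> topspace T \<and> compactin T (T closure_of A)"

text \<open>
  Functions on a subspace are total functions on the ambient type. Compact support
  makes them vanish outside the subspace, in particular where the last mark is the
  origin, which is not a point of \<open>mark_space\<close>.
\<close>

definition compactly_supported :: "'a topology \<Rightarrow> ('a \<Rightarrow> real) \<Rightarrow> bool" where
  "compactly_supported T f \<longleftrightarrow> (\<exists>K. compactin T K \<and> (\<forall>p. p \<notin> K \<longrightarrow> f p = 0))"


abbreviation path_space :: "(int \<Rightarrow> 's::finite \<Rightarrow> real) measure" where
  "path_space \<equiv> PiM UNIV (\<lambda>_. borel)"

definition time_series :: "'w measure \<Rightarrow> (int \<Rightarrow> 'w \<Rightarrow> 's::finite \<Rightarrow> real) \<Rightarrow> bool" where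
  "time_series M X \<longleftrightarrow> prob_space M \<and> (\<forall>t. X t \<in> M \<rightarrow>\<^sub>M restrict_space borel nonneg_cone)"

definition strictly_stationary :: "'w measure \<Rightarrow> (int \<Rightarrow> 'w \<Rightarrow> 's::finite \<Rightarrow> real) \<Rightarrow> bool" where
  "strictly_stationary M X \<longleftrightarrow>
     (\<forall>h. distr M path_space (\<lambda>\<omega> t. X (t + h) \<omega>) = distr M path_space (\<lambda>\<omega> t. X t \<omega>))"

definition jointly_regularly_varying ::
    "'w measure \<Rightarrow> (int \<Rightarrow> 'w \<Rightarrow> 's::finite \<Rightarrow> real) \<Rightarrow> real \<Rightarrow> bool" where
  "jointly_regularly_varying M X \<alpha> \<longleftrightarrow>
     0 < \<alpha> \<and>
     (\<forall>t>1. ((\<lambda>x. \<P>(\<omega> in M. maxnorm (X 0 \<omega>) > x * t \<bar> maxnorm (X 0 \<omega>) > x))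
               \<longlongrightarrow> t powr (- \<alpha>)) at_top) \<and>
     (\<forall>t1 t2. t1 < t2 \<longrightarrow>
       (let T = punctured_window {t1..t2} in
        \<exists>\<mu>. sets \<mu> = sets (borel_of T) \<and>
            emeasure \<mu> (space \<mu>) \<noteq> 0 \<and>
            (\<forall>A\<in>sets \<mu>. relatively_compact_in T A \<longrightarrow> emeasure \<mu> A < \<infinity>) \<and>
            (\<forall>A\<in>sets \<mu>. relatively_compact_in T A \<and> emeasure \<mu> (T frontier_of A) = 0 \<longrightarrow>
               ((\<lambda>x. \<P>(\<omega> in M. (\<lambda>t\<in>{t1..t2}. embed (\<lambda>s. X t \<omega> s / x)) \<in> A)
                      / \<P>(\<omega> in M. maxnorm (X 0 \<omega>) > x))
                \<longlongrightarrow> measure \<mu> A) at_top)))"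

definition spectral_tail_process ::
    "'w measure \<Rightarrow> (int \<Rightarrow> 'w \<Rightarrow> 's::finite \<Rightarrow> real) \<Rightarrow>
     'p measure \<Rightarrow> (int \<Rightarrow> 'p \<Rightarrow> 's \<Rightarrow> real) \<Rightarrow> bool" where
  "spectral_tail_process M X M' \<Theta> \<longleftrightarrow>
     time_series M' \<Theta> \<and>
     (AE \<omega> in M'. maxnorm (\<Theta> 0 \<omega>) = 1) \<and>
     (\<forall>t1 t2. t1 < t2 \<longrightarrow>
       (\<forall>h. continuous_map (product_topology (\<lambda>_. top_of_set nonneg_cone) {t1..t2}) euclideanreal h \<and>
            bounded (range h) \<longrightarrow>
          ((\<lambda>x. \<integral>\<omega>. h (\<lambda>t\<in>{t1..t2}. \<lambda>s. X t \<omega> s / maxnorm (X 0 \<omega>))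
                  \<partial>uniform_measure M {\<omega> \<in> space M. maxnorm (X 0 \<omega>) > x})
           \<longlongrightarrow> (\<integral>\<omega>. h (\<lambda>t\<in>{t1..t2}. \<Theta> t \<omega>) \<partial>M')) at_top))"

definition pareto :: "real \<Rightarrow> 'p measure \<Rightarrow> ('p \<Rightarrow> real) \<Rightarrow> bool" where
  "pareto \<alpha> M' P \<longleftrightarrow>
     P \<in> borel_measurable M' \<and> (\<forall>y\<ge>1. \<P>(\<omega> in M'. P \<omega> > y) = y powr (- \<alpha>))"

text \<open>
  \<^const>\<open>prob_space.indep_var\<close> requires both variables to have the same value type;
  this is the same notion for variables of different types.
\<close>

definition independent ::
    "'q measure \<Rightarrow> 'a measure \<Rightarrow> ('q \<Rightarrow> 'a) \<Rightarrow> 'b measure \<Rightarrow> ('q \<Rightarrow> 'b) \<Rightarrow> bool" where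
  "independent Q A X B Y \<longleftrightarrow>
     X \<in> Q \<rightarrow>\<^sub>M A \<and> Y \<in> Q \<rightarrow>\<^sub>M B \<and>
     prob_space.indep_set Q {X -` C \<inter> space Q |C. C \<in> sets A} {Y -` C \<inter> space Q |C. C \<in> sets B}"

definition tail_process ::
    "'w measure \<Rightarrow> (int \<Rightarrow> 'w \<Rightarrow> 's::finite \<Rightarrow> real) \<Rightarrow> real \<Rightarrow>
     'p measure \<Rightarrow> (int \<Rightarrow> 'p \<Rightarrow> 's \<Rightarrow> real) \<Rightarrow> bool" where
  "tail_process M X \<alpha> M' Y \<longleftrightarrow>
     (\<exists>\<Theta> P. spectral_tail_process M X M' \<Theta> \<and> pareto \<alpha> M' P \<and>
        independent M' borel P path_space (\<lambda>\<omega> t. \<Theta> t \<omega>) \<and>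
        (\<forall>t. \<forall>\<omega>\<in>space M'. Y t \<omega> = (\<lambda>s. P \<omega> * \<Theta> t \<omega> s)))"

definition mixing_condition ::
    "'w measure \<Rightarrow> (int \<Rightarrow> 'w \<Rightarrow> 's::finite \<Rightarrow> real) \<Rightarrow> (nat \<Rightarrow> real) \<Rightarrow> (nat \<Rightarrow> nat) \<Rightarrow> bool" where
  "mixing_condition M X a b \<longleftrightarrow>
     (\<forall>f. f \<in> borel_measurable (borel_of mark_space) \<and> (\<forall>p. 0 \<le> f p) \<and> bounded (range f) \<and>
          compactly_supported mark_space f \<longrightarrow>
        (\<lambda>n. (\<integral>\<omega>. exp (- (\<Sum>s\<in>UNIV. \<Sum>j=1..n.
                  f (real j / real n, s, embed (\<lambda>s'. X (int j) \<omega> s' / a n)))) \<partial>M)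
           - (\<Prod>i=1..n div b n.
                \<integral>\<omega>. exp (- (\<Sum>s\<in>UNIV. \<Sum>j=(i - 1) * b n + 1..i * b n.
                  f (real j / real n, s, embed (\<lambda>s'. X (int j) \<omega> s' / a n)))) \<partial>M))
        \<longlonglongrightarrow> 0)"

definition anticlustering_condition ::
    "'w measure \<Rightarrow> (int \<Rightarrow> 'w \<Rightarrow> 's::finite \<Rightarrow> real) \<Rightarrow> (nat \<Rightarrow> real) \<Rightarrow> (nat \<Rightarrow> nat) \<Rightarrow> bool" where
  "anticlustering_condition M X a b \<longleftrightarrow>
     (\<forall>u>0. (\<lambda>m. limsup (\<lambda>n. ereal
        (\<P>(\<omega> in M. (\<exists>t. int m \<le> \<bar>t\<bar> \<and> \<bar>t\<bar> \<le> int (b n) \<and> maxnorm (X t \<omega>) > a n * u)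
             \<bar> maxnorm (X 0 \<omega>) > a n * u)))) \<longlonglongrightarrow> 0)"

definition extremal_index ::
    "'w measure \<Rightarrow> (int \<Rightarrow> 'w \<Rightarrow> 's::finite \<Rightarrow> real) \<Rightarrow> (nat \<Rightarrow> nat) \<Rightarrow> real" where
  "extremal_index M X b =
     lim (\<lambda>n. Lim at_top (\<lambda>x.
        \<P>(\<omega> in M. (\<forall>j\<in>{1..b n}. maxnorm (X (int j) \<omega>) \<le> x) \<bar> maxnorm (X 0 \<omega>) > x)))"


definition risk_functional :: "(('s::finite \<Rightarrow> real) \<Rightarrow> real) \<Rightarrow> bool" where
  "risk_functional r \<longleftrightarrow>
     r \<in> borel_measurable (restrict_space borel nonneg_cone) \<and>
     (\<forall>x\<in>nonneg_cone. 0 \<le> r x) \<and>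
     continuous (at (\<lambda>s. 0) within nonneg_cone) r \<and>
     (\<forall>c>0. \<forall>x\<in>nonneg_cone. r (\<lambda>s. c * x s) = c * r x)"

text \<open>
  For a homogeneous functional, continuity at the origin only says that it is bounded by
  a multiple of the norm, so weak convergence to the tail process does not pass through
  the events \<open>r x > u\<close>. The usual continuity-set condition has to be imposed in addition.
  Without it, take \<open>S = {1, 2}\<close>, an i.i.d. series \<open>X\<^sub>t = (R\<^sub>t - 1, R\<^sub>t)\<close> with \<open>R\<^sub>t\<close> Pareto,
  and \<open>r x = (if x 1 = x 2 then x 1 else 0)\<close>: with
  \<open>u = 1\<close> no \<open>X\<^sub>t\<close> is ever an exceedance, since \<open>r (X\<^sub>t) = 0\<close>, while
  \<open>r (Y\<^sub>0) = \<parallel>Y\<^sub>0\<parallel> > 1\<close> almost surely.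
\<close>

definition ae_continuous_along ::
    "'p measure \<Rightarrow> (int \<Rightarrow> 'p \<Rightarrow> 's::finite \<Rightarrow> real) \<Rightarrow> (('s \<Rightarrow> real) \<Rightarrow> real) \<Rightarrow> bool" where
  "ae_continuous_along M' Y r \<longleftrightarrow>
     (\<forall>t\<ge>0. AE \<omega> in M'. continuous (at (Y t \<omega>) within nonneg_cone) r)"


text \<open>
  \<open>point_measure T I p\<close> is \<open>\<Sum>\<^bsub>i \<in> I\<^esub> \<delta>\<^bsub>p i\<^esub>\<close> as a measure on the Borel sets of \<open>T\<close>,
  written as the image of the counting measure on the index set.
\<close>

definition point_measure :: "'a topology \<Rightarrow> 'i set \<Rightarrow> ('i \<Rightarrow> 'a) \<Rightarrow> 'a measure" where
  "point_measure T I p = distr (count_space I) (borel_of T) p"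

text \<open>
  The space of measures on \<open>K\<close> with the \<open>\<sigma>\<close>-algebra generated by the evaluations; the
  construction is that of \<^const>\<open>subprob_algebra\<close> without the bound on the total mass.
\<close>

definition measures_algebra :: "'a measure \<Rightarrow> 'a measure measure" where
  "measures_algebra K =
     (SUP A \<in> sets K. vimage_algebra {N. sets N = sets K} (\<lambda>N. emeasure N A) borel)"

definition point_process :: "'q measure \<Rightarrow> 'a topology \<Rightarrow> ('q \<Rightarrow> 'a measure) \<Rightarrow> bool" where
  "point_process Q T N \<longleftrightarrow>
     prob_space Q \<and>
     N \<in> Q \<rightarrow>\<^sub>M measures_algebra (borel_of T) \<and>
     (AE \<omega> in Q. (\<forall>B\<in>sets (borel_of T). emeasure (N \<omega>) B \<in> insert \<infinity> (range of_nat)) \<and>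
                  (\<forall>K. compactin T K \<longrightarrow> emeasure (N \<omega>) K < \<infinity>))"

definition same_law ::
    "'a topology \<Rightarrow> 'q measure \<Rightarrow> ('q \<Rightarrow> 'a measure) \<Rightarrow> 'v measure \<Rightarrow> ('v \<Rightarrow> 'a measure) \<Rightarrow> bool" where
  "same_law T Q N Q' N' \<longleftrightarrow>
     N \<in> Q \<rightarrow>\<^sub>M measures_algebra (borel_of T) \<and>
     N' \<in> Q' \<rightarrow>\<^sub>M measures_algebra (borel_of T) \<and>
     distr Q (measures_algebra (borel_of T)) N = distr Q' (measures_algebra (borel_of T)) N'"

definition converges_weakly ::
    "'a topology \<Rightarrow> 'w measure \<Rightarrow> (nat \<Rightarrow> 'w \<Rightarrow> 'a measure) \<Rightarrow>
     'q measure \<Rightarrow> ('q \<Rightarrow> 'a measure) \<Rightarrow> bool" where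
  "converges_weakly T M Nn Q N \<longleftrightarrow>
     (\<forall>g. continuous_map T euclideanreal g \<and> (\<forall>p. 0 \<le> g p) \<and> compactly_supported T g \<longrightarrow>
        (\<lambda>n. \<integral>\<omega>. exp (- (\<integral>p. g p \<partial>Nn n \<omega>)) \<partial>M)
          \<longlonglongrightarrow> (\<integral>\<omega>. exp (- (\<integral>p. g p \<partial>N \<omega>)) \<partial>Q))"

definition exceedance_region ::
    "('s::finite \<Rightarrow> ('s \<Rightarrow> real) \<Rightarrow> real) \<Rightarrow> real \<Rightarrow> (real \<times> 's \<times> ('s \<Rightarrow> ennreal)) set" where
  "exceedance_region r u =
     {(v, s, embed x) |v s x. v \<in> {0..1} \<and> x \<in> nonneg_cone - {\<lambda>s. 0} \<and> r s x > u}"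

definition exceedance_process ::
    "(int \<Rightarrow> 'w \<Rightarrow> 's::finite \<Rightarrow> real) \<Rightarrow> (nat \<Rightarrow> real) \<Rightarrow> ('s \<Rightarrow> ('s \<Rightarrow> real) \<Rightarrow> real) \<Rightarrow> real \<Rightarrow>
     nat \<Rightarrow> 'w \<Rightarrow> (real \<times> 's \<times> ('s \<Rightarrow> ennreal)) measure" where
  "exceedance_process X a r u n \<omega> =
     point_measure mark_space
       {(s, j). j \<in> {1..n} \<and> r s (X (int j) \<omega>) > a n * u}
       (\<lambda>(s, j). (real j / real n, s, embed (\<lambda>s'. X (int j) \<omega> s' / a n)))"


text \<open>
  A cluster is represented by the pair of its time mark \<open>V\<close> and its labelled sequence
  \<open>Z\<close>: the superposition keeps the points with \<open>j \<ge> 0\<close>, which the unlabelled point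
  process does not determine.
\<close>

definition cluster_law ::
    "'p measure \<Rightarrow> (int \<Rightarrow> 'p \<Rightarrow> 's::finite \<Rightarrow> real) \<Rightarrow> (real \<times> (int \<Rightarrow> 's \<Rightarrow> real)) measure" where
  "cluster_law M' Y =
     uniform_measure lborel {0<..<1} \<Otimes>\<^sub>M
     distr (uniform_measure M' {\<omega> \<in> space M'. \<forall>j\<le>-1. maxnorm (Y j \<omega>) \<le> 1})
       path_space (\<lambda>\<omega> j. Y j \<omega>)"

definition poisson_clusters ::
    "'p measure \<Rightarrow> (int \<Rightarrow> 'p \<Rightarrow> 's::finite \<Rightarrow> real) \<Rightarrow> real \<Rightarrow>
     'q measure \<Rightarrow> ('q \<Rightarrow> nat) \<Rightarrow> (nat \<Rightarrow> 'q \<Rightarrow> real) \<Rightarrow> (nat \<Rightarrow> int \<Rightarrow> 'q \<Rightarrow> 's \<Rightarrow> real) \<Rightarrow> bool" where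
  "poisson_clusters M' Y \<theta> Q T V Z \<longleftrightarrow>
     prob_space Q \<and>
     T \<in> Q \<rightarrow>\<^sub>M count_space UNIV \<and>
     distr Q (count_space UNIV) T = measure_pmf (poisson_pmf \<theta>) \<and>
     prob_space.indep_vars Q (\<lambda>_. borel \<Otimes>\<^sub>M path_space) (\<lambda>i \<omega>. (V i \<omega>, \<lambda>j. Z i j \<omega>)) {1..} \<and>
     (\<forall>i\<ge>1. distr Q (borel \<Otimes>\<^sub>M path_space) (\<lambda>\<omega>. (V i \<omega>, \<lambda>j. Z i j \<omega>)) = cluster_law M' Y) \<and>
     independent Q (count_space UNIV) T
       (PiM {1..} (\<lambda>_. borel \<Otimes>\<^sub>M path_space)) (\<lambda>\<omega>. \<lambda>i\<in>{1..}. (V i \<omega>, \<lambda>j. Z i j \<omega>))"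

definition cluster_superposition ::
    "('s::finite \<Rightarrow> ('s \<Rightarrow> real) \<Rightarrow> real) \<Rightarrow> real \<Rightarrow>
     ('q \<Rightarrow> nat) \<Rightarrow> (nat \<Rightarrow> 'q \<Rightarrow> real) \<Rightarrow> (nat \<Rightarrow> int \<Rightarrow> 'q \<Rightarrow> 's \<Rightarrow> real) \<Rightarrow>
     'q \<Rightarrow> (real \<times> 's \<times> ('s \<Rightarrow> ennreal)) measure" where
  "cluster_superposition r u T V Z \<omega> =
     point_measure mark_space
       {(i, s, j). i \<in> {1..T \<omega>} \<and> 0 \<le> j \<and> r s (Z i j \<omega>) > u}
       (\<lambda>(i, s, j). (V i \<omega>, s, embed (Z i j \<omega>)))"

end

theory Submission
  imports Defs
begin

text \<open>
  Weak convergence is convergence of Laplace functionals, so the proof computes the limit of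
  the left-hand side and the Laplace functional of a Poisson superposition, and compares them.

  The bound \<open>r s x \<le> u * \<parallel>x\<parallel>\<close> forces every point of the exceedance process to be an exceedance
  of the norm over \<open>a n\<close>. A test function \<open>g\<close> therefore enters only through its sum over the
  sites, \<open>site_sum g v x\<close>, which vanishes for \<open>\<parallel>x\<parallel> \<le> 1\<close>. The mixing condition, applied to \<open>g\<close> cut off
  outside the exceedance region, replaces the Laplace functional by a product over the blocks
  of length \<open>b n\<close>. Each factor is within \<open>b n * P(\<parallel>X 0\<parallel> > a n) \<rightarrow> 0\<close> of one, so the product
  tends to \<open>exp (- \<Lambda>)\<close> as soon as the losses \<open>1 - E exp (- block)\<close> add up to \<open>\<Lambda>\<close>
  in the limit (\<open>prod_one_minus_tendsto_exp\<close>).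

  The loss of a block is split according to the position of its first exceedance
  (\<open>first_exceedance_expansion\<close>). Stationarity moves that position to time zero. The
  summand then is an expectation on the event \<open>\<parallel>X 0\<parallel> > a n\<close> that sees the points following
  time zero, provided that the earlier part of the block has no exceedance. By the
  anticlustering condition only a window \<open>{-m..m}\<close> matters, up to an error that is small
  uniformly in large \<open>n\<close> (\<open>block_loss_approx\<close>). On a fixed window the series, given an exceedance
  at time zero, behaves like the tail process \<open>Y\<close> (\<open>tail_limit\<close>), and the sum over the
  positions is a Riemann sum in the time mark. This yields (\<open>block_product_tendsto\<close>)

    \<open>\<Lambda> = \<integral>\<^sub>0\<^sup>1 E [(1 - exp (- \<Sum>\<^bsub>k \<ge> 0\<^esub> site_sum g v (Y k))) * 1 {\<parallel>Y l\<parallel> \<le> 1 for all l < 0}] dv\<close>.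

  The event in the indicator has probability \<open>\<theta>\<close>: an exceedance with no other one among the
  next \<open>k\<close> times is exactly as likely as one with no other among the previous \<open>k\<close> times
  (\<open>first_last_exceedance\<close>), so both limits agree with the extremal index. It is positive
  because the tail process almost surely has a last exceedance and no time is more likely to
  be the last one than time zero (\<open>past_event_pos\<close>). Conditioning on the event turns \<open>\<Lambda>\<close> into
  \<open>\<theta> * (1 - E exp (- cluster sum))\<close> (\<open>intensity_eq\<close>), and \<open>exp\<close> of its negative is the Laplace
  functional of a Poisson number of independent clusters (\<open>superposition_laplace\<close>).

  The passage to the tail process cannot use weak convergence alone: the functionals above
  are only almost everywhere continuous, they depend on \<open>n\<close>, and the tail process is a product
  of a radius and a direction whose convergence is given separately. All three points are
  settled at once by squeezing the functionals from below between Lipschitz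
  functions of the direction, one for each cell of a fine partition of the radial axis
  (\<open>envelope\<close>, \<open>tail_liminf\<close>).
\<close>

section \<open>Norms, paths and neighbourhoods\<close>

lemma maxnorm_le_iff: "maxnorm x \<le> c \<longleftrightarrow> (\<forall>s. x s \<le> c)" for x :: "'s::finite \<Rightarrow> real"
  by (auto simp: maxnorm_def)

lemma maxnorm_ge: "x s \<le> maxnorm x" for x :: "'s::finite \<Rightarrow> real"
  using maxnorm_le_iff[of x "maxnorm x"] by simp

lemma maxnorm_mono_dist: "maxnorm x \<le> maxnorm y + (\<Sum>s\<in>UNIV. \<bar>x s - y s\<bar>)"
  for x :: "'s::finite \<Rightarrow> real"
proof -
  have "x s \<le> maxnorm y + (\<Sum>s\<in>UNIV. \<bar>x s - y s\<bar>)" for s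
  proof -
    have "\<bar>x s - y s\<bar> \<le> (\<Sum>s\<in>UNIV. \<bar>x s - y s\<bar>)" by (rule member_le_sum) auto
    with maxnorm_ge[of y s] show ?thesis by linarith
  qed
  then show ?thesis by (simp add: maxnorm_le_iff)
qed

lemma maxnorm_scale: "0 < c \<Longrightarrow> maxnorm (\<lambda>s. c * x s) = c * maxnorm x" for x :: "'s::finite \<Rightarrow> real"
proof (rule antisym)
  assume c: "0 < c"
  show "maxnorm (\<lambda>s. c * x s) \<le> c * maxnorm x"
    using c by (simp add: maxnorm_le_iff maxnorm_ge)
  have "maxnorm x \<le> maxnorm (\<lambda>s. c * x s) / c"
    using c maxnorm_ge[of "\<lambda>s. c * x s"] by (auto simp: maxnorm_le_iff field_simps)
  then show "c * maxnorm x \<le> maxnorm (\<lambda>s. c * x s)"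
    using c by (simp add: field_simps)
qed

lemma maxnorm_divide: "0 < c \<Longrightarrow> maxnorm (\<lambda>s. x s / c) = maxnorm x / c" for x :: "'s::finite \<Rightarrow> real"
  using maxnorm_scale[of "1/c" x] by simp

lemma scale_in_cone: "0 \<le> c \<Longrightarrow> x \<in> nonneg_cone \<Longrightarrow> (\<lambda>s. c * x s) \<in> nonneg_cone"
  by (auto simp: nonneg_cone_def)

lemma divide_in_cone: "0 \<le> c \<Longrightarrow> x \<in> nonneg_cone \<Longrightarrow> (\<lambda>s. x s / c) \<in> nonneg_cone"
  by (auto simp: nonneg_cone_def)

lemma continuous_maxnorm: "continuous_on A (maxnorm :: ('s::finite \<Rightarrow> real) \<Rightarrow> real)"
proof -
  have *: "continuous_on A (\<lambda>x::'s \<Rightarrow> real. \<Sum>s\<in>UNIV. \<bar>x s - y s\<bar>)" for y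
    by (intro continuous_on_sum continuous_on_rabs continuous_on_diff continuous_on_const
          continuous_on_subset[OF continuous_on_product_coordinates subset_UNIV])
  show ?thesis
    unfolding continuous_on_def
  proof (rule ballI)
    fix y :: "'s \<Rightarrow> real" assume "y \<in> A"
    have lim: "((\<lambda>x. \<Sum>s\<in>UNIV. \<bar>x s - y s\<bar>) \<longlongrightarrow> 0) (at y within A)"
      using *[of y] \<open>y \<in> A\<close> by (auto simp: continuous_on_def dest!: bspec)
    have bound: "norm (maxnorm x - maxnorm y) \<le> (\<Sum>s\<in>UNIV. \<bar>x s - y s\<bar>)" for x :: "'s \<Rightarrow> real"
    proof -
      have "(\<Sum>s\<in>UNIV. \<bar>x s - y s\<bar>) = (\<Sum>s\<in>UNIV. \<bar>y s - x s\<bar>)"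
        by (simp add: abs_minus_commute)
      then show ?thesis
        using maxnorm_mono_dist[of x y] maxnorm_mono_dist[of y x] by auto
    qed
    have "((\<lambda>x. maxnorm x - maxnorm y) \<longlongrightarrow> 0) (at y within A)"
      by (rule Lim_null_comparison[OF always_eventually[OF allI[OF bound]] lim])
    then show "(maxnorm \<longlongrightarrow> maxnorm y) (at y within A)"
      by (simp add: LIM_zero_iff)
  qed
qed

lemma maxnorm_measurable [measurable]: "(maxnorm :: ('s::finite \<Rightarrow> real) \<Rightarrow> real) \<in> borel_measurable borel"
  by (intro borel_measurable_continuous_onI continuous_maxnorm)

lemma closed_nonneg_cone: "closed (nonneg_cone :: ('s \<Rightarrow> real) set)"
proof -
  have "nonneg_cone = (\<Inter>s. {x::'s \<Rightarrow> real. 0 \<le> x s})" by (auto simp: nonneg_cone_def)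
  also have "closed \<dots>"
    by (intro closed_INT ballI closed_Collect_le continuous_on_const continuous_on_product_coordinates)
  finally show ?thesis .
qed

lemma nonneg_cone_measurable [measurable]: "(nonneg_cone :: ('s \<Rightarrow> real) set) \<in> sets borel"
  by (rule borel_closed[OF closed_nonneg_cone])

lemma path_coordinate_measurable [measurable]:
  "(\<lambda>z :: int \<Rightarrow> 's::finite \<Rightarrow> real. z t) \<in> borel_measurable borel"
  by (intro borel_measurable_continuous_onI continuous_on_product_coordinates)

lemma coordinate_measurable [measurable (raw)]:
  "f \<in> M1 \<rightarrow>\<^sub>M (borel :: ('s::countable \<Rightarrow> real) measure) \<Longrightarrow> (\<lambda>\<omega>. f \<omega> s) \<in> borel_measurable M1"
  by (rule measurable_product_then_coordinatewise)

lemma path_measurable: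
  assumes "\<And>t. (\<lambda>\<omega>. F \<omega> t) \<in> borel_measurable N"
  shows "F \<in> N \<rightarrow>\<^sub>M (borel :: (int \<Rightarrow> 's::countable \<Rightarrow> real) measure)"
  using assms by (rule measurable_coordinatewise_then_product)

text \<open>
  A distance that only sees the coordinates in \<open>I\<close>, so that limits along the filter \<open>near\<close> are limits
  of finite-dimensional type. It is compatible with scaling, which the product of radius and
  direction requires.
\<close>

definition pdist :: "int set \<Rightarrow> (int \<Rightarrow> 's::finite \<Rightarrow> real) \<Rightarrow> (int \<Rightarrow> 's \<Rightarrow> real) \<Rightarrow> real" where
  "pdist I y z = (\<Sum>t\<in>I. \<Sum>s\<in>UNIV. \<bar>y t s - z t s\<bar>)"

definition nonneg_paths :: "(int \<Rightarrow> 's \<Rightarrow> real) set" where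
  "nonneg_paths = {z. \<forall>t. z t \<in> nonneg_cone}"

definition near :: "int set \<Rightarrow> (int \<Rightarrow> 's::finite \<Rightarrow> real) \<Rightarrow> (int \<Rightarrow> 's \<Rightarrow> real) filter" where
  "near I y = inf (filtercomap (pdist I y) (nhds 0)) (principal nonneg_paths)"

lemma pdist_nonneg [simp]: "0 \<le> pdist I y z"
  by (auto simp: pdist_def intro!: sum_nonneg)

lemma pdist_self [simp]: "pdist I y y = 0"
  by (simp add: pdist_def)

lemma pdist_commute: "pdist I y z = pdist I z y"
  by (simp add: pdist_def abs_minus_commute)

lemma pdist_triangle: "pdist I x z \<le> pdist I x y + pdist I y z"
proof -
  have "pdist I x z \<le> (\<Sum>t\<in>I. \<Sum>s\<in>UNIV. \<bar>x t s - y t s\<bar> + \<bar>y t s - z t s\<bar>)"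
    unfolding pdist_def by (intro sum_mono) linarith
  then show ?thesis by (simp add: pdist_def sum.distrib)
qed

lemma pdist_scale: "pdist I (\<lambda>t s. \<rho> * x t s) (\<lambda>t s. \<rho> * y t s) = \<bar>\<rho>\<bar> * pdist I x y"
  for x y :: "int \<Rightarrow> 's::finite \<Rightarrow> real"
  by (simp add: pdist_def sum_distrib_left abs_mult[symmetric] right_diff_distrib)

lemma eventually_near:
  "eventually Q (near I y) \<longleftrightarrow> (\<exists>\<delta>>0. \<forall>z\<in>nonneg_paths. pdist I y z < \<delta> \<longrightarrow> Q z)"
proof -
  have "eventually Q (near I y) \<longleftrightarrow> (\<exists>R. eventually R (nhds 0) \<and> (\<forall>z. R (pdist I y z) \<longrightarrow> z \<in> nonneg_paths \<longrightarrow> Q z))"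
    by (simp add: near_def eventually_inf_principal eventually_filtercomap)
  also have "\<dots> \<longleftrightarrow> (\<exists>\<delta>>0. \<forall>z\<in>nonneg_paths. pdist I y z < \<delta> \<longrightarrow> Q z)"
  proof safe
    fix R assume R: "eventually R (nhds 0)" "\<forall>z. R (pdist I y z) \<longrightarrow> z \<in> nonneg_paths \<longrightarrow> Q z"
    then obtain \<delta> where "\<delta> > 0" "\<And>x. dist x 0 < \<delta> \<Longrightarrow> R x"
      by (auto simp: eventually_nhds_metric)
    then show "\<exists>\<delta>>0. \<forall>z\<in>nonneg_paths. pdist I y z < \<delta> \<longrightarrow> Q z"
      using R(2) by (intro exI[of _ \<delta>]) auto
  next
    fix \<delta> :: real assume "\<delta> > 0" "\<forall>z\<in>nonneg_paths. pdist I y z < \<delta> \<longrightarrow> Q z"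
    then show "\<exists>R. eventually R (nhds 0) \<and> (\<forall>z. R (pdist I y z) \<longrightarrow> z \<in> nonneg_paths \<longrightarrow> Q z)"
      by (intro exI[of _ "\<lambda>x. x < \<delta>"]) (auto simp: eventually_nhds_metric dist_real_def intro!: exI[of _ \<delta>])
  qed
  finally show ?thesis .
qed

lemma tendsto_fun_iff:
  "((f :: 'x \<Rightarrow> 's \<Rightarrow> 'b::topological_space) \<longlongrightarrow> l) F \<longleftrightarrow> (\<forall>s. ((\<lambda>z. f z s) \<longlongrightarrow> l s) F)"
  using limitin_componentwise[of "\<lambda>_. euclidean :: 'b topology" "UNIV :: 's set" f l F]
  unfolding euclidean_product_topology limitin_canonical_iff by simp

lemma near_coordinate:
  assumes "finite I" "t \<in> I"
  shows "((\<lambda>z. z t) \<longlongrightarrow> y t) (near I y)"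
proof (subst tendsto_fun_iff, rule allI)
  fix s
  have "\<bar>y t s - z t s\<bar> \<le> pdist I y z" for z
  proof -
    have "\<bar>y t s - z t s\<bar> \<le> (\<Sum>s\<in>UNIV. \<bar>y t s - z t s\<bar>)" by (rule member_le_sum) auto
    also have "\<dots> \<le> pdist I y z" unfolding pdist_def
      using assms by (intro member_le_sum[of t I "\<lambda>t. \<Sum>s\<in>UNIV. \<bar>y t s - z t s\<bar>"]) (auto intro: sum_nonneg)
    finally show ?thesis .
  qed
  note bound = this
  show "((\<lambda>z. z t s) \<longlongrightarrow> y t s) (near I y)"
  proof (rule tendstoI)
    fix e :: real assume "e > 0"
    moreover have "dist (z t s) (y t s) < e" if "pdist I y z < e" for z
      using bound[of z] that by (simp add: dist_real_def abs_minus_commute)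
    ultimately show "\<forall>\<^sub>F z in near I y. dist (z t s) (y t s) < e"
      unfolding eventually_near by blast
  qed
qed

lemma near_paths: "\<forall>\<^sub>F z in near I y. z \<in> nonneg_paths"
  unfolding eventually_near by (rule exI[of _ 1]) simp

text \<open>
  Indicators of exceedance patterns are locally constant away from paths that touch the
  threshold. This is why all events below pass to the limit.
\<close>

lemma near_same_exceedances:
  assumes "finite I" "\<And>t. t \<in> I \<Longrightarrow> maxnorm (y t) \<noteq> 1"
  shows "\<forall>\<^sub>F z in near I y. \<forall>t\<in>I. 1 < maxnorm (z t) \<longleftrightarrow> 1 < maxnorm (y t)"
proof (rule eventually_ball_finite[OF assms(1)], rule ballI)
  fix t assume t: "t \<in> I"
  have lim: "((\<lambda>z. maxnorm (z t)) \<longlongrightarrow> maxnorm (y t)) (near I y)"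
    by (rule continuous_on_tendsto_compose[OF continuous_maxnorm[of UNIV] near_coordinate[OF assms(1) t]]) auto
  show "\<forall>\<^sub>F z in near I y. 1 < maxnorm (z t) \<longleftrightarrow> 1 < maxnorm (y t)"
  proof (cases "1 < maxnorm (y t)")
    case True
    with order_tendstoD(1)[OF lim this] show ?thesis by (auto elim: eventually_mono)
  next
    case False
    then have "maxnorm (y t) < 1" using assms(2)[OF t] by simp
    with order_tendstoD(2)[OF lim this] show ?thesis by (auto elim: eventually_mono)
  qed
qed

lemma ball_nat_int: "(\<forall>j\<in>{1..int k}. R j) \<longleftrightarrow> (\<forall>j\<in>{1..k}. R (int j))"
proof -
  have "{1..int k} = int ` {1..k}" by (simp add: image_int_atLeastAtMost)
  then show ?thesis by simp
qed

lemma tendsto_prob_all: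
  fixes N :: "'x measure" and Q :: "nat \<Rightarrow> 'x \<Rightarrow> bool"
  assumes "finite_measure N" "\<And>j. Measurable.pred N (Q j)"
  shows "(\<lambda>k. measure N {\<omega> \<in> space N. \<forall>j\<in>{1..k}. Q j \<omega>}) \<longlonglongrightarrow> measure N {\<omega> \<in> space N. \<forall>j\<ge>1. Q j \<omega>}"
proof -
  interpret finite_measure N by fact
  note [measurable] = assms(2)
  have "(\<lambda>k. measure N {\<omega> \<in> space N. \<forall>j\<in>{1..k}. Q j \<omega>}) \<longlonglongrightarrow> measure N (\<Inter>k. {\<omega> \<in> space N. \<forall>j\<in>{1..k}. Q j \<omega>})"
    by (rule finite_Lim_measure_decseq) (auto simp: decseq_def)
  also have "(\<Inter>k. {\<omega> \<in> space N. \<forall>j\<in>{1..k}. Q j \<omega>}) = {\<omega> \<in> space N. \<forall>j\<ge>1. Q j \<omega>}"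
  proof -
    have "(\<forall>k. \<forall>j\<in>{1..k}. R j) \<longleftrightarrow> (\<forall>j\<ge>1. R j)" for R :: "nat \<Rightarrow> bool"
      by (meson atLeastAtMost_iff order_refl)
    note this[of "\<lambda>j. Q j \<omega>" for \<omega>]
    then show ?thesis unfolding set_eq_iff INT_iff mem_Collect_eq by blast
  qed
  finally show ?thesis .
qed

section \<open>Lipschitz envelopes\<close>

text \<open>
  The largest lower bound of all functions \<open>\<Phi> n\<close>, \<open>n \<ge> N\<close>, that has Lipschitz constant \<open>N\<close>,
  evaluated at \<open>\<rho> * \<theta>\<close> and minimised over the radii \<open>\<rho>\<close> of the cell \<open>{lo..hi}\<close>. It depends on the
  direction \<open>\<theta>\<close> alone, and \<open>B\<close> is inserted to keep it bounded off the nonnegative paths.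
\<close>

definition envelope ::
    "(nat \<Rightarrow> (int \<Rightarrow> 's::finite \<Rightarrow> real) \<Rightarrow> real) \<Rightarrow> int set \<Rightarrow> real \<Rightarrow> nat \<Rightarrow> real \<Rightarrow> real \<Rightarrow>
     (int \<Rightarrow> 's \<Rightarrow> real) \<Rightarrow> real" where
  "envelope \<Phi> I B N lo hi \<theta> =
     Inf (insert B {\<Phi> n z + real N * pdist I (\<lambda>t s. \<rho> * \<theta> t s) z |n z \<rho>.
       N \<le> n \<and> z \<in> nonneg_paths \<and> lo \<le> \<rho> \<and> \<rho> \<le> hi})"

context
  fixes \<Phi> :: "nat \<Rightarrow> (int \<Rightarrow> 's::finite \<Rightarrow> real) \<Rightarrow> real" and I :: "int set" and B :: real
  assumes \<Phi>_nonneg: "\<And>n z. z \<in> nonneg_paths \<Longrightarrow> 0 \<le> \<Phi> n z" and B_nonneg: "0 \<le> B"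
begin

lemma envelope_bdd:
  "bdd_below (insert B {\<Phi> n z + real N * pdist I (\<lambda>t s. \<rho> * \<theta> t s) z |n z \<rho>.
       N \<le> n \<and> z \<in> nonneg_paths \<and> lo \<le> \<rho> \<and> \<rho> \<le> hi})"
  using B_nonneg \<Phi>_nonneg by (auto intro!: bdd_belowI[where m=0] add_nonneg_nonneg)

lemma envelope_le:
  "\<lbrakk>N \<le> n; z \<in> nonneg_paths; lo \<le> \<rho>; \<rho> \<le> hi\<rbrakk> \<Longrightarrow>
    envelope \<Phi> I B N lo hi \<theta> \<le> \<Phi> n z + real N * pdist I (\<lambda>t s. \<rho> * \<theta> t s) z"
  unfolding envelope_def by (rule cInf_lower[OF _ envelope_bdd]) blast

lemma envelope_le_bound: "envelope \<Phi> I B N lo hi \<theta> \<le> B"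
  unfolding envelope_def by (rule cInf_lower[OF _ envelope_bdd]) blast

lemma envelope_ge:
  assumes "c \<le> B"
    and "\<And>n z \<rho>. \<lbrakk>N \<le> n; z \<in> nonneg_paths; lo \<le> \<rho>; \<rho> \<le> hi\<rbrakk> \<Longrightarrow>
           c \<le> \<Phi> n z + real N * pdist I (\<lambda>t s. \<rho> * \<theta> t s) z"
  shows "c \<le> envelope \<Phi> I B N lo hi \<theta>"
  unfolding envelope_def using assms by (intro cInf_greatest) auto

lemma envelope_nonneg: "0 \<le> envelope \<Phi> I B N lo hi \<theta>"
  by (rule envelope_ge) (auto simp: B_nonneg \<Phi>_nonneg)

lemma envelope_lipschitz:
  assumes "0 \<le> lo" "lo \<le> hi"
  shows "envelope \<Phi> I B N lo hi \<theta> - envelope \<Phi> I B N lo hi \<theta>' \<le> real N * hi * pdist I \<theta> \<theta>'"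
proof -
  have "envelope \<Phi> I B N lo hi \<theta> - real N * hi * pdist I \<theta> \<theta>' \<le> envelope \<Phi> I B N lo hi \<theta>'"
  proof (rule envelope_ge)
    have "0 \<le> real N * hi * pdist I \<theta> \<theta>'" using assms by simp
    then show "envelope \<Phi> I B N lo hi \<theta> - real N * hi * pdist I \<theta> \<theta>' \<le> B"
      using envelope_le_bound[of N lo hi \<theta>] by linarith
  next
    fix n \<rho> and z :: "int \<Rightarrow> 's \<Rightarrow> real" assume *: "N \<le> n" "z \<in> nonneg_paths" "lo \<le> \<rho>" "\<rho> \<le> hi"
    have "pdist I (\<lambda>t s. \<rho> * \<theta> t s) z \<le>
        pdist I (\<lambda>t s. \<rho> * \<theta> t s) (\<lambda>t s. \<rho> * \<theta>' t s) + pdist I (\<lambda>t s. \<rho> * \<theta>' t s) z"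
      by (rule pdist_triangle)
    moreover have "pdist I (\<lambda>t s. \<rho> * \<theta> t s) (\<lambda>t s. \<rho> * \<theta>' t s) \<le> hi * pdist I \<theta> \<theta>'"
      using * assms by (simp add: pdist_scale mult_right_mono)
    ultimately have "real N * pdist I (\<lambda>t s. \<rho> * \<theta> t s) z \<le>
        real N * (hi * pdist I \<theta> \<theta>' + pdist I (\<lambda>t s. \<rho> * \<theta>' t s) z)"
      by (intro mult_left_mono) auto
    then show "envelope \<Phi> I B N lo hi \<theta> - real N * hi * pdist I \<theta> \<theta>' \<le>
        \<Phi> n z + real N * pdist I (\<lambda>t s. \<rho> * \<theta>' t s) z"
      using envelope_le[OF *, of \<theta>] by (simp add: algebra_simps)
  qed
  then show ?thesis by simp
qed

end

lemma continuous_on_if_pdist_lipschitz: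
  fixes h :: "(int \<Rightarrow> 's::finite \<Rightarrow> real) \<Rightarrow> real"
  assumes lip: "\<And>x y. h x - h y \<le> L * pdist I x y"
  shows "continuous_on UNIV h"
  unfolding continuous_on_def
proof (rule ballI)
  fix y :: "int \<Rightarrow> 's \<Rightarrow> real"
  have coord: "continuous_on UNIV (\<lambda>x :: int \<Rightarrow> 's \<Rightarrow> real. x t s)" for t s
    by (rule continuous_on_product_then_coordinatewise[OF continuous_on_product_coordinates])
  have "continuous_on UNIV (\<lambda>x. L * pdist I x y)"
    unfolding pdist_def
    by (intro continuous_on_mult continuous_on_sum continuous_on_rabs continuous_on_diff
        continuous_on_const coord)
  then have "((\<lambda>x. L * pdist I x y) \<longlongrightarrow> L * pdist I y y) (at y within UNIV)"
    unfolding continuous_on_def by blast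
  then have lim: "((\<lambda>x. L * pdist I x y) \<longlongrightarrow> 0) (at y within UNIV)"
    by simp
  have bound: "norm (h x - h y) \<le> L * pdist I x y" for x
    using lip[of x y] lip[of y x] by (auto simp: pdist_commute[of I y x])
  have "((\<lambda>x. h x - h y) \<longlongrightarrow> 0) (at y within UNIV)"
    by (rule Lim_null_comparison[OF always_eventually[OF allI[OF bound]] lim])
  then show "(h \<longlongrightarrow> h y) (at y within UNIV)"
    by (simp add: LIM_zero_iff)
qed

lemma pdist_cong: "(\<And>t. t \<in> I \<Longrightarrow> x t = x' t) \<Longrightarrow> pdist I x y = pdist I x' y"
  by (simp add: pdist_def)

lemma envelope_cong:
  assumes "\<And>t. t \<in> I \<Longrightarrow> x t = x' t"
  shows "envelope \<Phi> I B N lo hi x = envelope \<Phi> I B N lo hi x'"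
proof -
  have "pdist I (\<lambda>t s. \<rho> * x t s) z = pdist I (\<lambda>t s. \<rho> * x' t s) z" for \<rho> z
    by (rule pdist_cong) (simp add: assms)
  then show ?thesis by (simp add: envelope_def)
qed

text \<open>
  Weak convergence of the spectral process is tested against functions on the product over the
  window only; this transfers continuity from the space of all paths.
\<close>

lemma continuous_map_restricted_window:
  fixes h :: "(int \<Rightarrow> 's::finite \<Rightarrow> real) \<Rightarrow> real"
  assumes "continuous_on UNIV h"
  shows "continuous_map (product_topology (\<lambda>_. top_of_set C) I) euclideanreal h"
proof -
  let ?T = "product_topology (\<lambda>_. top_of_set C) I :: (int \<Rightarrow> 's \<Rightarrow> real) topology"
  have "continuous_map ?T euclidean (\<lambda>z. z k)" for k
  proof (cases "k \<in> I")
    case True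
    then show ?thesis
      using continuous_map_product_projection[of k I "\<lambda>_. top_of_set C"]
      by (simp add: continuous_map_in_subtopology)
  next
    case False
    have "continuous_map ?T euclidean (\<lambda>z. undefined)" by simp
    then show ?thesis
      by (rule continuous_map_eq) (use False in \<open>auto simp: PiE_def extensional_def\<close>)
  qed
  then have "continuous_map ?T (product_topology (\<lambda>_. euclidean) UNIV) (\<lambda>z. z)"
    by (subst continuous_map_componentwise_UNIV) blast
  then have "continuous_map ?T euclidean (\<lambda>z. z)"
    by (simp only: euclidean_product_topology)
  then have "continuous_map ?T euclideanreal (h \<circ> (\<lambda>z. z))"
    by (rule continuous_map_compose) (use assms in simp)
  then show ?thesis by (simp add: comp_def)
qed

text \<open>
  Independence of a real variable and a path-valued one is reduced to independence of two real
  variables, for which product formulas are available.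
\<close>

lemma indep_var_path_functional:
  fixes H :: "(int \<Rightarrow> 's::finite \<Rightarrow> real) \<Rightarrow> real" and P :: "'p \<Rightarrow> real"
  assumes "prob_space M'" and ind: "independent M' borel P path_space F"
    and H: "H \<in> borel_measurable path_space"
  shows "prob_space.indep_var M' borel P borel (\<lambda>\<omega>. H (F \<omega>))"
proof -
  interpret prob_space M' by fact
  have P: "P \<in> borel_measurable M'" and F: "F \<in> M' \<rightarrow>\<^sub>M path_space"
    and s: "indep_set {P -` C \<inter> space M' |C. C \<in> sets borel} {F -` C \<inter> space M' |C. C \<in> sets path_space}"
    using ind by (auto simp: independent_def)
  have HF: "(\<lambda>\<omega>. H (F \<omega>)) \<in> borel_measurable M'"
    by (rule measurable_compose[OF F H])
  have sub: "{(\<lambda>\<omega>. H (F \<omega>)) -` C \<inter> space M' |C. C \<in> sets borel} \<subseteq> {F -` C \<inter> space M' |C. C \<in> sets path_space}"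
  proof clarify
    fix C :: "real set" assume C: "C \<in> sets borel"
    have "(\<lambda>\<omega>. H (F \<omega>)) -` C \<inter> space M' = F -` (H -` C \<inter> space path_space) \<inter> space M'"
      using measurable_space[OF F] by auto
    then show "\<exists>Ca. (\<lambda>\<omega>. H (F \<omega>)) -` C \<inter> space M' = F -` Ca \<inter> space M' \<and> Ca \<in> sets path_space"
      using measurable_sets[OF H C] by blast
  qed
  have "indep_set (sigma_sets (space M') {P -` C \<inter> space M' |C. C \<in> sets borel})
      (sigma_sets (space M') {(\<lambda>\<omega>. H (F \<omega>)) -` C \<inter> space M' |C. C \<in> sets borel})"
  proof (rule indep_set_sigma_sets)
    show "indep_set {P -` C \<inter> space M' |C. C \<in> sets borel} {(\<lambda>\<omega>. H (F \<omega>)) -` C \<inter> space M' |C. C \<in> sets borel}"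
      using s unfolding indep_set_def
      by (rule indep_sets_mono_sets) (use sub in \<open>simp split: bool.split\<close>)
    have stable: "Int_stable {f -` C \<inter> space M' |C. C \<in> sets borel}" for f :: "'p \<Rightarrow> real"
    proof (rule Int_stableI, clarify)
      fix C D :: "real set" assume "C \<in> sets borel" "D \<in> sets borel"
      then show "\<exists>Ca. f -` C \<inter> space M' \<inter> (f -` D \<inter> space M') = f -` Ca \<inter> space M' \<and> Ca \<in> sets borel"
        by (intro exI[of _ "C \<inter> D"]) auto
    qed
    show "Int_stable {P -` C \<inter> space M' |C. C \<in> sets borel}"
      "Int_stable {(\<lambda>\<omega>. H (F \<omega>)) -` C \<inter> space M' |C. C \<in> sets borel}"
      by (rule stable)+
  qed
  then show ?thesis
    unfolding indep_var_eq using P HF by simp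
qed


lemma integral_uniform_measure:
  fixes H :: "'x \<Rightarrow> real"
  assumes A: "A \<in> sets N" "emeasure N A \<noteq> \<infinity>" "0 < measure N A" and H: "H \<in> borel_measurable N"
  shows "(\<integral>x. H x \<partial>uniform_measure N A) = (\<integral>x. H x * indicator A x \<partial>N) / measure N A"
proof -
  have "emeasure N A = ennreal (measure N A)"
    using A(2) by (simp add: emeasure_eq_ennreal_measure top.not_eq_extremum)
  then have "uniform_measure N A = density N (\<lambda>x. ennreal (indicator A x / measure N A))"
    unfolding uniform_measure_def using A
    by (intro density_cong)
      (auto simp: divide_ennreal[of 1, simplified] split: split_indicator)
  then have "(\<integral>x. H x \<partial>uniform_measure N A) = (\<integral>x. (indicator A x / measure N A) * H x \<partial>N)"
    using A H by (simp add: integral_real_density)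
  also have "\<dots> = (\<integral>x. H x * indicator A x / measure N A \<partial>N)"
    by (simp add: mult.commute)
  finally show ?thesis by simp
qed

section \<open>Regularly varying series and their tail process\<close>

locale regular_tail =
  fixes M :: "'w measure" and X :: "int \<Rightarrow> 'w \<Rightarrow> 's::finite \<Rightarrow> real" and \<alpha> :: real
    and M' :: "'p measure" and \<Theta> :: "int \<Rightarrow> 'p \<Rightarrow> 's \<Rightarrow> real" and P :: "'p \<Rightarrow> real"
    and Y :: "int \<Rightarrow> 'p \<Rightarrow> 's \<Rightarrow> real"
  assumes series: "time_series M X"
    and stationary: "strictly_stationary M X"
    and regular: "jointly_regularly_varying M X \<alpha>"
    and spectral: "spectral_tail_process M X M' \<Theta>"
    and pareto: "pareto \<alpha> M' P"
    and indep: "independent M' borel P path_space (\<lambda>\<omega> t. \<Theta> t \<omega>)"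
    and tail: "\<forall>t. \<forall>\<omega>\<in>space M'. Y t \<omega> = (\<lambda>s. P \<omega> * \<Theta> t \<omega> s)"
begin

sublocale M: prob_space M
  using series by (simp add: time_series_def)

sublocale M': prob_space M'
  using spectral by (simp add: spectral_tail_process_def time_series_def)

lemma X_cone: "\<omega> \<in> space M \<Longrightarrow> X t \<omega> \<in> nonneg_cone"
  using series by (auto simp: time_series_def space_restrict_space dest!: spec[of _ t] measurable_space)

lemma X_measurable [measurable]: "X t \<in> borel_measurable M"
  using series by (auto simp: time_series_def measurable_restrict_space2_iff)

lemma \<Theta>_cone: "\<omega> \<in> space M' \<Longrightarrow> \<Theta> t \<omega> \<in> nonneg_cone"
  using spectral
  by (auto simp: spectral_tail_process_def time_series_def space_restrict_space dest!: spec[of _ t] measurable_space)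

lemma \<Theta>_measurable [measurable]: "\<Theta> t \<in> borel_measurable M'"
  using spectral by (auto simp: spectral_tail_process_def time_series_def measurable_restrict_space2_iff)

lemma P_measurable [measurable]: "P \<in> borel_measurable M'"
  using pareto by (simp add: pareto_def)

lemma Y_measurable [measurable]: "Y t \<in> borel_measurable M'"
proof -
  have "(\<lambda>\<omega> s. P \<omega> * \<Theta> t \<omega> s) \<in> borel_measurable M'"
    by (rule measurable_coordinatewise_then_product) measurable
  then show ?thesis
    by (rule measurable_cong[THEN iffD1, rotated]) (use tail in auto)
qed

definition tailp :: "real \<Rightarrow> real" where
  "tailp x = measure M {\<omega> \<in> space M. x < maxnorm (X 0 \<omega>)}"

abbreviation exc :: "real \<Rightarrow> 'w set" where
  "exc x \<equiv> {\<omega> \<in> space M. x < maxnorm (X 0 \<omega>)}"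

lemma tailp_mono: "x \<le> y \<Longrightarrow> tailp y \<le> tailp x"
  unfolding tailp_def by (rule M.finite_measure_mono) auto

lemma tailp_ratio_gt:
  assumes "1 < y"
  shows "((\<lambda>x. tailp (x * y) / tailp x) \<longlongrightarrow> y powr (- \<alpha>)) at_top"
proof -
  have lim: "((\<lambda>x. \<P>(\<omega> in M. maxnorm (X 0 \<omega>) > x * y \<bar> maxnorm (X 0 \<omega>) > x)) \<longlongrightarrow> y powr (- \<alpha>)) at_top"
    using regular assms by (simp add: jointly_regularly_varying_def)
  show ?thesis
  proof (rule Lim_transform_eventually[OF lim])
    show "\<forall>\<^sub>F x in at_top. \<P>(\<omega> in M. maxnorm (X 0 \<omega>) > x * y \<bar> maxnorm (X 0 \<omega>) > x) = tailp (x * y) / tailp x"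
      using eventually_ge_at_top[of 0]
    proof eventually_elim
      fix x :: real assume x: "0 \<le> x"
      have "x < maxnorm (X 0 \<omega>)" if "x * y < maxnorm (X 0 \<omega>)" for \<omega>
        using that assms x mult_left_mono[of 1 y x] by simp
      then have "{\<omega> \<in> space M. x * y < maxnorm (X 0 \<omega>) \<and> x < maxnorm (X 0 \<omega>)} = exc (x * y)"
        by auto
      then show "\<P>(\<omega> in M. maxnorm (X 0 \<omega>) > x * y \<bar> maxnorm (X 0 \<omega>) > x) = tailp (x * y) / tailp x"
        by (simp add: cond_prob_def tailp_def)
    qed
  qed
qed

text \<open>
  The limit \<open>t powr - \<alpha>\<close> of the ratios is positive, which rules out that \<open>\<parallel>X 0\<parallel>\<close> is bounded.
\<close>

lemma tailp_pos: "0 < tailp x"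
proof -
  have "\<forall>\<^sub>F x in at_top. 0 < tailp (x * 2) / tailp x"
    using order_tendstoD(1)[OF tailp_ratio_gt[of 2], of 0] by simp
  then obtain N where N: "\<And>x. N \<le> x \<Longrightarrow> 0 < tailp (x * 2) / tailp x"
    by (auto simp: eventually_at_top_linorder)
  have "0 < tailp (max x N)"
  proof (rule ccontr)
    assume "\<not> 0 < tailp (max x N)"
    then have "tailp (max x N) = 0" by (simp add: tailp_def zero_less_measure_iff measure_nonneg antisym)
    with N[of "max x N"] show False by simp
  qed
  with tailp_mono[of x "max x N"] show ?thesis by simp
qed

lemma tailp_ratio:
  assumes "1 \<le> y"
  shows "((\<lambda>x. tailp (x * y) / tailp x) \<longlongrightarrow> y powr (- \<alpha>)) at_top"
proof (cases "y = 1")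
  case True
  have "tailp x / tailp x = 1" for x using tailp_pos[of x] by simp
  then show ?thesis using True by simp
next
  case False
  then show ?thesis using assms by (intro tailp_ratio_gt) simp
qed

definition direction :: "'w \<Rightarrow> int \<Rightarrow> 's \<Rightarrow> real" where
  "direction \<omega> = (\<lambda>t s. X t \<omega> s / maxnorm (X 0 \<omega>))"

lemma direction_measurable [measurable]: "direction \<in> borel_measurable M"
proof -
  have "(\<lambda>\<omega>. direction \<omega> t) \<in> borel_measurable M" for t
    unfolding direction_def by (rule measurable_coordinatewise_then_product) measurable
  then show ?thesis by (rule path_measurable)
qed

lemma \<Theta>_path_measurable [measurable]: "(\<lambda>\<omega> t. \<Theta> t \<omega>) \<in> borel_measurable M'"
  by (rule path_measurable) measurable

lemma Y_path_measurable [measurable]: "(\<lambda>\<omega> t. Y t \<omega>) \<in> borel_measurable M'"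
  by (rule path_measurable) measurable

lemma integral_conditioned:
  assumes H: "H \<in> borel_measurable M"
  shows "(\<integral>\<omega>. H \<omega> \<partial>uniform_measure M (exc x)) = (\<integral>\<omega>. H \<omega> * indicator (exc x) \<omega> \<partial>M) / tailp x"
  using integral_uniform_measure[OF _ _ _ H, of "exc x"] tailp_pos[of x] by (simp add: tailp_def)

lemma direction_limit:
  assumes h: "continuous_on UNIV h" "\<And>z. \<bar>h z\<bar> \<le> (B::real)"
    and local: "\<And>z z'. (\<And>t. t \<in> {-m..m} \<Longrightarrow> z t = z' t) \<Longrightarrow> h z = h z'" and m: "1 \<le> (m::int)"
  shows "((\<lambda>x. (\<integral>\<omega>. h (direction \<omega>) * indicator (exc x) \<omega> \<partial>M) / tailp x)
           \<longlongrightarrow> (\<integral>\<omega>. h (\<lambda>t. \<Theta> t \<omega>) \<partial>M')) at_top"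
proof -
  have [measurable]: "h \<in> borel_measurable borel"
    using h(1) by (rule borel_measurable_continuous_onI)
  have "bounded (range h)" using h(2) by (auto simp: bounded_iff)
  moreover have "continuous_map (product_topology (\<lambda>_. top_of_set nonneg_cone) {-m..m}) euclideanreal h"
    by (rule continuous_map_restricted_window[OF h(1)])
  ultimately have "((\<lambda>x. \<integral>\<omega>. h (\<lambda>t\<in>{-m..m}. \<lambda>s. X t \<omega> s / maxnorm (X 0 \<omega>)) \<partial>uniform_measure M (exc x))
           \<longlongrightarrow> (\<integral>\<omega>. h (\<lambda>t\<in>{-m..m}. \<Theta> t \<omega>) \<partial>M')) at_top"
    using spectral m unfolding spectral_tail_process_def by (auto dest!: spec[of _ "-m"] spec[of _ m])
  moreover have "h (\<lambda>t\<in>{-m..m}. \<lambda>s. X t \<omega> s / maxnorm (X 0 \<omega>)) = h (direction \<omega>)" for \<omega>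
    by (rule local) (simp add: direction_def)
  moreover have "h (\<lambda>t\<in>{-m..m}. \<Theta> t \<omega>) = h (\<lambda>t. \<Theta> t \<omega>)" for \<omega>
    by (rule local) simp
  ultimately show ?thesis
    by (simp add: integral_conditioned)
qed

lemma pareto_tail: "1 \<le> y \<Longrightarrow> measure M' {\<omega> \<in> space M'. y < P \<omega>} = y powr (- \<alpha>)"
  using pareto by (simp add: pareto_def)

lemma P_gt_1: "AE \<omega> in M'. 1 < P \<omega>"
  using pareto_tail[of 1] by (simp add: M'.prob_eq_1[symmetric] M'.prob_Collect_eq_1[symmetric])

lemma pareto_cell:
  assumes "1 \<le> y" "y \<le> y'"
  shows "measure M' {\<omega> \<in> space M'. y < P \<omega> \<and> P \<omega> \<le> y'} = y powr (- \<alpha>) - y' powr (- \<alpha>)"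
proof -
  have "{\<omega> \<in> space M'. y < P \<omega> \<and> P \<omega> \<le> y'} = {\<omega> \<in> space M'. y < P \<omega>} - {\<omega> \<in> space M'. y' < P \<omega>}"
    by auto
  also have "measure M' \<dots> = y powr (- \<alpha>) - y' powr (- \<alpha>)"
    using assms by (subst M'.finite_measure_Diff) (auto simp: pareto_tail)
  finally show ?thesis .
qed

lemma indep_functional:
  assumes "H \<in> borel_measurable borel"
  shows "prob_space.indep_var M' borel P borel (\<lambda>\<omega>. H (\<lambda>t. \<Theta> t \<omega>) :: real)"
proof (rule indep_var_path_functional[OF M'.prob_space_axioms indep])
  have "sets (path_space :: (int \<Rightarrow> 's \<Rightarrow> real) measure) = sets borel"
    by (rule sets_PiM_equal_borel)
  then show "H \<in> borel_measurable path_space"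
    using assms measurable_cong_sets by blast
qed

lemma integral_cell:
  assumes H: "H \<in> borel_measurable borel" "\<And>z. \<bar>H z\<bar> \<le> (B::real)" and y: "1 \<le> y" "y \<le> y'"
  shows "(\<integral>\<omega>. H (\<lambda>t. \<Theta> t \<omega>) * indicator {y<..y'} (P \<omega>) \<partial>M') =
    (y powr (- \<alpha>) - y' powr (- \<alpha>)) * (\<integral>\<omega>. H (\<lambda>t. \<Theta> t \<omega>) \<partial>M')"
proof -
  have [measurable]: "(\<lambda>\<omega>. H (\<lambda>t. \<Theta> t \<omega>)) \<in> borel_measurable M'"
    by (rule measurable_compose[OF \<Theta>_path_measurable H(1)])
  have "M'.indep_var borel ((indicator {y<..y'} :: real \<Rightarrow> real) \<circ> P) borel ((\<lambda>x. x) \<circ> (\<lambda>\<omega>. H (\<lambda>t. \<Theta> t \<omega>)))"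
    by (rule M'.indep_var_compose[OF indep_functional[OF H(1)]]) auto
  then have ind: "M'.indep_var borel (\<lambda>\<omega>. indicator {y<..y'} (P \<omega>) :: real) borel (\<lambda>\<omega>. H (\<lambda>t. \<Theta> t \<omega>))"
    by (simp add: comp_def)
  have "integrable M' (\<lambda>\<omega>. H (\<lambda>t. \<Theta> t \<omega>))"
    by (rule M'.integrable_const_bound[where B=B]) (auto simp: H(2))
  moreover have "integrable M' (\<lambda>\<omega>. indicator {y<..y'} (P \<omega>) :: real)"
    by (rule M'.integrable_const_bound[where B=1]) auto
  ultimately have "(\<integral>\<omega>. indicator {y<..y'} (P \<omega>) * H (\<lambda>t. \<Theta> t \<omega>) \<partial>M') =
      (\<integral>\<omega>. indicator {y<..y'} (P \<omega>) \<partial>M') * (\<integral>\<omega>. H (\<lambda>t. \<Theta> t \<omega>) \<partial>M')"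
    by (intro M'.indep_var_lebesgue_integral ind)
  moreover have "(\<integral>\<omega>. indicator {y<..y'} (P \<omega>) \<partial>M') = measure M' {\<omega> \<in> space M'. y < P \<omega> \<and> P \<omega> \<le> y'}"
  proof -
    have "(\<integral>\<omega>. indicator {y<..y'} (P \<omega>) \<partial>M') = (\<integral>\<omega>. indicator {\<omega> \<in> space M'. y < P \<omega> \<and> P \<omega> \<le> y'} \<omega> \<partial>M' :: real)"
      by (rule Bochner_Integration.integral_cong) (auto split: split_indicator)
    then show ?thesis by simp
  qed
  ultimately show ?thesis
    using pareto_cell[OF y] by (simp add: mult.commute)
qed

text \<open>
  Joint convergence of direction and radius. Conditioning the direction on the higher threshold
  \<open>c n * y\<close> does not change its limit law, while the ratio of the two exceedance probabilities
  tends to \<open>y powr - \<alpha>\<close>; the product of both limits is the independent law of \<open>\<Theta>\<close> and \<open>P\<close>.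
\<close>

lemma cell_limit:
  assumes h: "continuous_on UNIV h" "\<And>z. \<bar>h z\<bar> \<le> (B::real)"
    and local: "\<And>z z'. (\<And>t. t \<in> {-m..m} \<Longrightarrow> z t = z' t) \<Longrightarrow> h z = h z'" and m: "1 \<le> (m::int)"
    and y: "1 \<le> y" "y \<le> y'" and c: "filterlim c at_top sequentially"
  shows "(\<lambda>n. (\<integral>\<omega>. h (direction \<omega>) * indicator {c n * y<..c n * y'} (maxnorm (X 0 \<omega>)) \<partial>M) / tailp (c n))
           \<longlonglongrightarrow> (\<integral>\<omega>. h (\<lambda>t. \<Theta> t \<omega>) * indicator {y<..y'} (P \<omega>) \<partial>M')"
proof -
  have [measurable]: "h \<in> borel_measurable borel"
    using h(1) by (rule borel_measurable_continuous_onI)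
  define E where "E x = (\<integral>\<omega>. h (direction \<omega>) * indicator (exc x) \<omega> \<partial>M)" for x
  have int: "integrable M (\<lambda>\<omega>. h (direction \<omega>) * indicator (exc x) \<omega>)" for x
    by (rule M.integrable_const_bound[where B=B])
      (use h(2) in \<open>auto simp: abs_mult split: split_indicator intro: order_trans[OF _ h(2)]\<close>)
  have above: "((\<lambda>x. E (x * y) / tailp x) \<longlongrightarrow> (\<integral>\<omega>. h (\<lambda>t. \<Theta> t \<omega>) \<partial>M') * y powr (- \<alpha>)) at_top"
    if y: "1 \<le> y" for y
  proof -
    have "filterlim (\<lambda>x. x * y) at_top at_top"
      using y by (intro filterlim_at_top_mult_tendsto_pos[OF tendsto_const]) (auto simp: filterlim_ident)
    then have "((\<lambda>x. E (x * y) / tailp (x * y)) \<longlongrightarrow> (\<integral>\<omega>. h (\<lambda>t. \<Theta> t \<omega>) \<partial>M')) at_top"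
      using filterlim_compose[OF direction_limit[OF h local m]] unfolding E_def by blast
    from tendsto_mult[OF this tailp_ratio[OF y]] show ?thesis
      using tailp_pos by (simp add: less_imp_neq[symmetric])
  qed
  have "((\<lambda>x. E (x * y) / tailp x - E (x * y') / tailp x) \<longlongrightarrow>
      (\<integral>\<omega>. h (\<lambda>t. \<Theta> t \<omega>) \<partial>M') * y powr (- \<alpha>) - (\<integral>\<omega>. h (\<lambda>t. \<Theta> t \<omega>) \<partial>M') * y' powr (- \<alpha>)) at_top"
    using y by (intro tendsto_diff above) auto
  from filterlim_compose[OF this c]
  have lim: "(\<lambda>n. E (c n * y) / tailp (c n) - E (c n * y') / tailp (c n)) \<longlonglongrightarrow>
      (\<integral>\<omega>. h (\<lambda>t. \<Theta> t \<omega>) * indicator {y<..y'} (P \<omega>) \<partial>M')"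
    by (subst integral_cell[OF _ h(2) y]) (simp_all add: algebra_simps)
  show ?thesis
  proof (rule Lim_transform_eventually[OF lim])
    have "\<forall>\<^sub>F n in sequentially. 0 \<le> c n" using c by (simp add: filterlim_at_top)
    then show "\<forall>\<^sub>F n in sequentially. E (c n * y) / tailp (c n) - E (c n * y') / tailp (c n) =
        (\<integral>\<omega>. h (direction \<omega>) * indicator {c n * y<..c n * y'} (maxnorm (X 0 \<omega>)) \<partial>M) / tailp (c n)"
    proof eventually_elim
      fix n assume "0 \<le> c n"
      then have "c n * y \<le> c n * y'" using y by (simp add: mult_left_mono)
      then have "E (c n * y) - E (c n * y') =
          (\<integral>\<omega>. h (direction \<omega>) * indicator {c n * y<..c n * y'} (maxnorm (X 0 \<omega>)) \<partial>M)"
        unfolding E_def Bochner_Integration.integral_diff[OF int int, symmetric]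
        by (intro Bochner_Integration.integral_cong) (auto split: split_indicator)
      then show "E (c n * y) / tailp (c n) - E (c n * y') / tailp (c n) =
        (\<integral>\<omega>. h (direction \<omega>) * indicator {c n * y<..c n * y'} (maxnorm (X 0 \<omega>)) \<partial>M) / tailp (c n)"
        by (simp add: diff_divide_distrib[symmetric])
    qed
  qed
qed

section \<open>Convergence of functionals to the tail process\<close>

definition scaled :: "real \<Rightarrow> 'w \<Rightarrow> int \<Rightarrow> 's \<Rightarrow> real" where
  "scaled c \<omega> = (\<lambda>t s. X t \<omega> s / c)"

abbreviation exc_mean :: "real \<Rightarrow> ((int \<Rightarrow> 's \<Rightarrow> real) \<Rightarrow> real) \<Rightarrow> real" where
  "exc_mean c \<Phi> \<equiv> (\<integral>\<omega>. \<Phi> (scaled c \<omega>) * indicator (exc c) \<omega> \<partial>M) / tailp c"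

abbreviation exc_prob :: "real \<Rightarrow> ('w \<Rightarrow> bool) \<Rightarrow> real" where
  "exc_prob c Q \<equiv> measure M {\<omega> \<in> space M. Q \<omega> \<and> c < maxnorm (X 0 \<omega>)} / tailp c"

lemma scaled_measurable [measurable]: "scaled c \<in> borel_measurable M"
proof -
  have "(\<lambda>\<omega>. scaled c \<omega> t) \<in> borel_measurable M" for t
    unfolding scaled_def by (rule measurable_coordinatewise_then_product) measurable
  then show ?thesis by (rule path_measurable)
qed

lemma scaled_paths: "0 < c \<Longrightarrow> \<omega> \<in> space M \<Longrightarrow> scaled c \<omega> \<in> nonneg_paths"
  using X_cone by (auto simp: nonneg_paths_def scaled_def intro!: divide_in_cone)

text \<open>
  The radial axis above \<open>1\<close> is cut into \<open>N\<^sup>2\<close> cells of length \<open>1/N\<close>. On each cell \<open>\<Phi> n\<close> is bounded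
  below by an envelope of the direction, to which \<open>cell_limit\<close> applies. As \<open>N\<close> grows, the
  resulting lower bound \<open>\<Psi> N\<close> recovers \<open>\<Phi>'\<close> wherever \<open>\<Phi> n\<close> converges to \<open>\<Phi>'\<close> continuously: a path that is
  \<open>\<delta>\<close> away from \<open>Y\<close> pays a penalty of order \<open>N * \<delta>\<close>, and the radius moves by at most \<open>1/N\<close>
  within its cell.
\<close>

lemma tail_liminf:
  fixes \<Phi> :: "nat \<Rightarrow> (int \<Rightarrow> 's \<Rightarrow> real) \<Rightarrow> real" and \<Phi>' :: "(int \<Rightarrow> 's \<Rightarrow> real) \<Rightarrow> real"
  assumes c: "filterlim c at_top sequentially" and m: "1 \<le> (m::int)"
    and \<Phi>: "\<And>n z. 0 \<le> \<Phi> n z" "\<And>n z. \<Phi> n z \<le> B"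
    and \<Phi>': "\<And>z. 0 \<le> \<Phi>' z" "\<And>z. \<Phi>' z \<le> B"
    and meas: "\<And>n. (\<lambda>\<omega>. \<Phi> n (scaled (c n) \<omega>)) \<in> borel_measurable M"
      "(\<lambda>\<omega>. \<Phi>' (\<lambda>t. Y t \<omega>)) \<in> borel_measurable M'"
    and conv: "AE \<omega> in M'. ((\<lambda>(n, z). \<Phi> n z) \<longlongrightarrow> \<Phi>' (\<lambda>t. Y t \<omega>))
        (sequentially \<times>\<^sub>F near {-m..m} (\<lambda>t. Y t \<omega>))"
    and \<epsilon>: "0 < \<epsilon>"
  shows "\<forall>\<^sub>F n in sequentially. (\<integral>\<omega>. \<Phi>' (\<lambda>t. Y t \<omega>) \<partial>M') - \<epsilon> <
    exc_mean (c n) (\<Phi> n)"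
proof -
  note [measurable] = meas
  let ?I = "{-m..m}"
  have B: "0 \<le> B" using \<Phi>[of 0 undefined] by linarith
  define y where "y N i = 1 + real i / real N" for N i :: nat
  define g where "g N i = envelope \<Phi> ?I B N (y N i) (y N (Suc i))" for N i
  have y_mono: "1 \<le> y N i" "y N i \<le> y N (Suc i)" for N i
    by (auto simp: y_def divide_right_mono)
  have g_bounds: "0 \<le> g N i \<theta>" "g N i \<theta> \<le> B" for N i \<theta>
    unfolding g_def using \<Phi>(1) B by (auto intro: envelope_nonneg envelope_le_bound)
  have g_cont: "continuous_on UNIV (g N i)" for N i
    unfolding g_def
    by (rule continuous_on_if_pdist_lipschitz, rule envelope_lipschitz)
      (use \<Phi>(1) B y_mono[of N i] in auto)
  have g_meas [measurable]: "g N i \<in> borel_measurable borel" for N i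
    by (rule borel_measurable_continuous_onI[OF g_cont])
  have g_local: "g N i z = g N i z'" if "\<And>t. t \<in> ?I \<Longrightarrow> z t = z' t" for N i z z'
    unfolding g_def using that by (rule envelope_cong)
  have g_abs: "\<bar>g N i \<theta>\<bar> \<le> B" for N i \<theta> using g_bounds[of N i \<theta>] by simp
  define \<Psi> where "\<Psi> N \<omega> = (\<Sum>i<N*N. g N i (\<lambda>t. \<Theta> t \<omega>) * indicator {y N i<..y N (Suc i)} (P \<omega>))" for N \<omega>
  have g\<Theta>_meas [measurable]: "(\<lambda>\<omega>. g N i (\<lambda>t. \<Theta> t \<omega>)) \<in> borel_measurable M'" for N i
    by (rule measurable_compose[OF \<Theta>_path_measurable g_meas])
  have [measurable]: "\<Psi> N \<in> borel_measurable M'" for N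
    unfolding \<Psi>_def by measurable
  have \<Psi>_nonneg: "0 \<le> \<Psi> N \<omega>" for N \<omega>
    unfolding \<Psi>_def using g_bounds by (intro sum_nonneg mult_nonneg_nonneg) auto
  have int\<Psi>: "integrable M' (\<lambda>\<omega>. g N i (\<lambda>t. \<Theta> t \<omega>) * indicator {y N i<..y N (Suc i)} (P \<omega>))" for N i
    by (rule M'.integrable_const_bound[where B=B])
      (use g_bounds B in \<open>auto simp: abs_mult split: split_indicator\<close>)

  let ?cell = "\<lambda>N i n \<omega>. g N i (direction \<omega>) * indicator {c n * y N i<..c n * y N (Suc i)} (maxnorm (X 0 \<omega>))"
  have \<Psi>_limit: "(\<lambda>n. (\<Sum>i<N*N. \<integral>\<omega>. ?cell N i n \<omega> \<partial>M) / tailp (c n))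
      \<longlonglongrightarrow> (\<integral>\<omega>. \<Psi> N \<omega> \<partial>M')" for N
    unfolding \<Psi>_def sum_divide_distrib Bochner_Integration.integral_sum[OF int\<Psi>]
    by (intro tendsto_sum cell_limit[OF g_cont g_abs g_local m y_mono c])

  \<comment> \<open>The cells are disjoint, so for each sample point at most one summand is nonzero.\<close>
  have lower: "\<forall>\<^sub>F n in sequentially. (\<Sum>i<N*N. \<integral>\<omega>. ?cell N i n \<omega> \<partial>M) / tailp (c n)
      \<le> exc_mean (c n) (\<Phi> n)"
    if N: "0 < N" for N
    using eventually_ge_at_top[of N] filterlim_at_top_dense[THEN iffD1, OF c, rule_format, of 0]
  proof eventually_elim
    fix n assume n: "N \<le> n" and cn: "0 < c n"
    have int: "integrable M (\<lambda>\<omega>. ?cell N i n \<omega>)" for i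
      by (rule M.integrable_const_bound[where B=B])
        (use g_bounds B in \<open>auto simp: abs_mult split: split_indicator\<close>)
    have "(\<Sum>i<N*N. \<integral>\<omega>. ?cell N i n \<omega> \<partial>M) =
        (\<integral>\<omega>. (\<Sum>i<N*N. ?cell N i n \<omega>) \<partial>M)"
      by (rule Bochner_Integration.integral_sum[symmetric]) (rule int)
    also have "\<dots> \<le> (\<integral>\<omega>. \<Phi> n (scaled (c n) \<omega>) * indicator (exc (c n)) \<omega> \<partial>M)"
    proof (rule integral_mono)
      show "integrable M (\<lambda>\<omega>. \<Sum>i<N*N. ?cell N i n \<omega>)"
        by (intro Bochner_Integration.integrable_sum int)
      show "integrable M (\<lambda>\<omega>. \<Phi> n (scaled (c n) \<omega>) * indicator (exc (c n)) \<omega>)"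
        by (rule M.integrable_const_bound[where B=B])
          (use \<Phi> B in \<open>auto simp: abs_mult split: split_indicator\<close>)
      fix \<omega> assume \<omega>: "\<omega> \<in> space M"
      show "(\<Sum>i<N*N. ?cell N i n \<omega>)
          \<le> \<Phi> n (scaled (c n) \<omega>) * indicator (exc (c n)) \<omega>"
      proof (cases "\<exists>i<N*N. maxnorm (X 0 \<omega>) \<in> {c n * y N i<..c n * y N (Suc i)}")
        case True
        then obtain i where i: "i < N*N" "c n * y N i < maxnorm (X 0 \<omega>)" "maxnorm (X 0 \<omega>) \<le> c n * y N (Suc i)"
          by auto
        have uniq: "j = i" if "maxnorm (X 0 \<omega>) \<in> {c n * y N j<..c n * y N (Suc j)}" for j
        proof -
          have "c n * y N j < c n * y N (Suc i)" "c n * y N i < c n * y N (Suc j)"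
            using that i by auto
          then have "y N j < y N (Suc i)" "y N i < y N (Suc j)"
            using cn by (auto simp: mult_less_cancel_left_pos)
          then have "j < Suc i" "i < Suc j"
            using N by (auto simp: y_def divide_less_cancel)
          then show ?thesis by simp
        qed
        have "(\<Sum>j<N*N. ?cell N j n \<omega>) =
            (\<Sum>j\<in>{i}. ?cell N j n \<omega>)"
        proof (rule sum.mono_neutral_right)
          show "\<forall>j\<in>{..<N*N} - {i}. ?cell N j n \<omega> = 0"
            using uniq unfolding indicator_def by fastforce
        qed (use i(1) in auto)
        also have "\<dots> = g N i (direction \<omega>)" using i by simp
        also have "\<dots> \<le> \<Phi> n (scaled (c n) \<omega>) + real N * pdist ?I (\<lambda>t s. (maxnorm (X 0 \<omega>) / c n) * direction \<omega> t s) (scaled (c n) \<omega>)"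
          unfolding g_def
          by (rule envelope_le)
            (use \<Phi>(1) B n i cn scaled_paths[OF cn \<omega>] in \<open>auto simp: field_simps\<close>)
        also have "(\<lambda>t s. (maxnorm (X 0 \<omega>) / c n) * direction \<omega> t s) = scaled (c n) \<omega>"
        proof -
          have "0 < c n * y N i" using cn y_mono(1)[of N i] by simp
          then have "maxnorm (X 0 \<omega>) \<noteq> 0" using i(2) by linarith
          then show ?thesis by (auto simp: direction_def scaled_def fun_eq_iff)
        qed
        finally have "(\<Sum>j<N*N. ?cell N j n \<omega>) \<le> \<Phi> n (scaled (c n) \<omega>)"
          by simp
        moreover have "c n \<le> c n * y N i" using cn y_mono(1)[of N i] by simp
        then have "\<omega> \<in> exc (c n)" using i(2) \<omega> by simp
        ultimately show ?thesis by simp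
      next
        case False
        then have "(\<Sum>i<N*N. ?cell N i n \<omega>) = 0"
          by (intro sum.neutral) (auto split: split_indicator)
        then show ?thesis using \<Phi>(1) by simp
      qed
    qed
    finally show "(\<Sum>i<N*N. \<integral>\<omega>. ?cell N i n \<omega> \<partial>M) / tailp (c n)
      \<le> exc_mean (c n) (\<Phi> n)"
      using tailp_pos[of "c n"] by (intro divide_right_mono) auto
  qed

  \<comment> \<open>The pointwise comparison: far paths are excluded by the penalty, near ones by convergence.\<close>
  have \<Psi>_lower: "\<forall>\<^sub>F N in sequentially. \<Phi>' (\<lambda>t. Y t \<omega>) - e \<le> \<Psi> N \<omega>"
    if \<omega>: "\<omega> \<in> space M'" "1 < P \<omega>" and e: "0 < e"
      and tends: "((\<lambda>(n, z). \<Phi> n z) \<longlongrightarrow> \<Phi>' (\<lambda>t. Y t \<omega>)) (sequentially \<times>\<^sub>F near ?I (\<lambda>t. Y t \<omega>))" for \<omega> e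
  proof -
    let ?y = "\<lambda>t. Y t \<omega>" and ?\<theta> = "\<lambda>t. \<Theta> t \<omega>"
    have "\<forall>\<^sub>F p in sequentially \<times>\<^sub>F near ?I ?y. \<Phi>' ?y - e < (case p of (n, z) \<Rightarrow> \<Phi> n z)"
      by (rule order_tendstoD(1)[OF tends]) (use e in simp)
    then obtain Q1 Q2 where Q: "eventually Q1 sequentially" "eventually Q2 (near ?I ?y)"
      "\<And>n z. Q1 n \<Longrightarrow> Q2 z \<Longrightarrow> \<Phi>' ?y - e < \<Phi> n z"
      by (auto simp: eventually_prod_filter)
    then obtain N0 \<delta> where N0: "\<And>n. N0 \<le> n \<Longrightarrow> Q1 n" and \<delta>: "0 < \<delta>"
      "\<And>z. z \<in> nonneg_paths \<Longrightarrow> pdist ?I ?y z < \<delta> \<Longrightarrow> Q2 z"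
      unfolding eventually_near eventually_sequentially by blast
    define S where "S = pdist ?I ?\<theta> (\<lambda>t s. 0)"
    have Y\<theta>: "?y = (\<lambda>t s. P \<omega> * ?\<theta> t s)" using tail \<omega> by auto
    \<comment> \<open>The three requirements on \<open>N\<close>: moving the radius within a cell costs at most \<open>\<delta>/2\<close>,
      the penalty at distance \<open>\<delta>/2\<close> is at least \<open>B\<close>, and \<open>P \<omega>\<close> lies below the last cell.\<close>
    obtain N1 :: nat where N1: "2 * S / \<delta> + 2 * B / \<delta> + P \<omega> + 1 \<le> real N1"
      using real_arch_simple by blast
    have "\<Phi>' ?y - e \<le> \<Psi> N \<omega>" if N: "max N0 N1 \<le> N" for N
    proof -
      have S: "0 \<le> S" by (simp add: S_def)
      have NN: "2 * S / \<delta> + 2 * B / \<delta> + P \<omega> + 1 \<le> real N" using N N1 by linarith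
      have "0 \<le> 2 * S / \<delta>" "0 \<le> 2 * B / \<delta>" using S B \<delta>(1) by auto
      with NN \<omega>(2) have NS: "2 * S / \<delta> \<le> real N" "2 * B / \<delta> \<le> real N" "P \<omega> \<le> real N" "1 < real N"
        by linarith+
      \<comment> \<open>The cells are open on the left, hence the ceiling minus one.\<close>
      define i where "i = nat \<lceil>(P \<omega> - 1) * real N\<rceil> - 1"
      have pos: "0 < (P \<omega> - 1) * real N" using \<omega>(2) NS(4) by simp
      then have "0 < \<lceil>(P \<omega> - 1) * real N\<rceil>" by linarith
      then have Suc_i: "real (Suc i) = real_of_int \<lceil>(P \<omega> - 1) * real N\<rceil>" and i_eq: "real i = real_of_int \<lceil>(P \<omega> - 1) * real N\<rceil> - 1"
        unfolding i_def by (simp_all add: of_nat_diff Suc_leI)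
      have cell: "y N i < P \<omega>" "P \<omega> \<le> y N (Suc i)"
      proof -
        have "real i < (P \<omega> - 1) * real N" unfolding i_eq by linarith
        then show "y N i < P \<omega>" using NS(4) by (simp add: y_def field_simps)
        have "(P \<omega> - 1) * real N \<le> real (Suc i)" unfolding Suc_i by linarith
        then show "P \<omega> \<le> y N (Suc i)" using NS(4) unfolding y_def by (simp add: field_simps)
      qed
      have i_less: "i < N * N"
      proof -
        have "real i < (P \<omega> - 1) * real N" unfolding i_eq by linarith
        also have "\<dots> \<le> real N * real N" using NS by (intro mult_right_mono) auto
        finally show ?thesis by (simp add: of_nat_mult[symmetric] del: of_nat_mult)
      qed
      have "\<Phi>' ?y - e \<le> g N i ?\<theta>"
        unfolding g_def
      proof (rule envelope_ge)
        show "\<And>n z. z \<in> nonneg_paths \<Longrightarrow> 0 \<le> \<Phi> n z" using \<Phi>(1) by blast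
        show "0 \<le> B" by (rule B)
        show "\<Phi>' ?y - e \<le> B" using \<Phi>'(2)[of ?y] e by linarith
        fix n \<rho> and z :: "int \<Rightarrow> 's \<Rightarrow> real"
        assume *: "N \<le> n" "z \<in> nonneg_paths" "y N i \<le> \<rho>" "\<rho> \<le> y N (Suc i)"
        show "\<Phi>' ?y - e \<le> \<Phi> n z + real N * pdist ?I (\<lambda>t s. \<rho> * ?\<theta> t s) z"
        proof (cases "pdist ?I ?y z < \<delta>")
          case True
          have "\<Phi>' ?y - e < \<Phi> n z"
            by (intro Q(3) N0 \<delta>(2)) (use * N True in auto)
          moreover have "0 \<le> real N * pdist ?I (\<lambda>t s. \<rho> * ?\<theta> t s) z" by simp
          ultimately show ?thesis by linarith
        next
          case False
          have "y N (Suc i) - y N i = 1 / real N" by (simp add: y_def add_divide_distrib)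
          then have \<rho>: "\<bar>P \<omega> - \<rho>\<bar> \<le> 1 / real N" using * cell by linarith
          have "pdist ?I ?y (\<lambda>t s. \<rho> * ?\<theta> t s) = \<bar>P \<omega> - \<rho>\<bar> * S"
            unfolding Y\<theta> S_def pdist_def
            by (simp add: sum_distrib_left abs_mult[symmetric] left_diff_distrib)
          also have "\<dots> \<le> 1 / real N * S" using \<rho> S by (rule mult_right_mono)
          also have "\<dots> \<le> \<delta> / 2"
            using NS \<delta>(1) by (simp add: field_simps)
          finally have "pdist ?I ?y (\<lambda>t s. \<rho> * ?\<theta> t s) \<le> \<delta> / 2" .
          then have "\<delta> / 2 \<le> pdist ?I (\<lambda>t s. \<rho> * ?\<theta> t s) z"
            using False pdist_triangle[of ?I ?y z "\<lambda>t s. \<rho> * ?\<theta> t s"] by linarith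
          then have "real N * (\<delta> / 2) \<le> real N * pdist ?I (\<lambda>t s. \<rho> * ?\<theta> t s) z"
            by (intro mult_left_mono) auto
          moreover have "B \<le> real N * (\<delta> / 2)" using NS(2) \<delta>(1) by (simp add: field_simps)
          ultimately show ?thesis using \<Phi>(1)[of n z] \<Phi>'(2)[of ?y] e by linarith
        qed
      qed
      also have "\<dots> = g N i ?\<theta> * indicator {y N i<..y N (Suc i)} (P \<omega>)" using cell by simp
      also have "\<dots> \<le> \<Psi> N \<omega>"
        unfolding \<Psi>_def
        by (rule member_le_sum[of i "{..<N*N}" "\<lambda>i. g N i ?\<theta> * indicator {y N i<..y N (Suc i)} (P \<omega>)"])
          (use i_less g_bounds in \<open>auto intro!: mult_nonneg_nonneg\<close>)
      finally show ?thesis .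
    qed
    then show ?thesis unfolding eventually_sequentially by blast
  qed

  have "(\<lambda>N. \<integral>\<omega>. min (\<Psi> N \<omega>) (\<Phi>' (\<lambda>t. Y t \<omega>)) \<partial>M') \<longlonglongrightarrow> (\<integral>\<omega>. \<Phi>' (\<lambda>t. Y t \<omega>) \<partial>M')"
  proof (rule integral_dominated_convergence[where w="\<lambda>_. B"])
    show "AE \<omega> in M'. (\<lambda>N. min (\<Psi> N \<omega>) (\<Phi>' (\<lambda>t. Y t \<omega>))) \<longlonglongrightarrow> \<Phi>' (\<lambda>t. Y t \<omega>)"
      using conv P_gt_1 AE_space
    proof eventually_elim
      fix \<omega> assume a: "((\<lambda>(n, z). \<Phi> n z) \<longlongrightarrow> \<Phi>' (\<lambda>t. Y t \<omega>)) (sequentially \<times>\<^sub>F near ?I (\<lambda>t. Y t \<omega>))"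
        "1 < P \<omega>" "\<omega> \<in> space M'"
      show "(\<lambda>N. min (\<Psi> N \<omega>) (\<Phi>' (\<lambda>t. Y t \<omega>))) \<longlonglongrightarrow> \<Phi>' (\<lambda>t. Y t \<omega>)"
      proof (rule tendstoI)
        fix e :: real assume "0 < e"
        then have "\<forall>\<^sub>F N in sequentially. \<Phi>' (\<lambda>t. Y t \<omega>) - e/2 \<le> \<Psi> N \<omega>"
          using \<Psi>_lower[OF a(3,2) _ a(1), of "e/2"] by simp
        then show "\<forall>\<^sub>F N in sequentially. dist (min (\<Psi> N \<omega>) (\<Phi>' (\<lambda>t. Y t \<omega>))) (\<Phi>' (\<lambda>t. Y t \<omega>)) < e"
          by eventually_elim (use \<open>0 < e\<close> in \<open>auto simp: dist_real_def min_def\<close>)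
      qed
    qed
    show "AE \<omega> in M'. norm (min (\<Psi> N \<omega>) (\<Phi>' (\<lambda>t. Y t \<omega>))) \<le> B" for N
      using \<Psi>_nonneg \<Phi>' by (auto simp: abs_le_iff min_le_iff_disj intro!: AE_I2 order_trans[OF _ \<Phi>'(2)])
  qed auto
  then have "\<forall>\<^sub>F N in sequentially. (\<integral>\<omega>. \<Phi>' (\<lambda>t. Y t \<omega>) \<partial>M') - \<epsilon> < (\<integral>\<omega>. min (\<Psi> N \<omega>) (\<Phi>' (\<lambda>t. Y t \<omega>)) \<partial>M')"
    using \<epsilon> by (intro order_tendstoD(1)) auto
  then have "\<forall>\<^sub>F N in sequentially. (\<integral>\<omega>. \<Phi>' (\<lambda>t. Y t \<omega>) \<partial>M') - \<epsilon> < (\<integral>\<omega>. min (\<Psi> N \<omega>) (\<Phi>' (\<lambda>t. Y t \<omega>)) \<partial>M') \<and> 0 < N"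
    using eventually_gt_at_top[of 0] by eventually_elim simp
  then obtain N where N: "0 < N" and N_int: "(\<integral>\<omega>. \<Phi>' (\<lambda>t. Y t \<omega>) \<partial>M') - \<epsilon> < (\<integral>\<omega>. min (\<Psi> N \<omega>) (\<Phi>' (\<lambda>t. Y t \<omega>)) \<partial>M')"
    by (auto simp: eventually_sequentially)
  have "(\<integral>\<omega>. min (\<Psi> N \<omega>) (\<Phi>' (\<lambda>t. Y t \<omega>)) \<partial>M') \<le> (\<integral>\<omega>. \<Psi> N \<omega> \<partial>M')"
  proof (rule integral_mono)
    show "integrable M' (\<lambda>\<omega>. min (\<Psi> N \<omega>) (\<Phi>' (\<lambda>t. Y t \<omega>)))"
      by (rule M'.integrable_const_bound[where B=B])
        (use \<Psi>_nonneg \<Phi>' in \<open>auto simp: abs_le_iff min_le_iff_disj intro!: AE_I2 order_trans[OF _ \<Phi>'(2)]\<close>)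
    show "integrable M' (\<Psi> N)"
      unfolding \<Psi>_def by (intro Bochner_Integration.integrable_sum int\<Psi>)
  qed simp
  with N_int have "(\<integral>\<omega>. \<Phi>' (\<lambda>t. Y t \<omega>) \<partial>M') - \<epsilon> < (\<integral>\<omega>. \<Psi> N \<omega> \<partial>M')" by linarith
  from order_tendstoD(1)[OF \<Psi>_limit this] lower[OF N]
  show ?thesis by eventually_elim linarith
qed

text \<open>
  The continuous mapping theorem for the tail process. The lower bound for \<open>\<Phi> n\<close> and for
  \<open>B - \<Phi> n\<close> together give convergence. The functionals may vary with \<open>n\<close> as long as they
  converge continuously, so time marks that depend on \<open>n\<close> need no separate argument.
\<close>

theorem tail_limit:
  fixes \<Phi> :: "nat \<Rightarrow> (int \<Rightarrow> 's \<Rightarrow> real) \<Rightarrow> real" and \<Phi>' :: "(int \<Rightarrow> 's \<Rightarrow> real) \<Rightarrow> real"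
  assumes c: "filterlim c at_top sequentially" and m: "1 \<le> (m::int)"
    and \<Phi>: "\<And>n z. 0 \<le> \<Phi> n z" "\<And>n z. \<Phi> n z \<le> B"
    and \<Phi>': "\<And>z. 0 \<le> \<Phi>' z" "\<And>z. \<Phi>' z \<le> B"
    and meas: "\<And>n. (\<lambda>\<omega>. \<Phi> n (scaled (c n) \<omega>)) \<in> borel_measurable M"
      "(\<lambda>\<omega>. \<Phi>' (\<lambda>t. Y t \<omega>)) \<in> borel_measurable M'"
    and conv: "AE \<omega> in M'. ((\<lambda>(n, z). \<Phi> n z) \<longlongrightarrow> \<Phi>' (\<lambda>t. Y t \<omega>))
        (sequentially \<times>\<^sub>F near {-m..m} (\<lambda>t. Y t \<omega>))"
  shows "(\<lambda>n. exc_mean (c n) (\<Phi> n))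
    \<longlonglongrightarrow> (\<integral>\<omega>. \<Phi>' (\<lambda>t. Y t \<omega>) \<partial>M')"
proof (rule order_tendstoI)
  note [measurable] = meas
  let ?L = "\<integral>\<omega>. \<Phi>' (\<lambda>t. Y t \<omega>) \<partial>M'"
  have B: "0 \<le> B" using \<Phi>[of 0 undefined] by linarith
  {
    fix a assume "a < ?L"
    then show "\<forall>\<^sub>F n in sequentially. a < exc_mean (c n) (\<Phi> n)"
      using tail_liminf[OF c m \<Phi> \<Phi>' meas conv, of "?L - a"] by simp
  next
    fix a assume a: "?L < a"
    have int: "integrable M' (\<lambda>\<omega>. \<Phi>' (\<lambda>t. Y t \<omega>))"
      by (rule M'.integrable_const_bound[where B=B]) (use \<Phi>' in auto)
    have conv': "AE \<omega> in M'. ((\<lambda>(n, z). B - \<Phi> n z) \<longlongrightarrow> B - \<Phi>' (\<lambda>t. Y t \<omega>))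
        (sequentially \<times>\<^sub>F near {-m..m} (\<lambda>t. Y t \<omega>))"
      using conv
    proof eventually_elim
      case (elim \<omega>)
      from tendsto_diff[OF tendsto_const[of B] elim] show ?case by (simp add: case_prod_beta')
    qed
    have "\<forall>\<^sub>F n in sequentially. (\<integral>\<omega>. B - \<Phi>' (\<lambda>t. Y t \<omega>) \<partial>M') - (a - ?L) <
      exc_mean (c n) (\<lambda>z. B - \<Phi> n z)"
      by (rule tail_liminf[where B=B, OF c m _ _ _ _ _ _ conv']) (use \<Phi> \<Phi>' a in auto)
    then show "\<forall>\<^sub>F n in sequentially. exc_mean (c n) (\<Phi> n) < a"
    proof eventually_elim
      case (elim n)
      have int1: "integrable M (\<lambda>\<omega>. \<Phi> n (scaled (c n) \<omega>) * indicator (exc (c n)) \<omega>)"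
        by (rule M.integrable_const_bound[where B=B])
          (use \<Phi> B in \<open>auto simp: abs_mult split: split_indicator\<close>)
      have int2: "integrable M (\<lambda>\<omega>. B * indicator (exc (c n)) \<omega>)"
        by (intro integrable_mult_right integrable_real_indicator) (auto simp: M.emeasure_eq_measure)
      have "(\<integral>\<omega>. (B - \<Phi> n (scaled (c n) \<omega>)) * indicator (exc (c n)) \<omega> \<partial>M) =
          (\<integral>\<omega>. B * indicator (exc (c n)) \<omega> \<partial>M) - (\<integral>\<omega>. \<Phi> n (scaled (c n) \<omega>) * indicator (exc (c n)) \<omega> \<partial>M)"
        unfolding left_diff_distrib by (rule Bochner_Integration.integral_diff[OF int2 int1])
      also have "(\<integral>\<omega>. B * indicator (exc (c n)) \<omega> \<partial>M) = B * tailp (c n)"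
        by (simp add: tailp_def)
      finally have "exc_mean (c n) (\<lambda>z. B - \<Phi> n z) =
         B - exc_mean (c n) (\<Phi> n)"
        using tailp_pos[of "c n"] by (simp add: diff_divide_distrib)
      moreover have "(\<integral>\<omega>. B - \<Phi>' (\<lambda>t. Y t \<omega>) \<partial>M') = B - ?L"
        using int by (simp add: M'.prob_space)
      ultimately show ?case using elim by linarith
    qed
  }
qed

section \<open>Exceedances of the tail process\<close>

lemma pareto_no_atom: "measure M' {\<omega> \<in> space M'. P \<omega> = p} = 0"
proof (cases "p \<le> 1")
  case True
  have "AE \<omega> in M'. P \<omega> \<noteq> p" using P_gt_1 by eventually_elim (use True in auto)
  then show ?thesis by (subst M'.prob_Collect_eq_0) auto
next
  case False
  have "(\<lambda>y. y powr (- \<alpha>) - p powr (- \<alpha>)) \<midarrow>p\<rightarrow> p powr (- \<alpha>) - p powr (- \<alpha>)"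
    using False by (intro tendsto_intros) auto
  then have lim: "((\<lambda>y. y powr (- \<alpha>) - p powr (- \<alpha>)) \<longlongrightarrow> 0) (at_left p)"
    by (auto intro: tendsto_mono[OF at_le])
  have "measure M' {\<omega> \<in> space M'. P \<omega> = p} \<le> 0"
  proof (rule tendsto_lowerbound[OF lim])
    have "\<forall>\<^sub>F y in at_left p. 1 < y \<and> y < p"
      using False by (subst eventually_at_left[of 1]) (auto intro!: exI[of _ 1])
    then show "\<forall>\<^sub>F y in at_left p. measure M' {\<omega> \<in> space M'. P \<omega> = p} \<le> y powr (- \<alpha>) - p powr (- \<alpha>)"
    proof eventually_elim
      case (elim y)
      then have "measure M' {\<omega> \<in> space M'. P \<omega> = p} \<le> measure M' {\<omega> \<in> space M'. y < P \<omega> \<and> P \<omega> \<le> p}"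
        by (intro M'.finite_measure_mono) auto
      then show ?case using elim by (simp add: pareto_cell)
    qed
  qed simp
  then show ?thesis by (simp add: measure_le_0_iff)
qed

text \<open>
  The Pareto radius has no atoms and is independent of the direction, so a homogeneous
  functional of \<open>Y\<close> takes any given nonzero value with probability zero. This makes
  thresholds continuity points.
\<close>

lemma AE_radial_neq:
  assumes H: "H \<in> borel_measurable borel" and u: "u \<noteq> 0"
  shows "AE \<omega> in M'. P \<omega> * H (\<lambda>t. \<Theta> t \<omega>) \<noteq> (u::real)"
proof -
  let ?W = "\<lambda>\<omega>. H (\<lambda>t. \<Theta> t \<omega>)"
  have W [measurable]: "?W \<in> borel_measurable M'"
    by (rule measurable_compose[OF \<Theta>_path_measurable H])
  interpret D1: prob_space "distr M' borel P" by (rule M'.prob_space_distr) measurable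
  interpret D2: prob_space "distr M' borel ?W" by (rule M'.prob_space_distr) measurable
  interpret pair_sigma_finite "distr M' borel P" "distr M' borel ?W" ..
  have joint: "distr M' borel P \<Otimes>\<^sub>M distr M' borel ?W = distr M' (borel \<Otimes>\<^sub>M borel) (\<lambda>\<omega>. (P \<omega>, ?W \<omega>))"
    using indep_functional[OF H] by (simp add: M'.indep_var_distribution_eq)
  have "AE p in distr M' borel P \<Otimes>\<^sub>M distr M' borel ?W. fst p * snd p \<noteq> u"
  proof -
    have "AE w in distr M' borel ?W. AE p in distr M' borel P. p * w \<noteq> u"
    proof (rule AE_I2)
      fix w
      have "AE \<omega> in M'. P \<omega> \<noteq> u / w"
        using pareto_no_atom[of "u / w"] by (subst (asm) M'.prob_Collect_eq_0) auto
      then have "AE \<omega> in M'. P \<omega> * w \<noteq> u"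
        by eventually_elim (use u in \<open>auto simp: field_simps\<close>)
      then show "AE p in distr M' borel P. p * w \<noteq> u"
        by (subst AE_distr_iff) auto
    qed
    moreover have "{x \<in> space (distr M' borel P \<Otimes>\<^sub>M distr M' borel ?W). fst x * snd x \<noteq> u}
        \<in> sets (distr M' borel P \<Otimes>\<^sub>M distr M' borel ?W)"
      by measurable
    ultimately show ?thesis
      using AE_commute[of "\<lambda>p w. p * w \<noteq> u"] AE_pair_iff[of "\<lambda>p w. p * w \<noteq> u"] by simp
  qed
  then show ?thesis
    unfolding joint by (subst (asm) AE_distr_iff) auto
qed

lemma Y_paths: "AE \<omega> in M'. (\<lambda>t. Y t \<omega>) \<in> nonneg_paths"
  using P_gt_1 AE_space
proof eventually_elim
  case (elim \<omega>)
  then show ?case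
    using tail \<Theta>_cone[OF elim(2)] by (auto simp: nonneg_paths_def intro!: scale_in_cone)
qed

lemma AE_Y_norm_neq_1: "AE \<omega> in M'. \<forall>t. maxnorm (Y t \<omega>) \<noteq> 1"
proof (subst AE_all_countable, rule allI)
  fix t
  have "AE \<omega> in M'. P \<omega> * (maxnorm \<circ> (\<lambda>z. z t)) (\<lambda>t. \<Theta> t \<omega>) \<noteq> 1"
    by (rule AE_radial_neq) (auto simp: comp_def)
  then show "AE \<omega> in M'. maxnorm (Y t \<omega>) \<noteq> 1"
    using P_gt_1 AE_space
    by eventually_elim (use tail in \<open>auto simp: maxnorm_scale\<close>)
qed

lemma Y0_exceeds: "AE \<omega> in M'. 1 < maxnorm (Y 0 \<omega>)"
proof -
  have "AE \<omega> in M'. maxnorm (\<Theta> 0 \<omega>) = 1"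
    using spectral by (simp add: spectral_tail_process_def)
  then show ?thesis
    using P_gt_1 AE_space by eventually_elim (use tail in \<open>auto simp: maxnorm_scale\<close>)
qed

lemma maxnorm_scaled: "0 < c \<Longrightarrow> 1 < maxnorm (scaled c \<omega> t) \<longleftrightarrow> c < maxnorm (X t \<omega>)"
  by (simp add: scaled_def maxnorm_divide)

lemma scaled_coordinate_measurable [measurable]: "(\<lambda>\<omega>. scaled c \<omega> t) \<in> borel_measurable M"
  by (rule measurable_compose[OF scaled_measurable path_coordinate_measurable])

text \<open>
  The case of \<open>tail_limit\<close> in which the functional is the indicator of an exceedance pattern on a
  finite window.
\<close>

lemma exceedance_event_limit:
  fixes Q :: "(int \<Rightarrow> bool) \<Rightarrow> bool"
  assumes c: "filterlim c at_top sequentially" and m: "1 \<le> (m::int)"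
    and local: "\<And>p q. (\<And>t. t \<in> {-m..m} \<Longrightarrow> p t = q t) \<Longrightarrow> Q p = Q q"
    and meas: "\<And>c. Measurable.pred M (\<lambda>\<omega>. Q (\<lambda>t. 1 < maxnorm (scaled c \<omega> t)))"
      "Measurable.pred M' (\<lambda>\<omega>. Q (\<lambda>t. 1 < maxnorm (Y t \<omega>)))"
  shows "(\<lambda>n. measure M {\<omega> \<in> space M. Q (\<lambda>t. c n < maxnorm (X t \<omega>)) \<and> c n < maxnorm (X 0 \<omega>)} / tailp (c n))
    \<longlonglongrightarrow> measure M' {\<omega> \<in> space M'. Q (\<lambda>t. 1 < maxnorm (Y t \<omega>))}"
proof -
  note [measurable] = meas
  define \<Phi> :: "(int \<Rightarrow> 's \<Rightarrow> real) \<Rightarrow> real" where "\<Phi> z = of_bool (Q (\<lambda>t. 1 < maxnorm (z t)))" for z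
  have lim: "(\<lambda>n. exc_mean (c n) \<Phi>)
      \<longlonglongrightarrow> (\<integral>\<omega>. \<Phi> (\<lambda>t. Y t \<omega>) \<partial>M')"
  proof (rule tail_limit[where B=1 and \<Phi>="\<lambda>n. \<Phi>", OF c m])
    show "AE \<omega> in M'. ((\<lambda>(n, z). \<Phi> z) \<longlongrightarrow> \<Phi> (\<lambda>t. Y t \<omega>)) (sequentially \<times>\<^sub>F near {-m..m} (\<lambda>t. Y t \<omega>))"
      using AE_Y_norm_neq_1
    proof eventually_elim
      case (elim \<omega>)
      have "\<Phi> z = \<Phi> (\<lambda>t. Y t \<omega>)"
        if "\<forall>t\<in>{-m..m}. 1 < maxnorm (z t) \<longleftrightarrow> 1 < maxnorm (Y t \<omega>)" for z
      proof -
        have "Q (\<lambda>t. 1 < maxnorm (z t)) = Q (\<lambda>t. 1 < maxnorm (Y t \<omega>))"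
          by (rule local) (use that in auto)
        then show ?thesis by (simp add: \<Phi>_def)
      qed
      moreover have "\<forall>\<^sub>F z in near {-m..m} (\<lambda>t. Y t \<omega>).
          \<forall>t\<in>{-m..m}. 1 < maxnorm (z t) \<longleftrightarrow> 1 < maxnorm (Y t \<omega>)"
        by (rule near_same_exceedances) (use elim in auto)
      ultimately have "\<forall>\<^sub>F z in near {-m..m} (\<lambda>t. Y t \<omega>). \<Phi> z = \<Phi> (\<lambda>t. Y t \<omega>)"
        by (rule eventually_mono[rotated])
      then have "(\<Phi> \<longlongrightarrow> \<Phi> (\<lambda>t. Y t \<omega>)) (near {-m..m} (\<lambda>t. Y t \<omega>))"
        by (rule tendsto_eventually)
      from filterlim_compose[OF this filterlim_snd] show ?case
        by (simp add: case_prod_beta')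
    qed
  qed (auto simp: \<Phi>_def)
  have "(\<integral>\<omega>. \<Phi> (\<lambda>t. Y t \<omega>) \<partial>M') = (\<integral>\<omega>. indicator {\<omega> \<in> space M'. Q (\<lambda>t. 1 < maxnorm (Y t \<omega>))} \<omega> \<partial>M')"
    by (rule Bochner_Integration.integral_cong) (auto simp: \<Phi>_def)
  also have "\<dots> = measure M' {\<omega> \<in> space M'. Q (\<lambda>t. 1 < maxnorm (Y t \<omega>))}"
    by simp
  finally have eq': "(\<integral>\<omega>. \<Phi> (\<lambda>t. Y t \<omega>) \<partial>M') = measure M' {\<omega> \<in> space M'. Q (\<lambda>t. 1 < maxnorm (Y t \<omega>))}" .
  show ?thesis
    unfolding eq'[symmetric]
  proof (rule Lim_transform_eventually[OF lim])
    show "\<forall>\<^sub>F n in sequentially. exc_mean (c n) \<Phi> =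
      exc_prob (c n) (\<lambda>\<omega>. Q (\<lambda>t. c n < maxnorm (X t \<omega>)))"
      using filterlim_at_top_dense[THEN iffD1, OF c, rule_format, of 0]
    proof eventually_elim
      case (elim n)
      have "(\<integral>\<omega>. \<Phi> (scaled (c n) \<omega>) * indicator (exc (c n)) \<omega> \<partial>M) =
        (\<integral>\<omega>. indicator {\<omega> \<in> space M. Q (\<lambda>t. c n < maxnorm (X t \<omega>)) \<and> c n < maxnorm (X 0 \<omega>)} \<omega> \<partial>M)"
        by (rule Bochner_Integration.integral_cong)
          (auto simp: \<Phi>_def maxnorm_scaled[OF elim] split: split_indicator)
      also have "\<dots> = measure M {\<omega> \<in> space M. Q (\<lambda>t. c n < maxnorm (X t \<omega>)) \<and> c n < maxnorm (X 0 \<omega>)}"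
        by (simp, rule arg_cong[where f="measure M"], blast)
      finally show ?case by simp
    qed
  qed
qed

lemma stationary_integral:
  assumes H: "H \<in> borel_measurable borel"
  shows "(\<integral>\<omega>. H (\<lambda>t. X (t + h) \<omega>) \<partial>M) = (\<integral>\<omega>. H (\<lambda>t. X t \<omega>) \<partial>M :: real)"
proof -
  have s: "sets (path_space :: (int \<Rightarrow> 's \<Rightarrow> real) measure) = sets borel"
    by (rule sets_PiM_equal_borel)
  have H': "H \<in> borel_measurable path_space" using H s measurable_cong_sets by blast
  have F: "(\<lambda>\<omega> t. X (t + h) \<omega>) \<in> M \<rightarrow>\<^sub>M path_space" for h
  proof -
    have "(\<lambda>\<omega> t. X (t + h) \<omega>) \<in> borel_measurable M" by (rule path_measurable) measurable
    then show ?thesis using s measurable_cong_sets by blast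
  qed
  have "(\<integral>\<omega>. H (\<lambda>t. X (t + h) \<omega>) \<partial>M) = (\<integral>z. H z \<partial>distr M path_space (\<lambda>\<omega> t. X (t + h) \<omega>))"
    by (rule integral_distr[OF F H', symmetric])
  also have "\<dots> = (\<integral>z. H z \<partial>distr M path_space (\<lambda>\<omega> t. X t \<omega>))"
    using stationary by (simp add: strictly_stationary_def)
  also have "\<dots> = (\<integral>\<omega>. H (\<lambda>t. X t \<omega>) \<partial>M)"
    using F[of 0] by (intro integral_distr[OF _ H']) simp
  finally show ?thesis .
qed

lemma stationary_prob:
  assumes Q: "Measurable.pred borel Q"
  shows "measure M {\<omega> \<in> space M. Q (\<lambda>t. X (t + h) \<omega>)} = measure M {\<omega> \<in> space M. Q (\<lambda>t. X t \<omega>)}"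
proof -
  have [measurable]: "(\<lambda>\<omega> t. X (t + h) \<omega>) \<in> borel_measurable M" for h
    by (rule path_measurable) measurable
  note [measurable] = Q
  have 1: "measure M {\<omega> \<in> space M. Q (\<lambda>t. X (t + h) \<omega>)} = (\<integral>\<omega>. of_bool (Q (\<lambda>t. X (t + h) \<omega>)) \<partial>M)" for h
  proof -
    have "(\<integral>\<omega>. of_bool (Q (\<lambda>t. X (t + h) \<omega>)) \<partial>M) =
      (\<integral>\<omega>. indicator {\<omega> \<in> space M. Q (\<lambda>t. X (t + h) \<omega>)} \<omega> \<partial>M :: real)"
      by (rule Bochner_Integration.integral_cong) auto
    then show ?thesis by simp
  qed
  have "(\<integral>\<omega>. of_bool (Q (\<lambda>t. X (t + h) \<omega>)) \<partial>M) = (\<integral>\<omega>. of_bool (Q (\<lambda>t. X t \<omega>)) \<partial>M :: real)"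
    by (rule stationary_integral) measurable
  then show ?thesis using 1[of h] 1[of 0] by simp
qed

section \<open>The extremal index\<close>

text \<open>
  Both sides equal the probability of no exceedance during \<open>k\<close> consecutive times minus that of
  none during \<open>k + 1\<close>.
\<close>

lemma first_last_exceedance:
  "measure M {\<omega> \<in> space M. (\<forall>j\<in>{1..int k}. \<not> c < maxnorm (X j \<omega>)) \<and> c < maxnorm (X 0 \<omega>)} =
   measure M {\<omega> \<in> space M. (\<forall>j\<in>{-int k..-1}. \<not> c < maxnorm (X j \<omega>)) \<and> c < maxnorm (X 0 \<omega>)}"
proof -
  let ?N = "\<lambda>J. {\<omega> \<in> space M. \<forall>j\<in>J. \<not> c < maxnorm (X j \<omega>)}"
  have [measurable]: "?N J \<in> sets M" if "finite J" for J
    using that by measurable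
  have shift: "measure M (?N {l + h..l' + h}) = measure M (?N {l..l'})" for l l' h
  proof -
    have "Measurable.pred borel (\<lambda>z::int \<Rightarrow> 's \<Rightarrow> real. \<forall>j\<in>{l..l'}. \<not> c < maxnorm (z j))"
      by measurable
    from stationary_prob[OF this, of h]
    have "measure M {\<omega> \<in> space M. \<forall>j\<in>{l..l'}. \<not> c < maxnorm (X (j + h) \<omega>)} = measure M (?N {l..l'})" .
    moreover have "(\<forall>j\<in>{l..l'}. \<not> c < maxnorm (X (j + h) \<omega>)) \<longleftrightarrow> (\<forall>j\<in>{l + h..l' + h}. \<not> c < maxnorm (X j \<omega>))" for \<omega>
    proof -
      have e: "{l + h..l' + h} = (\<lambda>j. j + h) ` {l..l'}" by simp
      show ?thesis unfolding e by blast
    qed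
    ultimately show ?thesis by simp
  qed
  have diff: "measure M {\<omega> \<in> space M. (\<forall>j\<in>J. \<not> c < maxnorm (X j \<omega>)) \<and> c < maxnorm (X 0 \<omega>)} =
      measure M (?N J) - measure M (?N (insert 0 J))" if J: "finite J" for J
  proof -
    have "{\<omega> \<in> space M. (\<forall>j\<in>J. \<not> c < maxnorm (X j \<omega>)) \<and> c < maxnorm (X 0 \<omega>)} = ?N J - ?N (insert 0 J)"
      by auto
    then show ?thesis
      using J by (simp only:) (rule M.finite_measure_Diff, auto)
  qed
  have i: "insert 0 {1..int k} = {0..int k}" "insert 0 {-int k..-1} = {-int k..0}" by auto
  show ?thesis
    using shift[of "-int k" "int k + 1" "-1"] shift[of "-int k" "int k" 0]
    by (simp add: diff i)
qed

definition future_prob :: "nat \<Rightarrow> real" where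
  "future_prob k = measure M' {\<omega> \<in> space M'. \<forall>j\<in>{1..int k}. \<not> 1 < maxnorm (Y j \<omega>)}"

definition past_event :: "'p set" where
  "past_event = {\<omega> \<in> space M'. \<forall>j\<le>-1. maxnorm (Y j \<omega>) \<le> 1}"

lemma past_event_measurable [measurable]: "past_event \<in> sets M'"
  unfolding past_event_def by measurable

lemma future_limit:
  assumes "filterlim c at_top sequentially"
  shows "(\<lambda>n. measure M {\<omega> \<in> space M. (\<forall>j\<in>{1..int k}. \<not> c n < maxnorm (X j \<omega>)) \<and> c n < maxnorm (X 0 \<omega>)} / tailp (c n))
     \<longlonglongrightarrow> future_prob k"
  unfolding future_prob_def
  by (rule exceedance_event_limit[OF assms, of "int k + 1" "\<lambda>p. \<forall>j\<in>{1..int k}. \<not> p j"]) auto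

lemma past_limit:
  assumes "filterlim c at_top sequentially"
  shows "(\<lambda>n. exc_prob (c n) (\<lambda>\<omega>. \<forall>j\<in>{-int k..-1}. \<not> c n < maxnorm (X j \<omega>)))
     \<longlonglongrightarrow> measure M' {\<omega> \<in> space M'. \<forall>j\<in>{-int k..-1}. \<not> 1 < maxnorm (Y j \<omega>)}"
  by (rule exceedance_event_limit[OF assms, of "int k + 1" "\<lambda>p. \<forall>j\<in>{-int k..-1}. \<not> p j"]) auto

lemma past_eq_future:
  "measure M' {\<omega> \<in> space M'. \<forall>j\<in>{-int k..-1}. \<not> 1 < maxnorm (Y j \<omega>)} = future_prob k"
  using LIMSEQ_unique[OF future_limit[OF filterlim_real_sequentially, of k]
      past_limit[OF filterlim_real_sequentially, of k, folded first_last_exceedance]]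
  by simp

lemma future_prob_tendsto: "future_prob \<longlonglongrightarrow> measure M' past_event"
proof -
  have "(\<lambda>k. measure M' {\<omega> \<in> space M'. \<forall>j\<in>{1..k}. \<not> 1 < maxnorm (Y (- int j) \<omega>)}) \<longlonglongrightarrow>
      measure M' {\<omega> \<in> space M'. \<forall>j\<ge>1. \<not> 1 < maxnorm (Y (- int j) \<omega>)}"
    by (rule tendsto_prob_all) (auto intro: M'.finite_measure_axioms)
  also have "{\<omega> \<in> space M'. \<forall>j\<ge>1. \<not> 1 < maxnorm (Y (- int j) \<omega>)} = past_event"
  proof -
    have "(\<forall>j\<le>-1. maxnorm (Y j \<omega>) \<le> 1) \<longleftrightarrow> (\<forall>j\<ge>1. \<not> 1 < maxnorm (Y (- int j) \<omega>))" for \<omega>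
    proof safe
      fix j :: int assume *: "\<forall>j\<ge>1. \<not> 1 < maxnorm (Y (- int j) \<omega>)" "j \<le> -1"
      then have "\<not> 1 < maxnorm (Y (- int (nat (-j))) \<omega>)" by (intro *(1)[rule_format]) auto
      then show "maxnorm (Y j \<omega>) \<le> 1" using *(2) by simp
    next
      fix j :: nat assume "\<forall>j\<le>-1. maxnorm (Y j \<omega>) \<le> 1" "1 \<le> j" "1 < maxnorm (Y (- int j) \<omega>)"
      then show False by (metis neg_le_iff_le not_le of_nat_1 of_nat_mono)
    qed
    then show ?thesis by (auto simp: past_event_def)
  qed
  also have "(\<lambda>k. measure M' {\<omega> \<in> space M'. \<forall>j\<in>{1..k}. \<not> 1 < maxnorm (Y (- int j) \<omega>)}) = future_prob"
  proof
    fix k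
    have "(\<forall>j\<in>{1..k}. \<not> 1 < maxnorm (Y (- int j) \<omega>)) \<longleftrightarrow> (\<forall>j\<in>{-int k..-1}. \<not> 1 < maxnorm (Y j \<omega>))" for \<omega>
    proof -
      have e: "{-int k..-1} = uminus ` {1..int k}" by simp
      show ?thesis
        unfolding e using ball_nat_int[of k "\<lambda>j. \<not> 1 < maxnorm (Y (-j) \<omega>)"] by blast
    qed
    then show "measure M' {\<omega> \<in> space M'. \<forall>j\<in>{1..k}. \<not> 1 < maxnorm (Y (- int j) \<omega>)} = future_prob k"
      by (simp add: past_eq_future[symmetric])
  qed
  finally show ?thesis .
qed

text \<open>
  The inner limit is a probability about the tail process at the times \<open>1, ..., b n\<close>. It equals the
  same probability for the past, which is the form in which it enters the cluster law.
\<close>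

lemma extremal_index_eq:
  assumes b: "filterlim b at_top sequentially"
  shows "extremal_index M X b = measure M' past_event"
proof -
  have inner: "Lim at_top (\<lambda>x. \<P>(\<omega> in M. (\<forall>j\<in>{1..k}. maxnorm (X (int j) \<omega>) \<le> x) \<bar> maxnorm (X 0 \<omega>) > x)) = future_prob k" for k
  proof (rule tendsto_Lim)
    show "((\<lambda>x. \<P>(\<omega> in M. (\<forall>j\<in>{1..k}. maxnorm (X (int j) \<omega>) \<le> x) \<bar> maxnorm (X 0 \<omega>) > x)) \<longlongrightarrow> future_prob k) at_top"
    proof (rule tendsto_at_topI_sequentially)
      fix c :: "nat \<Rightarrow> real" assume "filterlim c at_top sequentially"
      from future_limit[OF this, of k]
      show "(\<lambda>n. \<P>(\<omega> in M. (\<forall>j\<in>{1..k}. maxnorm (X (int j) \<omega>) \<le> c n) \<bar> maxnorm (X 0 \<omega>) > c n)) \<longlonglongrightarrow> future_prob k"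
        by (simp add: cond_prob_def tailp_def ball_nat_int not_less)
    qed
  qed simp
  show ?thesis
    unfolding extremal_index_def inner
    by (rule limI, rule filterlim_compose[OF future_prob_tendsto b])
qed

end

section \<open>Splitting a block at its first exceedance\<close>

lemma one_minus_exp_bounds: "0 \<le> x \<Longrightarrow> 0 \<le> 1 - exp (- x) \<and> 1 - exp (- x) \<le> (1::real)"
  by simp

lemma abs_diff_of_bool_le:
  fixes x y :: real
  assumes "0 \<le> x \<and> x \<le> 1" "0 \<le> y \<and> y \<le> 1"
  shows "\<bar>of_bool (A \<and> B) * x - of_bool (A \<and> C) * y\<bar> \<le> of_bool A"
  using assms by (cases A; cases B; cases C) auto

text \<open>
  At most one summand on the right is nonzero, the one at the first exceedance, and no
  \<open>f j\<close> before it contributes to the left.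
\<close>

lemma first_exceedance_expansion:
  fixes f :: "nat \<Rightarrow> real"
  assumes zero: "\<And>j. \<not> e j \<Longrightarrow> f j = 0"
  shows "1 - exp (- (\<Sum>j\<in>{c<..d}. f j)) =
    (\<Sum>j\<in>{c<..d}. of_bool (e j \<and> (\<forall>l\<in>{c<..<j}. \<not> e l)) * (1 - exp (- (\<Sum>k\<in>{j..d}. f k))))"
proof (cases "\<exists>j\<in>{c<..d}. e j")
  case False
  then have "(\<Sum>j\<in>{c<..d}. f j) = 0" using zero by (intro sum.neutral) auto
  moreover have "(\<Sum>j\<in>{c<..d}. of_bool (e j \<and> (\<forall>l\<in>{c<..<j}. \<not> e l)) * (1 - exp (- (\<Sum>k\<in>{j..d}. f k)))) = 0"
    using False by (intro sum.neutral) auto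
  ultimately show ?thesis by simp
next
  case True
  define j0 where "j0 = (LEAST j. j \<in> {c<..d} \<and> e j)"
  have j0: "j0 \<in> {c<..d}" "e j0"
    using LeastI_ex[of "\<lambda>j. j \<in> {c<..d} \<and> e j"] True unfolding j0_def by blast+
  have least: "\<not> e l" if "l \<in> {c<..<j0}" for l
    using not_less_Least[of l "\<lambda>j. j \<in> {c<..d} \<and> e j"] that j0(1) unfolding j0_def[symmetric] by auto
  have "(\<Sum>j\<in>{c<..d}. of_bool (e j \<and> (\<forall>l\<in>{c<..<j}. \<not> e l)) * (1 - exp (- (\<Sum>k\<in>{j..d}. f k)))) =
      (\<Sum>j\<in>{j0}. of_bool (e j \<and> (\<forall>l\<in>{c<..<j}. \<not> e l)) * (1 - exp (- (\<Sum>k\<in>{j..d}. f k))))"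
  proof (rule sum.mono_neutral_right)
    show "\<forall>j\<in>{c<..d} - {j0}. of_bool (e j \<and> (\<forall>l\<in>{c<..<j}. \<not> e l)) * (1 - exp (- (\<Sum>k\<in>{j..d}. f k))) = 0"
    proof
      fix j assume j: "j \<in> {c<..d} - {j0}"
      have "\<not> (e j \<and> (\<forall>l\<in>{c<..<j}. \<not> e l))"
        using j j0 least[of j] by (cases "j < j0") auto
      then show "of_bool (e j \<and> (\<forall>l\<in>{c<..<j}. \<not> e l)) * (1 - exp (- (\<Sum>k\<in>{j..d}. f k))) = 0"
        by simp
    qed
  qed (use j0 in auto)
  also have "\<dots> = 1 - exp (- (\<Sum>k\<in>{j0..d}. f k))"
    using j0 least by simp
  also have "(\<Sum>k\<in>{j0..d}. f k) = (\<Sum>j\<in>{c<..d}. f j)"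
    by (rule sum.mono_neutral_left) (use j0 least zero in auto)
  finally show ?thesis by simp
qed

text \<open>
  The two summands agree unless there is an exceedance at distance between \<open>m\<close> and \<open>w\<close>, or the
  window of radius \<open>m\<close> around \<open>j\<close> leaves the block \<open>{c<..c + w}\<close>; in both cases they differ by at most one.
\<close>

lemma window_truncation:
  fixes f :: "nat \<Rightarrow> real" and e :: "int \<Rightarrow> bool"
  assumes nonneg: "\<And>j. 0 \<le> f j" and zero: "\<And>j. \<not> e (int j) \<Longrightarrow> f j = 0"
    and j: "j \<in> {c<..c + w}"
  shows "\<bar>of_bool (e (int j) \<and> (\<forall>l\<in>{c<..<j}. \<not> e (int l))) * (1 - exp (- (\<Sum>k\<in>{j..c + w}. f k))) -
      of_bool (e (int j) \<and> (\<forall>l\<in>{-int m..-1}. \<not> e (int j + l))) * (1 - exp (- (\<Sum>k\<le>m. f (j + k))))\<bar>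
    \<le> of_bool ((\<exists>t. int m \<le> \<bar>t\<bar> \<and> \<bar>t\<bar> \<le> int w \<and> e (int j + t)) \<and> e (int j)) +
      of_bool (e (int j)) * of_bool (j \<le> c + m \<or> c + w < j + m)"
    (is "\<bar>?T - ?W\<bar> \<le> ?far + ?edge")
proof (cases "e (int j) \<and> \<not> (\<exists>t. int m \<le> \<bar>t\<bar> \<and> \<bar>t\<bar> \<le> int w \<and> e (int j + t)) \<and> \<not> (j \<le> c + m \<or> c + w < j + m)")
  case True
  then have no: "\<not> e (int j + t)" if "int m \<le> \<bar>t\<bar>" "\<bar>t\<bar> \<le> int w" for t using that by blast
  have "(\<forall>l\<in>{c<..<j}. \<not> e (int l)) \<longleftrightarrow> (\<forall>l\<in>{-int m..-1}. \<not> e (int j + l))"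
  proof
    assume *: "\<forall>l\<in>{c<..<j}. \<not> e (int l)"
    show "\<forall>l\<in>{-int m..-1}. \<not> e (int j + l)"
    proof
      fix l assume l: "l \<in> {-int m..-1}"
      then have "nat (int j + l) \<in> {c<..<j}" using True by auto
      with * have "\<not> e (int (nat (int j + l)))" by blast
      then show "\<not> e (int j + l)" using l True by (simp add: nat_0_le split: if_splits)
    qed
  next
    assume *: "\<forall>l\<in>{-int m..-1}. \<not> e (int j + l)"
    show "\<forall>l\<in>{c<..<j}. \<not> e (int l)"
    proof
      fix l assume l: "l \<in> {c<..<j}"
      show "\<not> e (int l)"
      proof (cases "j \<le> l + m")
        case True
        then have "int l - int j \<in> {-int m..-1}" using l by auto
        with * have "\<not> e (int j + (int l - int j))" by blast
        then show ?thesis by simp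
      next
        case False
        then show ?thesis using no[of "int l - int j"] l j by auto
      qed
    qed
  qed
  moreover have "(\<Sum>k\<in>{j..c + w}. f k) = (\<Sum>k\<le>m. f (j + k))"
  proof -
    have "(\<Sum>k\<le>m. f (j + k)) = (\<Sum>k\<in>{j..j + m}. f k)"
      by (rule sum.reindex_bij_witness[of _ "\<lambda>k. k - j" "\<lambda>k. j + k"]) auto
    also have "\<dots> = (\<Sum>k\<in>{j..c + w}. f k)"
    proof (rule sum.mono_neutral_left)
      show "\<forall>k\<in>{j..c + w} - {j..j + m}. f k = 0"
      proof
        fix k assume k: "k \<in> {j..c + w} - {j..j + m}"
        then have "\<not> e (int j + (int k - int j))" using j by (intro no) auto
        then show "f k = 0" using zero by simp
      qed
    qed (use True in auto)
    finally show ?thesis by simp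
  qed
  ultimately have "?T = ?W" by simp
  then show ?thesis by simp
next
  case False
  have b: "0 \<le> 1 - exp (- (\<Sum>k\<in>{j..c + w}. f k)) \<and> 1 - exp (- (\<Sum>k\<in>{j..c + w}. f k)) \<le> 1"
    "0 \<le> 1 - exp (- (\<Sum>k\<le>m. f (j + k))) \<and> 1 - exp (- (\<Sum>k\<le>m. f (j + k))) \<le> 1"
    by (rule one_minus_exp_bounds, rule sum_nonneg, rule nonneg)+
  have "\<bar>?T - ?W\<bar> \<le> of_bool (e (int j))"
    by (rule abs_diff_of_bool_le[OF b])
  also have "\<dots> \<le> ?far + ?edge" using False by auto
  finally show ?thesis .
qed

text \<open>
  \<open>1 - x\<close> and \<open>exp (- x)\<close> differ by at most \<open>x\<^sup>2\<close> on the unit interval, so the product and the exponential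
  of the sum differ by at most the largest term times the sum.
\<close>

lemma prod_one_minus_tendsto_exp:
  fixes D :: "nat \<Rightarrow> nat \<Rightarrow> real"
  assumes D: "\<And>n i. 0 \<le> D n i" "\<And>n i. D n i \<le> d n" and d: "d \<longlonglongrightarrow> 0"
    and lim: "(\<lambda>n. \<Sum>i\<in>I n. D n i) \<longlonglongrightarrow> L"
  shows "(\<lambda>n. \<Prod>i\<in>I n. 1 - D n i) \<longlonglongrightarrow> exp (- L)"
proof -
  have exp_lim: "(\<lambda>n. exp (- (\<Sum>i\<in>I n. D n i))) \<longlonglongrightarrow> exp (- L)"
    by (intro tendsto_intros lim)
  have bound_lim: "(\<lambda>n. d n * (\<Sum>i\<in>I n. D n i)) \<longlonglongrightarrow> 0"
    using tendsto_mult[OF d lim] by simp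
  have "(\<lambda>n. (\<Prod>i\<in>I n. 1 - D n i) - exp (- (\<Sum>i\<in>I n. D n i))) \<longlonglongrightarrow> 0"
  proof (rule Lim_null_comparison[OF _ bound_lim])
    have "\<forall>\<^sub>F n in sequentially. d n < 1" using d by (rule order_tendstoD) simp
    then show "\<forall>\<^sub>F n in sequentially. norm ((\<Prod>i\<in>I n. 1 - D n i) - exp (- (\<Sum>i\<in>I n. D n i))) \<le> d n * (\<Sum>i\<in>I n. D n i)"
    proof eventually_elim
      case (elim n)
      have quad: "\<bar>1 - D n i - exp (- D n i)\<bar> \<le> d n * D n i" for i
      proof -
        let ?x = "D n i"
        have x: "0 \<le> ?x" "?x \<le> 1" using D[where n=n and i=i] elim by linarith+
        have 1: "1 - ?x \<le> exp (- ?x)" using exp_ge_add_one_self[of "- ?x"] by simp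
        have "exp (- ?x) * (1 + ?x) \<le> exp (- ?x) * exp ?x"
          by (intro mult_left_mono exp_ge_add_one_self) auto
        then have "exp (- ?x) \<le> 1 / (1 + ?x)"
          using x by (simp add: exp_minus field_simps)
        also have "\<dots> \<le> 1 - ?x + ?x * ?x"
          using x by (simp add: field_simps)
        finally have "\<bar>1 - ?x - exp (- ?x)\<bar> \<le> ?x * ?x" using 1 by linarith
        also have "\<dots> \<le> d n * ?x" using D[where n=n and i=i] by (intro mult_right_mono) auto
        finally show ?thesis .
      qed
      show ?case
      proof (cases "finite (I n)")
        case True
        have "norm ((\<Prod>i\<in>I n. 1 - D n i) - (\<Prod>i\<in>I n. exp (- D n i))) \<le> (\<Sum>i\<in>I n. norm ((1 - D n i) - exp (- D n i)))"
        proof (rule norm_prod_diff)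
          fix i
          show "norm (1 - D n i) \<le> 1" using D[where n=n and i=i] elim by auto
          show "norm (exp (- D n i)) \<le> 1" using D(1)[of n i] by simp
        qed
        also have "\<dots> \<le> (\<Sum>i\<in>I n. d n * D n i)" using quad by (intro sum_mono) simp
        also have "\<dots> = d n * (\<Sum>i\<in>I n. D n i)" by (simp add: sum_distrib_left)
        also have "(\<Prod>i\<in>I n. exp (- D n i)) = exp (- (\<Sum>i\<in>I n. D n i))"
          using True by (simp add: exp_sum sum_negf[symmetric])
        finally show ?thesis .
      qed simp
    qed
  qed
  from tendsto_add[OF this exp_lim] show ?thesis by simp
qed

section \<open>Anticlustering\<close>

locale clustered_tail = regular_tail M X \<alpha> M' \<Theta> P Y
  for M :: "'w measure" and X :: "int \<Rightarrow> 'w \<Rightarrow> 's::finite \<Rightarrow> real" and \<alpha> :: real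
    and M' :: "'p measure" and \<Theta> :: "int \<Rightarrow> 'p \<Rightarrow> 's \<Rightarrow> real" and P :: "'p \<Rightarrow> real"
    and Y :: "int \<Rightarrow> 'p \<Rightarrow> 's \<Rightarrow> real" +
  fixes a :: "nat \<Rightarrow> real" and b :: "nat \<Rightarrow> nat"
  assumes a_pos: "\<forall>n\<ge>1. 0 < a n"
    and a_normal: "(\<lambda>n. real n * measure M {\<omega> \<in> space M. maxnorm (X 0 \<omega>) > a n}) \<longlonglongrightarrow> 1"
    and b_pos: "\<forall>n\<ge>1. 0 < b n"
    and b_top: "filterlim b at_top sequentially"
    and b_small: "(\<lambda>n. real (b n) / real n) \<longlonglongrightarrow> 0"
    and anticlustering: "anticlustering_condition M X a b"
begin

lemma a_tailp: "(\<lambda>n. real n * tailp (a n)) \<longlonglongrightarrow> 1"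
  using a_normal by (simp add: tailp_def)

lemma tailp_a_tendsto_0: "(\<lambda>n. tailp (a n)) \<longlonglongrightarrow> 0"
proof -
  have "(\<lambda>n. (real n * tailp (a n)) * (1 / real n)) \<longlonglongrightarrow> 1 * 0"
    by (intro tendsto_mult a_tailp lim_1_over_n)
  then have "(\<lambda>n. (real n * tailp (a n)) * (1 / real n)) \<longlonglongrightarrow> 0" by simp
  then show ?thesis
    by (rule Lim_transform_eventually)
      (use eventually_gt_at_top[of 0] in eventually_elim, simp)
qed

text \<open>
  \<open>P (\<parallel>X 0\<parallel> > a n)\<close> tends to zero although the tail of \<open>\<parallel>X 0\<parallel>\<close> is positive everywhere.
\<close>

lemma a_top: "filterlim a at_top sequentially"
  unfolding filterlim_at_top
proof
  fix Z :: real
  have "\<forall>\<^sub>F n in sequentially. tailp (a n) < tailp Z"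
    by (rule order_tendstoD(2)[OF tailp_a_tendsto_0 tailp_pos])
  then show "\<forall>\<^sub>F n in sequentially. Z \<le> a n"
    by eventually_elim (meson linorder_le_cases not_le tailp_mono)
qed

text \<open>
  The quantity in the anticlustering condition at \<open>u = 1\<close>, the level that matters because all marks
  of the limit have norm larger than one.
\<close>

definition far :: "nat \<Rightarrow> nat \<Rightarrow> real" where
  "far m n = measure M {\<omega> \<in> space M. (\<exists>t. int m \<le> \<bar>t\<bar> \<and> \<bar>t\<bar> \<le> int (b n) \<and> a n < maxnorm (X t \<omega>)) \<and>
     a n < maxnorm (X 0 \<omega>)} / tailp (a n)"

lemma far_small:
  assumes "0 < \<epsilon>"
  shows "\<forall>\<^sub>F m in sequentially. \<forall>\<^sub>F n in sequentially. far m n < \<epsilon>"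
proof -
  have "(\<lambda>m. limsup (\<lambda>n. ereal (far m n))) \<longlonglongrightarrow> 0"
    using anticlustering unfolding anticlustering_condition_def
    by (auto simp: cond_prob_def far_def tailp_def dest!: spec[of _ 1])
  from order_tendstoD(2)[OF this, of "ereal \<epsilon>"] assms
  have "\<forall>\<^sub>F m in sequentially. limsup (\<lambda>n. ereal (far m n)) < ereal \<epsilon>" by simp
  then show ?thesis
  proof eventually_elim
    case (elim m)
    from Limsup_lessD[OF elim] show ?case by simp
  qed
qed

text \<open>
  Any fixed window is contained in \<open>{-b n..b n}\<close> for large \<open>n\<close>, so the bound survives the passage to
  the tail process and then to unbounded windows.
\<close>

lemma far_tail_bound:
  assumes "\<forall>\<^sub>F n in sequentially. far m n < \<epsilon>"
  shows "measure M' {\<omega> \<in> space M'. \<exists>t. int m \<le> \<bar>t\<bar> \<and> 1 < maxnorm (Y t \<omega>)} \<le> \<epsilon>"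
proof -
  let ?E = "\<lambda>m'. {\<omega> \<in> space M'. \<exists>t. int m \<le> \<bar>t\<bar> \<and> \<bar>t\<bar> \<le> int m' \<and> 1 < maxnorm (Y t \<omega>)}"
  have bound: "measure M' (?E m') \<le> \<epsilon>" for m'
  proof (rule tendsto_upperbound)
    show "(\<lambda>n. exc_prob (a n) (\<lambda>\<omega>. \<exists>t. int m \<le> \<bar>t\<bar> \<and> \<bar>t\<bar> \<le> int m' \<and> a n < maxnorm (X t \<omega>))) \<longlonglongrightarrow> measure M' (?E m')"
    proof (rule exceedance_event_limit[OF a_top, of "int m' + 1" "\<lambda>p. \<exists>t. int m \<le> \<bar>t\<bar> \<and> \<bar>t\<bar> \<le> int m' \<and> p t"])
      fix p q :: "int \<Rightarrow> bool" assume pq: "\<And>t. t \<in> {- (int m' + 1)..int m' + 1} \<Longrightarrow> p t = q t"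
      have "p t = q t" if "\<bar>t\<bar> \<le> int m'" for t by (rule pq) (use that in auto)
      then show "(\<exists>t. int m \<le> \<bar>t\<bar> \<and> \<bar>t\<bar> \<le> int m' \<and> p t) = (\<exists>t. int m \<le> \<bar>t\<bar> \<and> \<bar>t\<bar> \<le> int m' \<and> q t)"
        by blast
    qed (simp, measurable)
    have "\<forall>\<^sub>F n in sequentially. m' \<le> b n" using b_top by (simp add: filterlim_at_top)
    with assms show "\<forall>\<^sub>F n in sequentially. exc_prob (a n) (\<lambda>\<omega>. \<exists>t. int m \<le> \<bar>t\<bar> \<and> \<bar>t\<bar> \<le> int m' \<and> a n < maxnorm (X t \<omega>)) \<le> \<epsilon>"
    proof eventually_elim
      case (elim n)
      have "exc_prob (a n) (\<lambda>\<omega>. \<exists>t. int m \<le> \<bar>t\<bar> \<and> \<bar>t\<bar> \<le> int m' \<and> a n < maxnorm (X t \<omega>)) \<le> far m n"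
        unfolding far_def using tailp_pos[of "a n"] elim(2)
        by (intro divide_right_mono M.finite_measure_mono) force+
      with elim(1) show ?case by linarith
    qed
  qed simp
  have "(\<lambda>m'. measure M' (?E m')) \<longlonglongrightarrow> measure M' (\<Union>m'. ?E m')"
  proof (rule M'.finite_Lim_measure_incseq)
    show "range ?E \<subseteq> sets M'" by (rule image_subsetI) measurable
    show "incseq ?E" by (rule incseq_SucI) force
  qed
  then have "measure M' (\<Union>m'. ?E m') \<le> \<epsilon>"
    by (rule LIMSEQ_le_const2) (use bound in blast)
  also have "(\<Union>m'. ?E m') = {\<omega> \<in> space M'. \<exists>t. int m \<le> \<bar>t\<bar> \<and> 1 < maxnorm (Y t \<omega>)}"
  proof (intro set_eqI iffI)
    fix \<omega> assume "\<omega> \<in> {\<omega> \<in> space M'. \<exists>t. int m \<le> \<bar>t\<bar> \<and> 1 < maxnorm (Y t \<omega>)}"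
    then obtain t where "\<omega> \<in> space M'" "int m \<le> \<bar>t\<bar>" "1 < maxnorm (Y t \<omega>)" by blast
    then have "\<omega> \<in> ?E (nat \<bar>t\<bar>)" by auto
    then show "\<omega> \<in> (\<Union>m'. ?E m')" by blast
  qed blast
  finally show ?thesis .
qed

lemma finitely_many_exceedances: "AE \<omega> in M'. \<exists>m. \<forall>t. int m \<le> \<bar>t\<bar> \<longrightarrow> maxnorm (Y t \<omega>) \<le> 1"
proof -
  let ?B = "{\<omega> \<in> space M'. \<forall>m. \<exists>t. int m \<le> \<bar>t\<bar> \<and> 1 < maxnorm (Y t \<omega>)}"
  have "measure M' ?B \<le> 0"
  proof (rule field_le_epsilon)
    fix \<epsilon> :: real assume "0 < \<epsilon>"
    from far_small[OF this] obtain m where m: "\<forall>\<^sub>F n in sequentially. far m n < \<epsilon>"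
      using eventually_happens'[OF sequentially_bot] by blast
    have "measure M' ?B \<le> measure M' {\<omega> \<in> space M'. \<exists>t. int m \<le> \<bar>t\<bar> \<and> 1 < maxnorm (Y t \<omega>)}"
      by (rule M'.finite_measure_mono) auto
    with far_tail_bound[OF m] show "measure M' ?B \<le> 0 + \<epsilon>" by linarith
  qed
  then have "measure M' ?B = 0" by (simp add: measure_le_0_iff)
  then have "AE \<omega> in M'. \<not> (\<forall>m. \<exists>t. int m \<le> \<bar>t\<bar> \<and> 1 < maxnorm (Y t \<omega>))"
    by (subst (asm) M'.prob_Collect_eq_0) auto
  then show ?thesis by eventually_elim (auto simp: not_less)
qed

text \<open>
  For the series, an exceedance at time \<open>t\<close> followed by \<open>k\<close> quiet times has by stationarity the
  same probability as one at time zero; intersecting with an exceedance at zero only lowers it.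
\<close>

lemma last_exceedance_bound:
  "measure M' {\<omega> \<in> space M'. (\<forall>j\<in>{1..int k}. \<not> 1 < maxnorm (Y (j + int t) \<omega>)) \<and> 1 < maxnorm (Y (int t) \<omega>)} \<le> future_prob k"
proof (rule LIMSEQ_le)
  show "(\<lambda>n. exc_prob (a n) (\<lambda>\<omega>. \<forall>j\<in>{1..int k}. \<not> a n < maxnorm (X j \<omega>)))
     \<longlonglongrightarrow> future_prob k"
    by (rule future_limit[OF a_top])
  show "(\<lambda>n. exc_prob (a n) (\<lambda>\<omega>. (\<forall>j\<in>{1..int k}. \<not> a n < maxnorm (X (j + int t) \<omega>)) \<and> a n < maxnorm (X (int t) \<omega>)))
     \<longlonglongrightarrow> measure M' {\<omega> \<in> space M'. (\<forall>j\<in>{1..int k}. \<not> 1 < maxnorm (Y (j + int t) \<omega>)) \<and> 1 < maxnorm (Y (int t) \<omega>)}"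
    by (rule exceedance_event_limit[OF a_top, of "int k + int t + 1"
        "\<lambda>p. (\<forall>j\<in>{1..int k}. \<not> p (j + int t)) \<and> p (int t)"]) auto
  have "measure M {\<omega> \<in> space M. ((\<forall>j\<in>{1..int k}. \<not> c < maxnorm (X (j + int t) \<omega>)) \<and> c < maxnorm (X (int t) \<omega>)) \<and> c < maxnorm (X 0 \<omega>)}
     \<le> measure M {\<omega> \<in> space M. (\<forall>j\<in>{1..int k}. \<not> c < maxnorm (X j \<omega>)) \<and> c < maxnorm (X 0 \<omega>)}" for c
  proof -
    have "Measurable.pred borel (\<lambda>z::int \<Rightarrow> 's \<Rightarrow> real. (\<forall>j\<in>{1..int k}. \<not> c < maxnorm (z j)) \<and> c < maxnorm (z 0))"
      by measurable
    from stationary_prob[OF this, of "int t"]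
    have "measure M {\<omega> \<in> space M. (\<forall>j\<in>{1..int k}. \<not> c < maxnorm (X (j + int t) \<omega>)) \<and> c < maxnorm (X (int t) \<omega>)}
      = measure M {\<omega> \<in> space M. (\<forall>j\<in>{1..int k}. \<not> c < maxnorm (X j \<omega>)) \<and> c < maxnorm (X 0 \<omega>)}"
      by simp
    moreover have "measure M {\<omega> \<in> space M. ((\<forall>j\<in>{1..int k}. \<not> c < maxnorm (X (j + int t) \<omega>)) \<and> c < maxnorm (X (int t) \<omega>)) \<and> c < maxnorm (X 0 \<omega>)}
      \<le> measure M {\<omega> \<in> space M. (\<forall>j\<in>{1..int k}. \<not> c < maxnorm (X (j + int t) \<omega>)) \<and> c < maxnorm (X (int t) \<omega>)}"
      by (rule M.finite_measure_mono) auto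
    ultimately show ?thesis by simp
  qed
  then show "\<exists>N. \<forall>n\<ge>N. measure M {\<omega> \<in> space M. ((\<forall>j\<in>{1..int k}. \<not> a n < maxnorm (X (j + int t) \<omega>)) \<and> a n < maxnorm (X (int t) \<omega>)) \<and> a n < maxnorm (X 0 \<omega>)} / tailp (a n)
     \<le> exc_prob (a n) (\<lambda>\<omega>. \<forall>j\<in>{1..int k}. \<not> a n < maxnorm (X j \<omega>))"
    using tailp_pos by (intro exI allI impI divide_right_mono) (auto intro: less_imp_le)
qed

text \<open>
  If the probability were zero, then by \<open>last_exceedance_bound\<close> no time could be the last
  exceedance of \<open>Y\<close> with positive probability. But \<open>Y\<close> exceeds at time zero and only finitely
  often, so a last exceedance exists.
\<close>

theorem past_event_pos: "0 < measure M' past_event"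
proof (rule ccontr)
  assume "\<not> 0 < measure M' past_event"
  then have zero: "measure M' past_event = 0" by (simp add: zero_less_measure_iff)
  let ?L = "\<lambda>t \<omega>. (\<forall>j\<ge>1. \<not> 1 < maxnorm (Y (int j + int t) \<omega>)) \<and> 1 < maxnorm (Y (int t) \<omega>)"
  have "AE \<omega> in M'. \<forall>t. \<not> ?L t \<omega>"
  proof (subst AE_all_countable, rule allI)
    fix t
    have "measure M' {\<omega> \<in> space M'. ?L t \<omega>} \<le> 0"
    proof (rule tendsto_lowerbound)
      show "future_prob \<longlonglongrightarrow> 0" using future_prob_tendsto zero by simp
      have "measure M' {\<omega> \<in> space M'. ?L t \<omega>} \<le> future_prob k" for k
      proof -
        have "measure M' {\<omega> \<in> space M'. ?L t \<omega>} \<le>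
          measure M' {\<omega> \<in> space M'. (\<forall>j\<in>{1..int k}. \<not> 1 < maxnorm (Y (j + int t) \<omega>)) \<and> 1 < maxnorm (Y (int t) \<omega>)}"
          by (rule M'.finite_measure_mono) (auto simp: ball_nat_int)
        with last_exceedance_bound[of k t] show ?thesis by linarith
      qed
      then show "\<forall>\<^sub>F k in sequentially. measure M' {\<omega> \<in> space M'. ?L t \<omega>} \<le> future_prob k" by simp
    qed simp
    then have "measure M' {\<omega> \<in> space M'. ?L t \<omega>} = 0" by (simp add: measure_le_0_iff)
    then show "AE \<omega> in M'. \<not> ?L t \<omega>" by (subst (asm) M'.prob_Collect_eq_0) auto
  qed
  then have "AE \<omega> in M'. False"
    using finitely_many_exceedances Y0_exceeds
  proof eventually_elim
    case (elim \<omega>)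
    then obtain m where m: "\<And>t. int m \<le> \<bar>t\<bar> \<Longrightarrow> maxnorm (Y t \<omega>) \<le> 1" by blast
    define t where "t = (GREATEST t::nat. 1 < maxnorm (Y (int t) \<omega>))"
    have bdd: "s \<le> m" if "1 < maxnorm (Y (int s) \<omega>)" for s
      using m[of "int s"] that by (cases "s \<le> m") auto
    have "1 < maxnorm (Y (int t) \<omega>)"
      unfolding t_def by (rule GreatestI_nat[of _ 0 m]) (use elim bdd in auto)
    moreover have "\<not> 1 < maxnorm (Y (int j + int t) \<omega>)" if "1 \<le> j" for j
    proof
      assume "1 < maxnorm (Y (int j + int t) \<omega>)"
      then have "j + t \<le> t"
        unfolding t_def by (intro Greatest_le_nat[of _ _ m]) (use bdd in auto)
      then show False using that by simp
    qed
    ultimately show False using elim by blast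
  qed
  then show False by simp
qed

end

section \<open>The Laplace functional of a block\<close>

text \<open>
  An abstract form of \<open>site_sum g\<close> for a test function \<open>g\<close>: what the blocks need is that \<open>f v x\<close> vanishes
  for \<open>\<parallel>x\<parallel> \<le> 1\<close> and is almost everywhere jointly continuous along the tail process.
\<close>

locale cluster_functional = clustered_tail M X \<alpha> M' \<Theta> P Y a b
  for M :: "'w measure" and X :: "int \<Rightarrow> 'w \<Rightarrow> 's::finite \<Rightarrow> real" and \<alpha> :: real
    and M' :: "'p measure" and \<Theta> :: "int \<Rightarrow> 'p \<Rightarrow> 's \<Rightarrow> real" and P :: "'p \<Rightarrow> real"
    and Y :: "int \<Rightarrow> 'p \<Rightarrow> 's \<Rightarrow> real" and a :: "nat \<Rightarrow> real" and b :: "nat \<Rightarrow> nat" +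
  fixes f :: "real \<Rightarrow> ('s \<Rightarrow> real) \<Rightarrow> real"
  assumes f_nonneg: "\<And>v x. 0 \<le> f v x"
    and f_zero: "\<And>v x. maxnorm x \<le> 1 \<Longrightarrow> f v x = 0"
    and f_measurable: "(\<lambda>(v, x). f v x) \<in> borel_measurable (borel \<Otimes>\<^sub>M borel)"
    and f_cont: "\<And>v t. \<lbrakk>0 < v; v < 1; 0 \<le> t\<rbrakk> \<Longrightarrow>
      AE \<omega> in M'. ((\<lambda>(w, x). f w x) \<longlongrightarrow> f v (Y t \<omega>))
        (nhds v \<times>\<^sub>F inf (nhds (Y t \<omega>)) (principal nonneg_cone))"
begin

lemma f_compose_measurable [measurable (raw)]:
  assumes "g \<in> borel_measurable N" "h \<in> borel_measurable N"
  shows "(\<lambda>\<omega>. f (g \<omega>) (h \<omega>)) \<in> borel_measurable N"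
  using measurable_compose[OF measurable_Pair[OF assms] f_measurable] by simp

text \<open>
  The contribution of an exceedance at absolute position \<open>j\<close>, with the path shifted so that this
  position is time zero and everything outside \<open>{-m..m}\<close> ignored.
\<close>

definition window :: "nat \<Rightarrow> nat \<Rightarrow> nat \<Rightarrow> (int \<Rightarrow> 's \<Rightarrow> real) \<Rightarrow> real" where
  "window n m j z = of_bool (\<forall>l\<in>{-int m..-1}. \<not> 1 < maxnorm (z l)) *
     (1 - exp (- (\<Sum>k\<le>m. f (real (j + k) / real n) (z (int k)))))"

definition window_mean :: "nat \<Rightarrow> nat \<Rightarrow> nat \<Rightarrow> real" where
  "window_mean n m j = exc_mean (a n) (window n m j)"

lemma window_bounds: "0 \<le> window n m j z" "window n m j z \<le> 1"
  using f_nonneg by (auto simp: window_def intro: sum_nonneg)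

lemma window_measurable [measurable]: "window n m j \<in> borel_measurable borel"
  unfolding window_def by measurable

lemma window_mean_bounds: "0 \<le> window_mean n m j" "window_mean n m j \<le> 1"
proof -
  show "0 \<le> window_mean n m j"
    unfolding window_mean_def using window_bounds tailp_pos
    by (intro divide_nonneg_nonneg Bochner_Integration.integral_nonneg) (auto simp: less_imp_le)
  have "(\<integral>\<omega>. window n m j (scaled (a n) \<omega>) * indicator (exc (a n)) \<omega> \<partial>M) \<le> (\<integral>\<omega>. indicator (exc (a n)) \<omega> \<partial>M)"
  proof (rule integral_mono)
    show "integrable M (\<lambda>\<omega>. window n m j (scaled (a n) \<omega>) * indicator (exc (a n)) \<omega>)"
      by (rule M.integrable_const_bound[where B=1])
        (use window_bounds in \<open>auto simp: abs_mult split: split_indicator\<close>)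
    show "integrable M (indicator (exc (a n)) :: 'w \<Rightarrow> real)"
      by (intro integrable_real_indicator) (auto simp: M.emeasure_eq_measure)
  qed (use window_bounds in \<open>auto split: split_indicator\<close>)
  also have "\<dots> = tailp (a n)"
    by (simp add: tailp_def)
  finally show "window_mean n m j \<le> 1"
    using tailp_pos[of "a n"] by (simp add: window_mean_def divide_le_eq)
qed

definition block :: "nat \<Rightarrow> nat \<Rightarrow> 'w \<Rightarrow> real" where
  "block n c \<omega> = (\<Sum>j\<in>{c<..c + b n}. f (real j / real n) (scaled (a n) \<omega> (int j)))"

lemma block_measurable [measurable]: "block n c \<in> borel_measurable M"
  unfolding block_def by measurable

lemma block_nonneg: "0 \<le> block n c \<omega>"
  unfolding block_def by (intro sum_nonneg f_nonneg)

definition block_loss :: "nat \<Rightarrow> nat \<Rightarrow> real" where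
  "block_loss n c = (\<integral>\<omega>. 1 - exp (- block n c \<omega>) \<partial>M)"

lemma window_shift:
  assumes n: "0 < a n"
  shows "(\<integral>\<omega>. of_bool (1 < maxnorm (scaled (a n) \<omega> (int j))) * window n m j (\<lambda>t. scaled (a n) \<omega> (t + int j)) \<partial>M)
    = window_mean n m j * tailp (a n)"
proof -
  define H :: "(int \<Rightarrow> 's \<Rightarrow> real) \<Rightarrow> real" where
    "H z = of_bool (1 < maxnorm (\<lambda>s. z 0 s / a n)) * window n m j (\<lambda>t s. z t s / a n)" for z
  have sc: "(\<lambda>z :: int \<Rightarrow> 's \<Rightarrow> real. \<lambda>t s. z t s / a n) \<in> borel_measurable borel"
    by (intro path_measurable measurable_coordinatewise_then_product) measurable
  have sc0: "(\<lambda>z :: int \<Rightarrow> 's \<Rightarrow> real. \<lambda>s. z 0 s / a n) \<in> borel_measurable borel"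
    by (intro measurable_coordinatewise_then_product) measurable
  have "H \<in> borel_measurable borel"
    unfolding H_def using measurable_compose[OF sc window_measurable] sc0 by measurable
  from stationary_integral[OF this, of "int j"]
  have "(\<integral>\<omega>. of_bool (1 < maxnorm (scaled (a n) \<omega> (int j))) * window n m j (\<lambda>t. scaled (a n) \<omega> (t + int j)) \<partial>M)
    = (\<integral>\<omega>. of_bool (1 < maxnorm (scaled (a n) \<omega> 0)) * window n m j (scaled (a n) \<omega>) \<partial>M)"
    by (simp add: H_def scaled_def)
  also have "\<dots> = (\<integral>\<omega>. window n m j (scaled (a n) \<omega>) * indicator (exc (a n)) \<omega> \<partial>M)"
    by (rule Bochner_Integration.integral_cong) (auto simp: maxnorm_scaled[OF n])
  also have "\<dots> = window_mean n m j * tailp (a n)"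
    using tailp_pos[of "a n"] by (simp add: window_mean_def)
  finally show ?thesis .
qed

lemma prob_exceed: "measure M {\<omega> \<in> space M. a n < maxnorm (X t \<omega>)} = tailp (a n)"
proof -
  have "Measurable.pred borel (\<lambda>z :: int \<Rightarrow> 's \<Rightarrow> real. a n < maxnorm (z 0))" by measurable
  from stationary_prob[OF this, of t] show ?thesis by (simp add: tailp_def)
qed

lemma prob_far: "measure M {\<omega> \<in> space M. (\<exists>t. int m \<le> \<bar>t\<bar> \<and> \<bar>t\<bar> \<le> int (b n) \<and> a n < maxnorm (X (int j + t) \<omega>)) \<and>
     a n < maxnorm (X (int j) \<omega>)} = far m n * tailp (a n)"
proof -
  have "Measurable.pred borel (\<lambda>z :: int \<Rightarrow> 's \<Rightarrow> real. (\<exists>t. int m \<le> \<bar>t\<bar> \<and> \<bar>t\<bar> \<le> int (b n) \<and> a n < maxnorm (z t)) \<and> a n < maxnorm (z 0))"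
    by measurable
  from stationary_prob[OF this, of "int j"] show ?thesis
    using tailp_pos[of "a n"] by (simp add: far_def add.commute)
qed

text \<open>
  The expectation of \<open>window_truncation\<close>. Each of the \<open>b n\<close> positions contributes a distant exceedance
  with probability \<open>far m n * tailp (a n)\<close>, and at most \<open>2 * m\<close> positions are within \<open>m\<close> of an end of
  the block.
\<close>

lemma block_loss_approx:
  assumes n: "0 < a n"
  shows "\<bar>block_loss n c - (\<Sum>j\<in>{c<..c + b n}. window_mean n m j) * tailp (a n)\<bar>
    \<le> (real (b n) * far m n + 2 * real m) * tailp (a n)"
proof -
  define e where "e \<omega> t \<longleftrightarrow> 1 < maxnorm (scaled (a n) \<omega> t)" for \<omega> t
  have e_X: "e \<omega> t \<longleftrightarrow> a n < maxnorm (X t \<omega>)" for \<omega> t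
    by (simp add: e_def maxnorm_scaled[OF n])
  define V where "V j \<omega> = of_bool (e \<omega> (int j)) * window n m j (\<lambda>t. scaled (a n) \<omega> (t + int j))" for j \<omega>
  define err where "err j \<omega> = (of_bool ((\<exists>t. int m \<le> \<bar>t\<bar> \<and> \<bar>t\<bar> \<le> int (b n) \<and> e \<omega> (int j + t)) \<and> e \<omega> (int j)) :: real) +
      of_bool (e \<omega> (int j)) * of_bool (j \<le> c + m \<or> c + b n < j + m)" for j \<omega>
  have [measurable]: "Measurable.pred M (\<lambda>\<omega>. e \<omega> t)" for t
    unfolding e_def by measurable
  have shift_meas: "(\<lambda>\<omega> t. scaled (a n) \<omega> (t + int j)) \<in> borel_measurable M" for j
    by (rule path_measurable) measurable
  have [measurable]: "V j \<in> borel_measurable M" for j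
    unfolding V_def using measurable_compose[OF shift_meas window_measurable] by measurable
  have [measurable]: "err j \<in> borel_measurable M" for j
    unfolding err_def by measurable
  have V_bound: "0 \<le> V j \<omega>" "V j \<omega> \<le> 1" for j \<omega>
    using window_bounds by (auto simp: V_def)
  have err_bound: "0 \<le> err j \<omega>" "err j \<omega> \<le> 2" for j \<omega>
    by (auto simp: err_def)
  have intV: "integrable M (V j)" for j
    by (rule M.integrable_const_bound[where B=1]) (use V_bound in auto)
  have int_err: "integrable M (err j)" for j
    by (rule M.integrable_const_bound[where B=2]) (use err_bound in auto)
  have int_loss: "integrable M (\<lambda>\<omega>. 1 - exp (- block n c \<omega>))"
    by (rule M.integrable_const_bound[where B=1]) (use block_nonneg in auto)

  have pointwise: "\<bar>1 - exp (- block n c \<omega>) - (\<Sum>j\<in>{c<..c + b n}. V j \<omega>)\<bar> \<le> (\<Sum>j\<in>{c<..c + b n}. err j \<omega>)" for \<omega>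
  proof -
    let ?f = "\<lambda>j. f (real j / real n) (scaled (a n) \<omega> (int j))"
    have zero: "?f j = 0" if "\<not> e \<omega> (int j)" for j
      using that by (intro f_zero) (simp add: e_def)
    have V_eq: "V j \<omega> = of_bool (e \<omega> (int j) \<and> (\<forall>l\<in>{-int m..-1}. \<not> e \<omega> (int j + l))) * (1 - exp (- (\<Sum>k\<le>m. ?f (j + k))))" for j
      by (simp add: V_def window_def e_def add.commute)
    have "1 - exp (- block n c \<omega>) - (\<Sum>j\<in>{c<..c + b n}. V j \<omega>) =
      (\<Sum>j\<in>{c<..c + b n}. of_bool (e \<omega> (int j) \<and> (\<forall>l\<in>{c<..<j}. \<not> e \<omega> (int l))) * (1 - exp (- (\<Sum>k\<in>{j..c + b n}. ?f k))) - V j \<omega>)"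
      unfolding block_def
      by (subst first_exceedance_expansion[where e="\<lambda>j. e \<omega> (int j)", OF zero]) (simp_all add: sum_subtractf)
    also have "\<bar>\<dots>\<bar> \<le> (\<Sum>j\<in>{c<..c + b n}. err j \<omega>)"
      unfolding V_eq err_def
      by (rule order_trans[OF sum_abs sum_mono], rule window_truncation)
        (use f_nonneg zero in auto)
    finally show ?thesis .
  qed

  have E_err: "(\<integral>\<omega>. err j \<omega> \<partial>M) = far m n * tailp (a n) + tailp (a n) * of_bool (j \<le> c + m \<or> c + b n < j + m)" for j
  proof -
    have prob: "(\<integral>\<omega>. of_bool (R \<omega>) \<partial>M) = measure M {\<omega> \<in> space M. R \<omega>}" if [measurable]: "Measurable.pred M R" for R
    proof -
      have "(\<integral>\<omega>. of_bool (R \<omega>) \<partial>M) = (\<integral>\<omega>. indicator {\<omega> \<in> space M. R \<omega>} \<omega> \<partial>M :: real)"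
        by (rule Bochner_Integration.integral_cong) auto
      also have "\<dots> = measure M {\<omega> \<in> space M. R \<omega>}" by simp
      finally show ?thesis .
    qed
    have int: "integrable M (\<lambda>\<omega>. of_bool (R \<omega>) :: real)" if [measurable]: "Measurable.pred M R" for R
      by (rule M.integrable_const_bound[where B=1]) auto
    have "(\<integral>\<omega>. err j \<omega> \<partial>M) = (\<integral>\<omega>. of_bool ((\<exists>t. int m \<le> \<bar>t\<bar> \<and> \<bar>t\<bar> \<le> int (b n) \<and> e \<omega> (int j + t)) \<and> e \<omega> (int j)) \<partial>M) +
        (\<integral>\<omega>. of_bool (e \<omega> (int j)) * of_bool (j \<le> c + m \<or> c + b n < j + m) \<partial>M)"
      unfolding err_def by (intro Bochner_Integration.integral_add integrable_mult_left int) measurable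
    also have "\<dots> = far m n * tailp (a n) + tailp (a n) * of_bool (j \<le> c + m \<or> c + b n < j + m)"
      using prob_far[of m n j] prob_exceed[of n "int j"]
      by (subst prob, measurable, simp add: prob e_X)
    finally show ?thesis .
  qed
  have EV: "(\<integral>\<omega>. V j \<omega> \<partial>M) = window_mean n m j * tailp (a n)" for j
    unfolding V_def e_def by (rule window_shift[OF n])
  have "block_loss n c - (\<Sum>j\<in>{c<..c + b n}. window_mean n m j) * tailp (a n) =
      (\<integral>\<omega>. 1 - exp (- block n c \<omega>) - (\<Sum>j\<in>{c<..c + b n}. V j \<omega>) \<partial>M)"
    unfolding block_loss_def sum_distrib_right
    by (subst Bochner_Integration.integral_diff[OF int_loss Bochner_Integration.integrable_sum[OF intV]],
        subst Bochner_Integration.integral_sum[OF intV])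
      (simp add: EV)
  also have "\<bar>\<dots>\<bar> \<le> (\<integral>\<omega>. \<bar>1 - exp (- block n c \<omega>) - (\<Sum>j\<in>{c<..c + b n}. V j \<omega>)\<bar> \<partial>M)"
    by (rule integral_abs_bound)
  also have "\<dots> \<le> (\<integral>\<omega>. (\<Sum>j\<in>{c<..c + b n}. err j \<omega>) \<partial>M)"
  proof (rule integral_mono)
    show "integrable M (\<lambda>\<omega>. \<bar>1 - exp (- block n c \<omega>) - (\<Sum>j\<in>{c<..c + b n}. V j \<omega>)\<bar>)"
      by (rule integrable_abs[OF Bochner_Integration.integrable_diff[OF int_loss
          Bochner_Integration.integrable_sum[OF intV]]])
    show "integrable M (\<lambda>\<omega>. \<Sum>j\<in>{c<..c + b n}. err j \<omega>)"
      by (rule Bochner_Integration.integrable_sum[OF int_err])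
  qed (rule pointwise)
  also have "\<dots> = (\<Sum>j\<in>{c<..c + b n}. \<integral>\<omega>. err j \<omega> \<partial>M)"
    by (rule Bochner_Integration.integral_sum[OF int_err])
  also have "\<dots> = (\<Sum>j\<in>{c<..c + b n}. far m n * tailp (a n) + tailp (a n) * of_bool (j \<le> c + m \<or> c + b n < j + m))"
    by (simp only: E_err)
  also have "\<dots> = (real (b n) * far m n + (\<Sum>j\<in>{c<..c + b n}. of_bool (j \<le> c + m \<or> c + b n < j + m))) * tailp (a n)"
    by (simp add: sum.distrib sum_distrib_left[symmetric] algebra_simps)
  also have "\<dots> \<le> (real (b n) * far m n + 2 * real m) * tailp (a n)"
  proof -
    have "(\<Sum>j\<in>{c<..c + b n}. of_bool (j \<le> c + m \<or> c + b n < j + m)) = real (card {j \<in> {c<..c + b n}. j \<le> c + m \<or> c + b n < j + m})"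
      by (simp add: sum.inter_filter[symmetric] of_bool_def)
    also have "card {j \<in> {c<..c + b n}. j \<le> c + m \<or> c + b n < j + m} \<le> card ({c<..c + m} \<union> {c + b n - m<..c + b n})"
      by (intro card_mono) auto
    also have "\<dots> \<le> m + m"
      by (rule order_trans[OF card_Un_le add_mono]) auto
    finally show ?thesis using tailp_pos[of "a n"] by (intro mult_right_mono) auto
  qed
  finally show ?thesis .
qed

text \<open>
  A block without exceedance loses nothing, so the loss is bounded by the expected number of
  exceedances in the block.
\<close>

lemma block_loss_bounds:
  assumes n: "0 < a n"
  shows "0 \<le> block_loss n c" "block_loss n c \<le> real (b n) * tailp (a n)"
proof -
  show "0 \<le> block_loss n c"
    unfolding block_loss_def using block_nonneg by (intro Bochner_Integration.integral_nonneg) auto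
  have int: "integrable M (\<lambda>\<omega>. of_bool (a n < maxnorm (X (int j) \<omega>)) :: real)" for j
    by (rule M.integrable_const_bound[where B=1]) auto
  have prob: "(\<integral>\<omega>. of_bool (a n < maxnorm (X (int j) \<omega>)) \<partial>M) = tailp (a n)" for j
  proof -
    have "(\<integral>\<omega>. of_bool (a n < maxnorm (X (int j) \<omega>)) \<partial>M) =
        (\<integral>\<omega>. indicator {\<omega> \<in> space M. a n < maxnorm (X (int j) \<omega>)} \<omega> \<partial>M :: real)"
      by (rule Bochner_Integration.integral_cong) auto
    also have "\<dots> = measure M {\<omega> \<in> space M. a n < maxnorm (X (int j) \<omega>)}" by simp
    finally show ?thesis by (simp add: prob_exceed)
  qed
  have "block_loss n c \<le> (\<integral>\<omega>. (\<Sum>j\<in>{c<..c + b n}. of_bool (a n < maxnorm (X (int j) \<omega>))) \<partial>M)"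
    unfolding block_loss_def
  proof (rule integral_mono)
    show "integrable M (\<lambda>\<omega>. 1 - exp (- block n c \<omega>))"
      by (rule M.integrable_const_bound[where B=1]) (use block_nonneg in auto)
    show "integrable M (\<lambda>\<omega>. \<Sum>j\<in>{c<..c + b n}. of_bool (a n < maxnorm (X (int j) \<omega>)) :: real)"
      by (intro Bochner_Integration.integrable_sum int)
    fix \<omega>
    show "1 - exp (- block n c \<omega>) \<le> (\<Sum>j\<in>{c<..c + b n}. of_bool (a n < maxnorm (X (int j) \<omega>)))"
    proof (cases "\<exists>j\<in>{c<..c + b n}. a n < maxnorm (X (int j) \<omega>)")
      case True
      then obtain j where j: "j \<in> {c<..c + b n}" "a n < maxnorm (X (int j) \<omega>)" by blast
      have "(1::real) \<le> (\<Sum>j\<in>{c<..c + b n}. of_bool (a n < maxnorm (X (int j) \<omega>)))"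
        using member_le_sum[of j "{c<..c + b n}" "\<lambda>j. of_bool (a n < maxnorm (X (int j) \<omega>)) :: real"] j by simp
      moreover have "1 - exp (- block n c \<omega>) \<le> 1" by simp
      ultimately show ?thesis by linarith
    next
      case False
      have "block n c \<omega> = 0"
        unfolding block_def
      proof (rule sum.neutral, rule ballI)
        fix j assume "j \<in> {c<..c + b n}"
        with False have "\<not> 1 < maxnorm (scaled (a n) \<omega> (int j))" using maxnorm_scaled[OF n] by blast
        then show "f (real j / real n) (scaled (a n) \<omega> (int j)) = 0" by (intro f_zero) simp
      qed
      then show ?thesis by (simp add: sum_nonneg)
    qed
  qed
  also have "\<dots> = real (b n) * tailp (a n)"
    unfolding Bochner_Integration.integral_sum[OF int] prob by simp
  finally show "block_loss n c \<le> real (b n) * tailp (a n)" .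
qed

end

section \<open>Riemann sums over the blocks\<close>

lemma step_function_integral:
  fixes h :: "nat \<Rightarrow> real"
  assumes n: "0 < n"
  shows "(\<integral>v. h (nat \<lceil>real n * v\<rceil>) * indicator {0<..real K / real n} v \<partial>lborel) = (\<Sum>q\<in>{1..K}. h q) / real n"
proof -
  have "h (nat \<lceil>real n * v\<rceil>) * indicator {0<..real K / real n} v =
      (\<Sum>q\<in>{1..K}. h q * indicator {(real q - 1) / real n<..real q / real n} v)" for v
  proof -
    have cell: "v \<in> {(real q - 1) / real n<..real q / real n} \<longleftrightarrow> \<lceil>real n * v\<rceil> = int q" for q
      using n by (auto simp: ceiling_eq_iff field_simps)
    have range: "v \<in> {0<..real K / real n} \<longleftrightarrow> nat \<lceil>real n * v\<rceil> \<in> {1..K}"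
    proof -
      have "v \<in> {0<..real K / real n} \<longleftrightarrow> 0 < real n * v \<and> real n * v \<le> real K"
        using n by (auto simp: field_simps zero_less_mult_iff)
      also have "\<dots> \<longleftrightarrow> 1 \<le> \<lceil>real n * v\<rceil> \<and> \<lceil>real n * v\<rceil> \<le> int K"
        by (safe; linarith)
      also have "\<dots> \<longleftrightarrow> nat \<lceil>real n * v\<rceil> \<in> {1..K}"
        unfolding atLeastAtMost_iff by (safe; linarith)
      finally show ?thesis .
    qed
    have "(\<Sum>q\<in>{1..K}. h q * indicator {(real q - 1) / real n<..real q / real n} v) =
      (\<Sum>q\<in>{1..K}. if q = nat \<lceil>real n * v\<rceil> then h q else 0)"
    proof (rule sum.cong)
      fix q assume q: "q \<in> {1..K}"
      have e: "\<lceil>real n * v\<rceil> = int q \<longleftrightarrow> q = nat \<lceil>real n * v\<rceil>"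
        using q unfolding atLeastAtMost_iff by (safe; linarith)
      show "h q * indicator {(real q - 1) / real n<..real q / real n} v = (if q = nat \<lceil>real n * v\<rceil> then h q else 0)"
        unfolding indicator_def cell e by simp
    qed simp
    also have "\<dots> = (if nat \<lceil>real n * v\<rceil> \<in> {1..K} then h (nat \<lceil>real n * v\<rceil>) else 0)"
      by (simp add: sum.delta)
    finally show ?thesis unfolding indicator_def range by simp
  qed
  moreover have em: "emeasure lborel {(real q - 1) / real n<..real q / real n} = ennreal (1 / real n)" for q
    by (subst emeasure_lborel_Ioc) (auto simp: divide_right_mono diff_divide_distrib)
  ultimately have "(\<integral>v. h (nat \<lceil>real n * v\<rceil>) * indicator {0<..real K / real n} v \<partial>lborel) =
      (\<integral>v. (\<Sum>q\<in>{1..K}. h q * indicator {(real q - 1) / real n<..real q / real n} v) \<partial>lborel)"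
    by simp
  also have "\<dots> = (\<Sum>q\<in>{1..K}. \<integral>v. h q * indicator {(real q - 1) / real n<..real q / real n} v \<partial>lborel)"
    by (intro Bochner_Integration.integral_sum integrable_mult_right integrable_real_indicator)
      (auto simp: em)
  also have "\<dots> = (\<Sum>q\<in>{1..K}. h q / real n)"
  proof (rule sum.cong)
    fix q
    have "measure lborel {(real q - 1) / real n<..real q / real n} = 1 / real n"
      by (simp add: measure_def em)
    then show "(\<integral>v. h q * indicator {(real q - 1) / real n<..real q / real n} v \<partial>lborel) = h q / real n"
      by simp
  qed simp
  finally show ?thesis by (simp add: sum_divide_distrib)
qed

lemma sum_over_blocks:
  fixes h :: "nat \<Rightarrow> real"
  shows "(\<Sum>i\<in>{1..k}. \<Sum>j\<in>{(i - 1) * w<..(i - 1) * w + w}. h j) = (\<Sum>j\<in>{1..k * w}. h j)"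
proof (induction k)
  case (Suc k)
  have "{1..Suc k * w} = {1..k * w} \<union> {k * w<..k * w + w}" by auto
  then have "(\<Sum>j\<in>{1..Suc k * w}. h j) = (\<Sum>j\<in>{1..k * w}. h j) + (\<Sum>j\<in>{k * w<..k * w + w}. h j)"
    by (simp only:) (rule sum.union_disjoint, auto)
  with Suc show ?case by simp
qed simp

context cluster_functional
begin

definition cluster_window :: "nat \<Rightarrow> real \<Rightarrow> (int \<Rightarrow> 's \<Rightarrow> real) \<Rightarrow> real" where
  "cluster_window m v z = of_bool (\<forall>l\<in>{-int m..-1}. \<not> 1 < maxnorm (z l)) * (1 - exp (- (\<Sum>k\<le>m. f v (z (int k)))))"

definition cluster_total :: "real \<Rightarrow> (int \<Rightarrow> 's \<Rightarrow> real) \<Rightarrow> real" where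
  "cluster_total v z = (\<Sum>k. f v (z (int k)))"

definition cluster_loss :: "real \<Rightarrow> (int \<Rightarrow> 's \<Rightarrow> real) \<Rightarrow> real" where
  "cluster_loss v z = of_bool (\<forall>l\<le>-1. maxnorm (z l) \<le> 1) * (1 - exp (- cluster_total v z))"

lemma cluster_window_bounds: "0 \<le> cluster_window m v z" "cluster_window m v z \<le> 1"
  using f_nonneg by (auto simp: cluster_window_def intro: sum_nonneg)

lemma cluster_window_Y_measurable [measurable]:
  "(\<lambda>(v, \<omega>). cluster_window m v (\<lambda>t. Y t \<omega>)) \<in> borel_measurable (borel \<Otimes>\<^sub>M M')"
  unfolding cluster_window_def by measurable

lemma cluster_loss_Y_measurable [measurable]:
  "(\<lambda>(v, \<omega>). cluster_loss v (\<lambda>t. Y t \<omega>)) \<in> borel_measurable (borel \<Otimes>\<^sub>M M')"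
  unfolding cluster_loss_def cluster_total_def by measurable

text \<open>
  The marks \<open>(q n + k) / n\<close>, \<open>k \<le> m\<close>, all tend to the same \<open>v\<close>; joint continuity of \<open>f\<close> in mark and value
  makes \<open>tail_limit\<close> applicable with functionals depending on \<open>n\<close>.
\<close>

lemma window_mean_tendsto:
  assumes v: "0 < v" "v < 1" and q: "(\<lambda>n. real (q n) / real n) \<longlonglongrightarrow> v"
  shows "(\<lambda>n. window_mean n m (q n)) \<longlonglongrightarrow> (\<integral>\<omega>. cluster_window m v (\<lambda>t. Y t \<omega>) \<partial>M')"
  unfolding window_mean_def
proof (rule tail_limit[OF a_top, where B=1 and m="int m + 1"])
  let ?I = "{- (int m + 1)..int m + 1}"
  have "AE \<omega> in M'. \<forall>k. ((\<lambda>(w, x). f w x) \<longlongrightarrow> f v (Y (int k) \<omega>))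
        (nhds v \<times>\<^sub>F inf (nhds (Y (int k) \<omega>)) (principal nonneg_cone))"
    by (subst AE_all_countable) (use v f_cont in auto)
  then show "AE \<omega> in M'. ((\<lambda>(n, z). window n m (q n) z) \<longlongrightarrow> cluster_window m v (\<lambda>t. Y t \<omega>))
      (sequentially \<times>\<^sub>F near ?I (\<lambda>t. Y t \<omega>))"
    using AE_Y_norm_neq_1
  proof eventually_elim
    case (elim \<omega>)
    let ?F = "sequentially \<times>\<^sub>F near ?I (\<lambda>t. Y t \<omega>)"
    have f_lim: "((\<lambda>p. f (real (q (fst p) + k) / real (fst p)) (snd p (int k))) \<longlongrightarrow> f v (Y (int k) \<omega>)) ?F"
      if k: "k \<le> m" for k
    proof -
      have "(\<lambda>n. real (q n) / real n + real k / real n) \<longlonglongrightarrow> v + 0"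
        by (intro tendsto_add q lim_const_over_n)
      then have "(\<lambda>n. real (q n + k) / real n) \<longlonglongrightarrow> v" by (simp add: add_divide_distrib)
      from filterlim_compose[OF this filterlim_fst]
      have 1: "filterlim (\<lambda>p. real (q (fst p) + k) / real (fst p)) (nhds v) ?F" .
      have "filterlim (\<lambda>z. z (int k)) (inf (nhds (Y (int k) \<omega>)) (principal nonneg_cone)) (near ?I (\<lambda>t. Y t \<omega>))"
        unfolding filterlim_inf filterlim_principal
        using near_coordinate[of ?I "int k" "\<lambda>t. Y t \<omega>"] k
          eventually_mono[OF near_paths[of ?I "\<lambda>t. Y t \<omega>"], of "\<lambda>z. z (int k) \<in> nonneg_cone"]
        by (auto simp: nonneg_paths_def)
      from filterlim_compose[OF this filterlim_snd]
      have 2: "filterlim (\<lambda>p. snd p (int k)) (inf (nhds (Y (int k) \<omega>)) (principal nonneg_cone)) ?F" .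
      from filterlim_compose[OF elim(1)[rule_format] filterlim_Pair[OF 1 2]]
      show ?thesis by simp
    qed
    have "\<forall>\<^sub>F z in near ?I (\<lambda>t. Y t \<omega>). \<forall>t\<in>?I. 1 < maxnorm (z t) \<longleftrightarrow> 1 < maxnorm (Y t \<omega>)"
      by (rule near_same_exceedances) (use elim in auto)
    then have "\<forall>\<^sub>F z in near ?I (\<lambda>t. Y t \<omega>). (of_bool (\<forall>l\<in>{-int m..-1}. \<not> 1 < maxnorm (z l)) :: real) =
        of_bool (\<forall>l\<in>{-int m..-1}. \<not> 1 < maxnorm (Y l \<omega>))"
      by eventually_elim auto
    then have "((\<lambda>z. of_bool (\<forall>l\<in>{-int m..-1}. \<not> 1 < maxnorm (z l)) :: real) \<longlongrightarrow>
        of_bool (\<forall>l\<in>{-int m..-1}. \<not> 1 < maxnorm (Y l \<omega>))) (near ?I (\<lambda>t. Y t \<omega>))"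
      by (rule tendsto_eventually)
    from filterlim_compose[OF this filterlim_snd]
    have bool_lim: "((\<lambda>p. of_bool (\<forall>l\<in>{-int m..-1}. \<not> 1 < maxnorm (snd p l)) :: real) \<longlongrightarrow>
        of_bool (\<forall>l\<in>{-int m..-1}. \<not> 1 < maxnorm (Y l \<omega>))) ?F" .
    have "((\<lambda>p. of_bool (\<forall>l\<in>{-int m..-1}. \<not> 1 < maxnorm (snd p l)) *
        (1 - exp (- (\<Sum>k\<le>m. f (real (q (fst p) + k) / real (fst p)) (snd p (int k)))))) \<longlongrightarrow> cluster_window m v (\<lambda>t. Y t \<omega>)) ?F"
      unfolding cluster_window_def
      by (intro tendsto_mult bool_lim tendsto_diff tendsto_const tendsto_exp tendsto_minus tendsto_sum f_lim) auto
    then show ?case by (simp add: window_def case_prod_beta')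
  qed
  show "(\<lambda>\<omega>. cluster_window m v (\<lambda>t. Y t \<omega>)) \<in> borel_measurable M'"
    unfolding cluster_window_def by measurable
  show "(\<lambda>\<omega>. window n m (q n) (scaled (a n) \<omega>)) \<in> borel_measurable M" for n
    by (rule measurable_compose[OF scaled_measurable window_measurable])
qed (use window_bounds cluster_window_bounds in auto)

text \<open>
  The number of indices in the complete blocks; the remaining ones are fewer than \<open>b n\<close>.
\<close>

definition covered :: "nat \<Rightarrow> nat" where
  "covered n = (n div b n) * b n"

lemma covered_le: "covered n \<le> n"
  by (simp add: covered_def)

lemma covered_tendsto: "(\<lambda>n. real (covered n) / real n) \<longlonglongrightarrow> 1"
proof (rule tendsto_sandwich)
  show "(\<lambda>n. 1 - real (b n) / real n) \<longlonglongrightarrow> 1"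
    using tendsto_diff[OF tendsto_const[of 1] b_small] by simp
  show "(\<lambda>n. 1::real) \<longlonglongrightarrow> 1" by simp
  show "\<forall>\<^sub>F n in sequentially. 1 - real (b n) / real n \<le> real (covered n) / real n"
    using eventually_gt_at_top[of 0]
  proof eventually_elim
    case (elim n)
    have "n mod b n < b n" using b_pos elim by simp
    moreover have "covered n + n mod b n = n" by (simp add: covered_def)
    ultimately have "real n - real (b n) \<le> real (covered n)" by linarith
    then have "(real n - real (b n)) / real n \<le> real (covered n) / real n"
      by (rule divide_right_mono) simp
    then show ?case using elim by (simp add: diff_divide_distrib)
  qed
  show "\<forall>\<^sub>F n in sequentially. real (covered n) / real n \<le> 1"
    using covered_le by (intro always_eventually allI) (auto simp: divide_le_eq_1)
qed

definition window_intensity :: "nat \<Rightarrow> real" where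
  "window_intensity m = (\<integral>v. (\<integral>\<omega>. cluster_window m v (\<lambda>t. Y t \<omega>) \<partial>M') * indicator {0<..<1} v \<partial>lborel)"

definition intensity :: real where
  "intensity = (\<integral>v. (\<integral>\<omega>. cluster_loss v (\<lambda>t. Y t \<omega>) \<partial>M') * indicator {0<..<1} v \<partial>lborel)"

lemma expected_window_measurable [measurable]:
  "(\<lambda>v. \<integral>\<omega>. cluster_window m v (\<lambda>t. Y t \<omega>) \<partial>M') \<in> borel_measurable borel"
  by (rule M'.borel_measurable_lebesgue_integral) measurable

lemma expected_loss_measurable [measurable]:
  "(\<lambda>v. \<integral>\<omega>. cluster_loss v (\<lambda>t. Y t \<omega>) \<partial>M') \<in> borel_measurable borel"
  by (rule M'.borel_measurable_lebesgue_integral) measurable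

text \<open>
  Written as the integral of a step function in the mark, the sum converges by dominated
  convergence, since the summands are bounded by one and converge for every mark in the open
  unit interval.
\<close>

lemma riemann_sum_tendsto:
  "(\<lambda>n. (\<Sum>j\<in>{1..covered n}. window_mean n m j) / real n) \<longlonglongrightarrow> window_intensity m"
proof -
  have ceil_meas: "(\<lambda>v::real. h (nat \<lceil>real n * v\<rceil>)) \<in> borel_measurable borel" for h :: "nat \<Rightarrow> real" and n
    by measurable
  have "(\<lambda>n. \<integral>v. window_mean n m (nat \<lceil>real n * v\<rceil>) * indicator {0<..real (covered n) / real n} v \<partial>lborel) \<longlonglongrightarrow> window_intensity m"
    unfolding window_intensity_def
  proof (rule integral_dominated_convergence[where w="indicator {0<..1}"])
    show "(\<lambda>v. (\<integral>\<omega>. cluster_window m v (\<lambda>t. Y t \<omega>) \<partial>M') * indicator {0<..<1} v) \<in> borel_measurable lborel"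
      by measurable
    show "(\<lambda>v. window_mean n m (nat \<lceil>real n * v\<rceil>) * indicator {0<..real (covered n) / real n} v) \<in> borel_measurable lborel" for n
      unfolding measurable_lborel2 by (intro borel_measurable_times ceil_meas borel_measurable_indicator) auto
    show "integrable lborel (indicator {0<..1} :: real \<Rightarrow> real)"
      by (intro integrable_real_indicator) auto
    show "AE v in lborel. norm (window_mean n m (nat \<lceil>real n * v\<rceil>) * indicator {0<..real (covered n) / real n} v) \<le> indicator {0<..1} v" for n
    proof (rule AE_I2)
      fix v :: real
      have "real (covered n) / real n \<le> 1" using covered_le[of n] by (auto simp: divide_le_eq_1)
      then show "norm (window_mean n m (nat \<lceil>real n * v\<rceil>) * indicator {0<..real (covered n) / real n} v) \<le> indicator {0<..1} v"
        using window_mean_bounds[of n m "nat \<lceil>real n * v\<rceil>"] by (auto split: split_indicator)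
    qed
    have "AE v in lborel. v \<noteq> (1::real)" by (rule AE_lborel_singleton)
    then show "AE v in lborel. (\<lambda>n. window_mean n m (nat \<lceil>real n * v\<rceil>) * indicator {0<..real (covered n) / real n} v)
        \<longlonglongrightarrow> (\<integral>\<omega>. cluster_window m v (\<lambda>t. Y t \<omega>) \<partial>M') * indicator {0<..<1} v"
    proof eventually_elim
      case (elim v)
      consider "v \<le> 0" | "1 < v" | "0 < v" "v < 1" using elim by linarith
      then show ?case
      proof cases
        case 1 then show ?thesis by simp
      next
        case 2
        have "real (covered n) / real n < v" for n
          using covered_le[of n] 2 by (intro le_less_trans[OF _ 2]) (auto simp: divide_le_eq_1)
        then have "\<not> v \<le> real (covered n) / real n" for n by (simp add: not_le)
        then show ?thesis using 2 by simp
      next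
        case 3
        have q: "(\<lambda>n. real (nat \<lceil>real n * v\<rceil>) / real n) \<longlonglongrightarrow> v"
        proof (rule tendsto_sandwich)
          show "(\<lambda>n. v) \<longlonglongrightarrow> v" by simp
          show "(\<lambda>n. v + 1 / real n) \<longlonglongrightarrow> v"
            using tendsto_add[OF tendsto_const[of v] lim_1_over_n] by simp
          show "\<forall>\<^sub>F n in sequentially. v \<le> real (nat \<lceil>real n * v\<rceil>) / real n"
            using eventually_gt_at_top[of 0]
          proof eventually_elim
            case (elim n)
            have "real n * v \<le> real (nat \<lceil>real n * v\<rceil>)" by linarith
            then show ?case using elim by (simp add: field_simps)
          qed
          show "\<forall>\<^sub>F n in sequentially. real (nat \<lceil>real n * v\<rceil>) / real n \<le> v + 1 / real n"
            using eventually_gt_at_top[of 0]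
          proof eventually_elim
            case (elim n)
            have "0 \<le> real n * v" using 3 by simp
            then have "real (nat \<lceil>real n * v\<rceil>) \<le> real n * v + 1" by linarith
            then show ?case using elim by (simp add: field_simps)
          qed
        qed
        have "\<forall>\<^sub>F n in sequentially. v < real (covered n) / real n"
          by (rule order_tendstoD(1)[OF covered_tendsto]) (use 3 in simp)
        then have "\<forall>\<^sub>F n in sequentially. window_mean n m (nat \<lceil>real n * v\<rceil>) =
            window_mean n m (nat \<lceil>real n * v\<rceil>) * indicator {0<..real (covered n) / real n} v"
          by eventually_elim (use 3 in simp)
        from Lim_transform_eventually[OF window_mean_tendsto[OF 3 q] this] show ?thesis using 3 by simp
      qed
    qed
  qed
  then show ?thesis
    by (rule Lim_transform_eventually)
      (use eventually_gt_at_top[of 0] in eventually_elim, rule step_function_integral)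
qed

text \<open>
  Once the window contains all exceedances, enlarging it changes nothing.
\<close>

lemma cluster_window_eventually:
  assumes m0: "\<And>t. int m0 \<le> \<bar>t\<bar> \<Longrightarrow> maxnorm (z t) \<le> 1" and m: "m0 \<le> m"
  shows "cluster_window m v z = cluster_loss v z"
proof -
  have "(\<forall>l\<in>{-int m..-1}. \<not> 1 < maxnorm (z l)) \<longleftrightarrow> (\<forall>l\<le>-1. maxnorm (z l) \<le> 1)"
  proof safe
    fix l :: int assume *: "\<forall>l\<in>{-int m..-1}. \<not> 1 < maxnorm (z l)" "l \<le> -1"
    show "maxnorm (z l) \<le> 1"
    proof (cases "-int m \<le> l")
      case True with * show ?thesis by (auto simp: not_less)
    next
      case False with m show ?thesis by (intro m0) auto
    qed
  next
    fix l :: int assume *: "\<forall>l\<le>-1. maxnorm (z l) \<le> 1" "l \<in> {-int m..-1}" "1 < maxnorm (z l)"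
    then have "maxnorm (z l) \<le> 1" by simp
    with *(3) show False by simp
  qed
  moreover have "cluster_total v z = (\<Sum>k\<le>m. f v (z (int k)))"
    unfolding cluster_total_def
    by (rule suminf_finite) (use m0 m in \<open>auto intro!: f_zero\<close>)
  ultimately show ?thesis by (simp add: cluster_window_def cluster_loss_def)
qed

lemma window_intensity_tendsto: "window_intensity \<longlonglongrightarrow> intensity"
  unfolding window_intensity_def[abs_def] intensity_def
proof (rule integral_dominated_convergence[where w="indicator {0<..<1}"])
  show "integrable lborel (indicator {0<..<1} :: real \<Rightarrow> real)"
    by (intro integrable_real_indicator) auto
  have bound: "\<bar>\<integral>\<omega>. cluster_window m v (\<lambda>t. Y t \<omega>) \<partial>M'\<bar> \<le> 1" for m v
  proof -
    have [measurable]: "(\<lambda>\<omega>. cluster_window m v (\<lambda>t. Y t \<omega>)) \<in> borel_measurable M'"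
      unfolding cluster_window_def by measurable
    have "0 \<le> (\<integral>\<omega>. cluster_window m v (\<lambda>t. Y t \<omega>) \<partial>M')"
      by (intro Bochner_Integration.integral_nonneg cluster_window_bounds)
    moreover have "(\<integral>\<omega>. cluster_window m v (\<lambda>t. Y t \<omega>) \<partial>M') \<le> 1"
      by (intro M'.integral_le_const M'.integrable_const_bound[where B=1])
        (use cluster_window_bounds in auto)
    ultimately show ?thesis by simp
  qed
  show "AE v in lborel. norm ((\<integral>\<omega>. cluster_window m v (\<lambda>t. Y t \<omega>) \<partial>M') * indicator {0<..<1} v) \<le> indicator {0<..<1} v" for m
    using bound by (intro AE_I2) (auto split: split_indicator)
  show "AE v in lborel. (\<lambda>m. (\<integral>\<omega>. cluster_window m v (\<lambda>t. Y t \<omega>) \<partial>M') * indicator {0<..<1} v) \<longlonglongrightarrow>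
      (\<integral>\<omega>. cluster_loss v (\<lambda>t. Y t \<omega>) \<partial>M') * indicator {0<..<1} v"
  proof (rule AE_I2, intro tendsto_mult tendsto_const)
    fix v
    show "(\<lambda>m. \<integral>\<omega>. cluster_window m v (\<lambda>t. Y t \<omega>) \<partial>M') \<longlonglongrightarrow> (\<integral>\<omega>. cluster_loss v (\<lambda>t. Y t \<omega>) \<partial>M')"
    proof (rule integral_dominated_convergence[where w="\<lambda>_. 1"])
      show "(\<lambda>\<omega>. cluster_loss v (\<lambda>t. Y t \<omega>)) \<in> borel_measurable M'"
        unfolding cluster_loss_def cluster_total_def by measurable
      show "(\<lambda>\<omega>. cluster_window m v (\<lambda>t. Y t \<omega>)) \<in> borel_measurable M'" for m
        unfolding cluster_window_def by measurable
      show "AE \<omega> in M'. (\<lambda>m. cluster_window m v (\<lambda>t. Y t \<omega>)) \<longlonglongrightarrow> cluster_loss v (\<lambda>t. Y t \<omega>)"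
        using finitely_many_exceedances
      proof eventually_elim
        case (elim \<omega>)
        then obtain m0 where m0: "\<And>t. int m0 \<le> \<bar>t\<bar> \<Longrightarrow> maxnorm (Y t \<omega>) \<le> 1" by blast
        have "cluster_window m v (\<lambda>t. Y t \<omega>) = cluster_loss v (\<lambda>t. Y t \<omega>)" if "m0 \<le> m" for m
          using m0 that by (rule cluster_window_eventually)
        then show ?case
          by (intro tendsto_eventually eventually_sequentiallyI)
      qed
    qed (use cluster_window_bounds in auto)
  qed
qed measurable

text \<open>
  The limits in \<open>n\<close> and \<open>m\<close> are interchanged: the truncation error is at most \<open>far m n\<close> plus
  \<open>2 * m / b n\<close>, times the factor \<open>n * tailp (a n)\<close> close to one.
\<close>

lemma total_block_loss_tendsto:
  "(\<lambda>n. \<Sum>i\<in>{1..n div b n}. block_loss n ((i - 1) * b n)) \<longlonglongrightarrow> intensity"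
proof (rule tendstoI)
  fix \<epsilon> :: real assume \<epsilon>: "0 < \<epsilon>"
  \<comment> \<open>First \<open>m\<close> is fixed by the anticlustering condition and the convergence of the window
    intensities, then \<open>n\<close> is taken large.\<close>
  have "\<forall>\<^sub>F m in sequentially. (\<forall>\<^sub>F n in sequentially. far m n < \<epsilon> / 8) \<and> dist (window_intensity m) intensity < \<epsilon> / 4"
    using far_small[of "\<epsilon> / 8"] tendstoD[OF window_intensity_tendsto, of "\<epsilon> / 4"] \<epsilon>
    by (intro eventually_conj) auto
  then obtain m where m: "\<forall>\<^sub>F n in sequentially. far m n < \<epsilon> / 8" "dist (window_intensity m) intensity < \<epsilon> / 4"
    using eventually_happens'[OF sequentially_bot] by blast
  let ?S = "\<lambda>n. (\<Sum>j\<in>{1..covered n}. window_mean n m j)"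
  have "(\<lambda>n. (?S n / real n) * (real n * tailp (a n))) \<longlonglongrightarrow> window_intensity m * 1"
    by (intro tendsto_mult riemann_sum_tendsto a_tailp)
  from tendstoD[OF this, of "\<epsilon> / 4"] have "\<forall>\<^sub>F n in sequentially. dist ((?S n / real n) * (real n * tailp (a n))) (window_intensity m) < \<epsilon> / 4"
    using \<epsilon> by (simp only: mult_1_right)
  moreover have "\<forall>\<^sub>F n in sequentially. real n * tailp (a n) < 2"
    by (rule order_tendstoD(2)[OF a_tailp]) simp
  moreover have "\<forall>\<^sub>F n in sequentially. 16 * real m / \<epsilon> \<le> real (b n)"
    using filterlim_compose[OF filterlim_real_sequentially b_top] by (simp add: filterlim_at_top)
  moreover have "\<forall>\<^sub>F n in sequentially. 1 \<le> n" by (rule eventually_ge_at_top)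
  ultimately show "\<forall>\<^sub>F n in sequentially. dist (\<Sum>i\<in>{1..n div b n}. block_loss n ((i - 1) * b n)) intensity < \<epsilon>"
    using m(1)
  proof eventually_elim
    case (elim n)
    have n: "0 < a n" "0 < b n" "0 < real n" using elim a_pos b_pos by auto
    let ?K = "n div b n" and ?p = "tailp (a n)"
    have p: "0 < ?p" by (rule tailp_pos)
    have far0: "0 \<le> far m n" unfolding far_def using p by simp
    have diff: "(\<Sum>i\<in>{1..?K}. block_loss n ((i - 1) * b n)) - ?S n * ?p =
      (\<Sum>i\<in>{1..?K}. block_loss n ((i - 1) * b n) - (\<Sum>j\<in>{(i - 1) * b n<..(i - 1) * b n + b n}. window_mean n m j) * ?p)"
      unfolding covered_def sum_over_blocks[symmetric] by (simp add: sum_subtractf sum_distrib_right)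
    have "\<bar>(\<Sum>i\<in>{1..?K}. block_loss n ((i - 1) * b n)) - ?S n * ?p\<bar> \<le>
        (\<Sum>i\<in>{1..?K}. (real (b n) * far m n + 2 * real m) * ?p)"
      unfolding diff by (rule order_trans[OF sum_abs sum_mono]) (rule block_loss_approx[OF n(1)])
    also have "\<dots> = (real (covered n) * far m n + 2 * real m * real ?K) * ?p"
    proof -
      have "real k * ((x * y + 2 * z) * t) = (real k * x * y + 2 * z * real k) * t" for k :: nat and x y z t :: real
        by (simp add: algebra_simps)
      then show ?thesis by (simp only: covered_def of_nat_mult sum_constant card_atLeastAtMost diff_Suc_1)
    qed
    also have "\<dots> \<le> (real n * far m n + 2 * real m * (real n / real (b n))) * ?p"
    proof (intro mult_right_mono add_mono mult_left_mono)
      show "real (covered n) \<le> real n" using covered_le[of n] by simp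
      show "real ?K \<le> real n / real (b n)" by (rule of_nat_div_le_of_nat)
    qed (use p far0 in auto)
    also have "\<dots> = (real n * ?p) * (far m n + 2 * real m / real (b n))"
      by (simp add: algebra_simps)
    also have "\<dots> \<le> 2 * (\<epsilon> / 8 + \<epsilon> / 8)"
    proof (intro mult_mono add_mono)
      show "2 * real m / real (b n) \<le> \<epsilon> / 8"
        using elim(3) n \<epsilon> by (simp add: field_simps)
    qed (use elim p far0 \<epsilon> in auto)
    also have "\<dots> = \<epsilon> / 2" by simp
    finally have 1: "\<bar>(\<Sum>i\<in>{1..?K}. block_loss n ((i - 1) * b n)) - ?S n * ?p\<bar> \<le> \<epsilon> / 2" .
    have "(?S n / real n) * (real n * ?p) = ?S n * ?p" using n by simp
    then show ?case using 1 elim(1) m(2) unfolding dist_real_def by linarith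
  qed
qed

theorem block_product_tendsto:
  "(\<lambda>n. \<Prod>i\<in>{1..n div b n}. \<integral>\<omega>. exp (- block n ((i - 1) * b n) \<omega>) \<partial>M) \<longlonglongrightarrow> exp (- intensity)"
proof -
  define D where "D n i = (if n = 0 then 0 else block_loss n ((i - 1) * b n))" for n i
  define d where "d n = (if n = 0 then 0 else real (b n) * tailp (a n))" for n
  have D0: "0 \<le> D n i" and Dd: "D n i \<le> d n" for n i
    using block_loss_bounds[of n] a_pos by (auto simp: D_def d_def)
  have "(\<lambda>n. (real (b n) / real n) * (real n * tailp (a n))) \<longlonglongrightarrow> 0 * 1"
    by (intro tendsto_mult b_small a_tailp)
  then have "(\<lambda>n. (real (b n) / real n) * (real n * tailp (a n))) \<longlonglongrightarrow> 0" by simp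
  then have d_lim: "d \<longlonglongrightarrow> 0"
    by (rule Lim_transform_eventually)
      (use eventually_gt_at_top[of 0] in eventually_elim, simp add: d_def)
  have D_lim: "(\<lambda>n. \<Sum>i\<in>{1..n div b n}. D n i) \<longlonglongrightarrow> intensity"
    by (rule Lim_transform_eventually[OF total_block_loss_tendsto])
      (use eventually_gt_at_top[of 0] in eventually_elim, simp add: D_def)
  have "(\<lambda>n. \<Prod>i\<in>{1..n div b n}. 1 - D n i) \<longlonglongrightarrow> exp (- intensity)"
    by (rule prod_one_minus_tendsto_exp[where d=d, OF D0 Dd d_lim D_lim])
  then show ?thesis
  proof (rule Lim_transform_eventually)
    show "\<forall>\<^sub>F n in sequentially. (\<Prod>i\<in>{1..n div b n}. 1 - D n i) =
        (\<Prod>i\<in>{1..n div b n}. \<integral>\<omega>. exp (- block n ((i - 1) * b n) \<omega>) \<partial>M)"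
      using eventually_gt_at_top[of 0]
    proof eventually_elim
      case (elim n)
      have int: "integrable M (\<lambda>\<omega>. exp (- block n c \<omega>))" for c
        by (rule M.integrable_const_bound[where B=1]) (use block_nonneg in auto)
      have "1 - block_loss n c = (\<integral>\<omega>. exp (- block n c \<omega>) \<partial>M)" for c
        unfolding block_loss_def using int by (simp add: M.prob_space)
      then show ?case using elim by (simp add: D_def)
    qed
  qed
qed

end

section \<open>Marks and exceedance regions\<close>

lemma space_borel_of [simp]: "space (borel_of T) = topspace T"
  by (simp add: borel_of_def space_measure_of_conv)

lemma sets_borel_of_openin: "openin T U \<Longrightarrow> U \<in> sets (borel_of T)"
  unfolding borel_of_def
  by (subst sets_measure_of) (auto dest: openin_subset)

lemma measurable_borel_ofI:
  assumes "h \<in> space N \<rightarrow> topspace T" "\<And>U. openin T U \<Longrightarrow> h -` U \<inter> space N \<in> sets N"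
  shows "h \<in> N \<rightarrow>\<^sub>M borel_of T"
  unfolding borel_of_def
  using assms by (intro measurable_measure_of) (auto dest: openin_subset)

lemma measurable_borel_of_continuous:
  assumes "continuous_map T euclidean h"
  shows "h \<in> borel_of T \<rightarrow>\<^sub>M borel"
proof (rule borel_measurableI)
  fix S :: "'b set" assume "open S"
  then have "openin T {x \<in> topspace T. h x \<in> S}"
    using assms by (auto simp: continuous_map_def)
  moreover have "{x \<in> topspace T. h x \<in> S} = h -` S \<inter> space (borel_of T)" by auto
  ultimately show "h -` S \<inter> space (borel_of T) \<in> sets (borel_of T)"
    using sets_borel_of_openin by metis
qed

lemma topspace_mark_space:
  "topspace (mark_space :: (real \<times> 's \<times> ('s \<Rightarrow> ennreal)) topology) = {0..1} \<times> UNIV \<times> (- {\<lambda>s. 0})"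
  by (simp add: mark_space_def)

lemma embed_eq_zero_iff: "x \<in> nonneg_cone \<Longrightarrow> embed x = (\<lambda>s. 0) \<longleftrightarrow> x = (\<lambda>s. 0)"
  by (auto simp: embed_def nonneg_cone_def fun_eq_iff ennreal_eq_0_iff antisym)

text \<open>
  The pairs of a time mark and a vector that define a point of \<open>mark_space\<close>; a mark or a vector
  outside falls off the space, so measurability is first shown on this set.
\<close>

definition mark_domain :: "(real \<times> ('s \<Rightarrow> real)) set" where
  "mark_domain = {(v, x). v \<in> {0..1} \<and> embed x \<noteq> (\<lambda>s. 0)}"

lemma continuous_on_embed: "continuous_on A (embed :: ('s \<Rightarrow> real) \<Rightarrow> 's \<Rightarrow> ennreal)"
  unfolding embed_def
  by (rule continuous_on_coordinatewise_then_product, rule continuous_on_ennreal,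
      rule continuous_on_subset[OF continuous_on_product_coordinates subset_UNIV])

lemma continuous_map_mark:
  "continuous_map (top_of_set mark_domain) mark_space (\<lambda>(v, x). (v, s :: 's, embed x))"
  unfolding mark_space_def continuous_map_pairwise
proof (intro conjI)
  show "continuous_map (top_of_set mark_domain) (top_of_set {0..1})
      (fst \<circ> (\<lambda>(v, x :: 's \<Rightarrow> real). (v, s, embed x)))"
    by (auto simp: continuous_map_in_subtopology comp_def case_prod_beta' mark_domain_def
        intro: continuous_on_fst continuous_on_id)
  show "continuous_map (top_of_set mark_domain) (discrete_topology UNIV)
      (fst \<circ> (snd \<circ> (\<lambda>(v, x :: 's \<Rightarrow> real). (v, s, embed x))))"
    by (simp add: comp_def case_prod_beta')
  have "continuous_on mark_domain (\<lambda>p :: real \<times> ('s \<Rightarrow> real). embed (snd p))"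
    by (rule continuous_on_compose2[OF continuous_on_embed[of UNIV]]) (auto intro: continuous_on_snd continuous_on_id)
  then show "continuous_map (top_of_set mark_domain) (top_of_set (- {\<lambda>s. 0}))
      (snd \<circ> (snd \<circ> (\<lambda>(v, x :: 's \<Rightarrow> real). (v, s, embed x))))"
    by (auto simp: continuous_map_in_subtopology comp_def case_prod_beta' mark_domain_def)
qed

lemma mark_domain_measurable: "(mark_domain :: (real \<times> ('s::countable \<Rightarrow> real)) set) \<in> sets borel"
proof -
  have "closed {p :: real \<times> ('s \<Rightarrow> real). \<forall>s. snd p s \<le> 0}"
  proof -
    have "continuous_on UNIV (\<lambda>p :: real \<times> ('s \<Rightarrow> real). snd p s)" for s
      by (rule continuous_on_compose2[OF continuous_on_product_coordinates[of s]]) (auto intro: continuous_on_snd continuous_on_id)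
    then have "closed (\<Inter>s. {p :: real \<times> ('s \<Rightarrow> real). snd p s \<le> 0})"
      by (intro closed_INT ballI closed_Collect_le continuous_on_const)
    moreover have "(\<Inter>s. {p :: real \<times> ('s \<Rightarrow> real). snd p s \<le> 0}) = {p. \<forall>s. snd p s \<le> 0}" by auto
    ultimately show ?thesis by simp
  qed
  moreover have "closed {p :: real \<times> ('s \<Rightarrow> real). 0 \<le> fst p \<and> fst p \<le> 1}"
    by (intro closed_Collect_conj closed_Collect_le continuous_intros)
  ultimately have "{p :: real \<times> ('s \<Rightarrow> real). 0 \<le> fst p \<and> fst p \<le> 1} - {p. \<forall>s. snd p s \<le> 0} \<in> sets borel"
    by (intro sets.Diff borel_closed)
  also have "{p :: real \<times> ('s \<Rightarrow> real). 0 \<le> fst p \<and> fst p \<le> 1} - {p. \<forall>s. snd p s \<le> 0} = mark_domain"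
    by (auto simp: mark_domain_def embed_def fun_eq_iff ennreal_eq_0_iff)
  finally show ?thesis .
qed

lemma mark_measurable:
  "(\<lambda>(v, x). (v, s, embed x)) \<in> restrict_space borel (mark_domain :: (real \<times> ('s::countable \<Rightarrow> real)) set)
     \<rightarrow>\<^sub>M borel_of mark_space"
proof (rule measurable_borel_ofI)
  show "(\<lambda>(v, x). (v, s, embed x)) \<in> space (restrict_space borel (mark_domain :: (real \<times> ('s \<Rightarrow> real)) set)) \<rightarrow> topspace mark_space"
    by (auto simp: topspace_mark_space space_restrict_space mark_domain_def)
  fix U :: "(real \<times> 's \<times> ('s \<Rightarrow> ennreal)) set" assume "openin mark_space U"
  then have "openin (top_of_set mark_domain) {p \<in> mark_domain. (\<lambda>(v, x). (v, s, embed x)) p \<in> U}"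
    using continuous_map_mark[of s] by (auto simp: continuous_map_def)
  then obtain W where W: "open W" "{p \<in> mark_domain. (\<lambda>(v, x). (v, s, embed x)) p \<in> U} = mark_domain \<inter> W"
    by (auto simp: openin_open)
  have "(\<lambda>(v, x). (v, s, embed x)) -` U \<inter> space (restrict_space borel mark_domain) = mark_domain \<inter> W"
    unfolding W(2)[symmetric] space_restrict_space by auto
  then show "(\<lambda>(v, x). (v, s, embed x)) -` U \<inter> space (restrict_space borel mark_domain) \<in> sets (restrict_space borel mark_domain)"
    using sets.Int[OF mark_domain_measurable borel_open[OF W(1)]] mark_domain_measurable[where 's='s]
    by (simp add: sets_restrict_space_iff)
qed

lemma mark_preimage_measurable:
  assumes "A \<in> sets (borel_of mark_space)"
  shows "{(v, x). (v, s, embed x) \<in> A} \<in> sets (borel \<Otimes>\<^sub>M (borel :: ('s::countable \<Rightarrow> real) measure))"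
proof -
  have sub: "A \<subseteq> topspace mark_space" using sets.sets_into_space[OF assms] by simp
  have "(\<lambda>(v, x). (v, s, embed x)) -` A \<inter> space (restrict_space borel mark_domain) = {(v, x). (v, s, embed x) \<in> A}"
    using sub by (auto simp: space_restrict_space mark_domain_def topspace_mark_space)
  with measurable_sets[OF mark_measurable assms, of s]
  have "{(v, x). (v, s, embed x) \<in> A} \<in> sets (restrict_space borel (mark_domain :: (real \<times> ('s \<Rightarrow> real)) set))"
    by simp
  then have "{(v, x). (v, s, embed x) \<in> A} \<in> sets (borel :: (real \<times> ('s \<Rightarrow> real)) measure)"
    using mark_domain_measurable[where 's='s] by (simp add: sets_restrict_space_iff)
  then show ?thesis by (simp only: borel_prod)
qed

abbreviation cluster_space :: "(real \<times> (int \<Rightarrow> 's::finite \<Rightarrow> real)) measure" where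
  "cluster_space \<equiv> borel \<Otimes>\<^sub>M path_space"

text \<open>
  Clusters with a mark in the open unit interval and finitely many exceedances. Almost all
  clusters are of this kind; replacing the others by a trivial cluster makes the superposition
  a finite measure for every sample point instead of almost every one.
\<close>

definition tame :: "(real \<times> (int \<Rightarrow> 's::finite \<Rightarrow> real)) set" where
  "tame = {(v, z). 0 < v \<and> v < 1 \<and> z \<in> nonneg_paths \<and> (\<exists>m. \<forall>j. int m \<le> \<bar>j\<bar> \<longrightarrow> maxnorm (z j) \<le> 1)}"

definition make_tame :: "real \<times> (int \<Rightarrow> 's::finite \<Rightarrow> real) \<Rightarrow> real \<times> (int \<Rightarrow> 's \<Rightarrow> real)" where
  "make_tame w = (if w \<in> tame then w else (1/2, \<lambda>j s. 0))"

lemma make_tame_in: "make_tame w \<in> tame"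
proof -
  have "maxnorm (\<lambda>s::'s::finite. 0::real) \<le> 1" by (simp add: maxnorm_le_iff)
  then show ?thesis by (auto simp: make_tame_def tame_def nonneg_paths_def nonneg_cone_def)
qed

lemma tame_measurable [measurable]: "tame \<in> sets (cluster_space :: (real \<times> (int \<Rightarrow> 's::finite \<Rightarrow> real)) measure)"
proof -
  have "{w \<in> space (cluster_space :: (real \<times> (int \<Rightarrow> 's \<Rightarrow> real)) measure). 0 < fst w \<and> fst w < 1 \<and>
      (\<forall>t. snd w t \<in> nonneg_cone) \<and> (\<exists>m. \<forall>j. int m \<le> \<bar>j\<bar> \<longrightarrow> maxnorm (snd w j) \<le> 1)} \<in> sets cluster_space"
    by measurable
  also have "{w \<in> space (cluster_space :: (real \<times> (int \<Rightarrow> 's \<Rightarrow> real)) measure). 0 < fst w \<and> fst w < 1 \<and>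
      (\<forall>t. snd w t \<in> nonneg_cone) \<and> (\<exists>m. \<forall>j. int m \<le> \<bar>j\<bar> \<longrightarrow> maxnorm (snd w j) \<le> 1)} = tame"
    by (simp add: set_eq_iff tame_def nonneg_paths_def space_pair_measure space_PiM)
  finally show ?thesis .
qed

lemma make_tame_measurable [measurable]: "make_tame \<in> cluster_space \<rightarrow>\<^sub>M cluster_space"
  unfolding make_tame_def by measurable (auto simp: space_pair_measure space_PiM)

locale risk_setting =
  fixes r :: "'s::finite \<Rightarrow> ('s \<Rightarrow> real) \<Rightarrow> real" and u :: real
  assumes risk: "\<forall>s. risk_functional (r s)"
    and u_pos: "0 < u"
    and bounded_by_norm: "\<forall>s. \<forall>x\<in>nonneg_cone. r s x \<le> u * maxnorm x"
begin

definition exceed :: "'s \<Rightarrow> ('s \<Rightarrow> real) set" where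
  "exceed s = {x \<in> nonneg_cone. u < r s x}"

text \<open>
  This is where the bound \<open>r s x \<le> u * \<parallel>x\<parallel>\<close> enters: all later arguments only look at exceedances
  of the norm over one.
\<close>

lemma exceed_norm: "x \<in> exceed s \<Longrightarrow> 1 < maxnorm x"
proof -
  assume "x \<in> exceed s"
  then have x: "x \<in> nonneg_cone" "u < r s x" by (simp_all add: exceed_def)
  then have "r s x \<le> u * maxnorm x" using bounded_by_norm by blast
  with x(2) have "u < u * maxnorm x" by linarith
  then show ?thesis using u_pos by simp
qed

lemma exceed_embed: "x \<in> exceed s \<Longrightarrow> embed x \<noteq> (\<lambda>s. 0)"
proof
  assume x: "x \<in> exceed s" and "embed x = (\<lambda>s. 0)"
  then have "x = (\<lambda>s. 0)" by (subst (asm) embed_eq_zero_iff) (auto simp: exceed_def)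
  then have "maxnorm x \<le> 0" by (simp add: maxnorm_le_iff)
  with exceed_norm[OF x] show False by simp
qed

lemma risk_restrict_measurable: "r s \<in> borel_measurable (restrict_space borel nonneg_cone)"
  using risk by (simp add: risk_functional_def)

lemma risk_scale: "0 < c \<Longrightarrow> x \<in> nonneg_cone \<Longrightarrow> r s (\<lambda>s'. x s' / c) = r s x / c"
proof -
  assume "0 < c" "x \<in> nonneg_cone"
  then have "r s (\<lambda>s'. (1 / c) * x s') = (1 / c) * r s x"
    using risk unfolding risk_functional_def by (metis zero_less_divide_1_iff)
  then show ?thesis by simp
qed

lemma exceed_measurable [measurable]: "exceed s \<in> sets borel"
proof -
  have "{x \<in> space (restrict_space borel nonneg_cone). u < r s x} \<in> sets (restrict_space borel nonneg_cone)"
    using risk_restrict_measurable by measurable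
  then show ?thesis by (auto simp: sets_restrict_space_iff space_restrict_space exceed_def)
qed

text \<open>
  A description by the coordinates of a point alone, which are measurable on the mark space.
\<close>

lemma exceedance_region_eq:
  "exceedance_region r u = {p \<in> topspace mark_space. (\<forall>t. snd (snd p) t \<noteq> \<infinity>) \<and>
     (\<lambda>t. enn2real (snd (snd p) t)) \<in> exceed (fst (snd p))}"
proof (intro set_eqI iffI)
  fix p assume "p \<in> exceedance_region r u"
  then obtain v s x where p: "p = (v, s, embed x)" "v \<in> {0..1}" "x \<in> nonneg_cone" "u < r s x"
    by (auto simp: exceedance_region_def)
  then have x: "x \<in> exceed s" by (simp add: exceed_def)
  have "(\<lambda>t. enn2real (embed x t)) = x" using p(3) by (auto simp: embed_def nonneg_cone_def)
  then show "p \<in> {p \<in> topspace mark_space. (\<forall>t. snd (snd p) t \<noteq> \<infinity>) \<and>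
     (\<lambda>t. enn2real (snd (snd p) t)) \<in> exceed (fst (snd p))}"
    using p x exceed_embed[OF x] by (simp add: topspace_mark_space) (simp add: embed_def)
next
  fix p assume p: "p \<in> {p \<in> topspace mark_space. (\<forall>t. snd (snd p) t \<noteq> \<infinity>) \<and>
     (\<lambda>t. enn2real (snd (snd p) t)) \<in> exceed (fst (snd p))}"
  obtain v s y where [simp]: "p = (v, s, y)" by (cases p)
  let ?x = "\<lambda>t. enn2real (y t)"
  have y: "embed ?x = y" using p by (auto simp: embed_def fun_eq_iff less_top)
  have x: "?x \<in> exceed s" using p by simp
  have "?x \<noteq> (\<lambda>t. 0)"
  proof
    assume "?x = (\<lambda>t. 0)"
    then have "maxnorm ?x \<le> 0" by (simp add: maxnorm_le_iff fun_eq_iff)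
    with exceed_norm[OF x] show False by simp
  qed
  then have "\<exists>v' s' x'. p = (v', s', embed x') \<and> v' \<in> {0..1} \<and> x' \<in> nonneg_cone - {\<lambda>s. 0} \<and> u < r s' x'"
    using p x y by (intro exI[of _ v] exI[of _ s] exI[of _ ?x]) (auto simp: exceed_def topspace_mark_space)
  then show "p \<in> exceedance_region r u" by (auto simp: exceedance_region_def)
qed

lemma region_measurable: "exceedance_region r u \<in> sets (borel_of mark_space)"
proof -
  let ?M = "borel_of (mark_space :: (real \<times> 's \<times> ('s \<Rightarrow> ennreal)) topology)"
  have snd_cont: "continuous_map mark_space euclidean (\<lambda>p :: real \<times> 's \<times> ('s \<Rightarrow> ennreal). snd (snd p))"
  proof -
    have "continuous_map mark_space (top_of_set (- {\<lambda>s. 0})) (snd \<circ> (snd :: real \<times> 's \<times> ('s \<Rightarrow> ennreal) \<Rightarrow> _))"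
      unfolding mark_space_def by (rule continuous_map_compose[OF continuous_map_snd continuous_map_snd])
    then show ?thesis by (simp add: continuous_map_in_subtopology comp_def)
  qed
  have site: "{p \<in> space ?M. fst (snd p) = s} \<in> sets ?M" for s
  proof -
    have "continuous_map mark_space (discrete_topology UNIV) (fst \<circ> (snd :: real \<times> 's \<times> ('s \<Rightarrow> ennreal) \<Rightarrow> _))"
      unfolding mark_space_def by (rule continuous_map_compose[OF continuous_map_snd continuous_map_fst])
    then have "openin mark_space {p \<in> topspace mark_space. (fst \<circ> (snd :: real \<times> 's \<times> ('s \<Rightarrow> ennreal) \<Rightarrow> _)) p \<in> {s}}"
      by (rule openin_continuous_map_preimage) simp
    then show ?thesis using sets_borel_of_openin by simp
  qed
  have y [measurable]: "(\<lambda>p. snd (snd p)) \<in> ?M \<rightarrow>\<^sub>M borel"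
    by (rule measurable_borel_of_continuous[OF snd_cont])
  have y_coord [measurable]: "(\<lambda>p. snd (snd p) t) \<in> borel_measurable ?M" for t
    by (rule measurable_product_then_coordinatewise[OF y])
  have [measurable]: "(\<lambda>p t. enn2real (snd (snd p) t)) \<in> ?M \<rightarrow>\<^sub>M borel"
    by (rule measurable_coordinatewise_then_product) measurable
  have "{p \<in> space ?M. (\<forall>t. snd (snd p) t \<noteq> \<infinity>) \<and> (\<lambda>t. enn2real (snd (snd p) t)) \<in> exceed s} \<in> sets ?M" for s
    by measurable
  then have "(\<Union>s. {p \<in> space ?M. fst (snd p) = s} \<inter>
      {p \<in> space ?M. (\<forall>t. snd (snd p) t \<noteq> \<infinity>) \<and> (\<lambda>t. enn2real (snd (snd p) t)) \<in> exceed s}) \<in> sets ?M"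
    using site by (intro sets.finite_UN sets.Int) auto
  also have "(\<Union>s. {p \<in> space ?M. fst (snd p) = s} \<inter>
      {p \<in> space ?M. (\<forall>t. snd (snd p) t \<noteq> \<infinity>) \<and> (\<lambda>t. enn2real (snd (snd p) t)) \<in> exceed s}) =
      exceedance_region r u"
    unfolding exceedance_region_eq by auto
  finally show ?thesis .
qed

lemma mark_in_region: "v \<in> {0..1} \<Longrightarrow> x \<in> exceed s \<Longrightarrow> (v, s, embed x) \<in> exceedance_region r u"
  using exceed_norm[of x s]
  by (force simp: exceedance_region_def exceed_def maxnorm_le_iff not_le[symmetric])

lemma mark_in_topspace: "v \<in> {0..1} \<Longrightarrow> x \<in> exceed s \<Longrightarrow> (v, s, embed x) \<in> topspace mark_space"
  using exceed_embed by (auto simp: topspace_mark_space)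

lemma embed_in_region_iff:
  assumes "x \<in> nonneg_cone"
  shows "(v, s, embed x) \<in> exceedance_region r u \<longleftrightarrow> v \<in> {0..1} \<and> x \<in> exceed s"
proof
  assume "(v, s, embed x) \<in> exceedance_region r u"
  then obtain x' where "v \<in> {0..1}" "embed x = embed x'" "x' \<in> nonneg_cone" "u < r s x'"
    by (auto simp: exceedance_region_def)
  moreover from this assms have "x = x'" by (auto simp: embed_def fun_eq_iff nonneg_cone_def)
  ultimately show "v \<in> {0..1} \<and> x \<in> exceed s" by (simp add: exceed_def)
qed (use mark_in_region in blast)

definition site_sum :: "(real \<times> 's \<times> ('s \<Rightarrow> ennreal) \<Rightarrow> real) \<Rightarrow> real \<Rightarrow> ('s \<Rightarrow> real) \<Rightarrow> real" where
  "site_sum g v x = (\<Sum>s\<in>UNIV. if x \<in> exceed s then g (v, s, embed x) else 0)"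

definition cluster_sum :: "(real \<times> 's \<times> ('s \<Rightarrow> ennreal) \<Rightarrow> real) \<Rightarrow> real \<times> (int \<Rightarrow> 's \<Rightarrow> real) \<Rightarrow> real" where
  "cluster_sum g w = (\<Sum>k. site_sum g (fst w) (snd w (int k)))"

end

section \<open>Test functions\<close>

locale test_function = risk_setting r u
  for r :: "'s::finite \<Rightarrow> ('s \<Rightarrow> real) \<Rightarrow> real" and u :: real +
  fixes g :: "real \<times> 's \<times> ('s \<Rightarrow> ennreal) \<Rightarrow> real"
  assumes g_cont: "continuous_map mark_space euclideanreal g"
    and g_nonneg: "\<forall>p. 0 \<le> g p"
    and g_support: "compactly_supported mark_space g"
begin

lemma g_outside: "p \<notin> topspace mark_space \<Longrightarrow> g p = 0"
  using g_support compactin_subset_topspace unfolding compactly_supported_def by blast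

lemma g_measurable: "g \<in> borel_measurable (borel_of mark_space)"
  by (rule measurable_borel_of_continuous[OF g_cont])

lemma g_bounded: "bounded (range g)"
proof -
  obtain K where K: "compactin mark_space K" "\<And>p. p \<notin> K \<Longrightarrow> g p = 0"
    using g_support by (auto simp: compactly_supported_def)
  have "bounded (g ` K)"
    using image_compactin[OF K(1) g_cont] compact_imp_bounded by simp
  then have "bounded (insert 0 (g ` K))" by simp
  then show ?thesis by (rule bounded_subset) (use K(2) in blast)
qed

lemma site_measurable: "(\<lambda>(v, x). g (v, s, embed x)) \<in> borel_measurable (borel \<Otimes>\<^sub>M borel)"
proof -
  have "(\<lambda>p. g ((\<lambda>(v, x). (v, s, embed x)) p)) \<in> borel_measurable (restrict_space borel mark_domain)"
    by (rule measurable_compose[OF mark_measurable g_measurable])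
  then have "(\<lambda>p. if p \<in> mark_domain then g ((\<lambda>(v, x). (v, s, embed x)) p) else 0) \<in> borel_measurable borel"
    using mark_domain_measurable[where 's='s]
    by (subst measurable_If_restrict_space_iff) auto
  moreover have "(\<lambda>p. if p \<in> mark_domain then g ((\<lambda>(v, x). (v, s, embed x)) p) else 0) = (\<lambda>(v, x). g (v, s, embed x))"
  proof (rule ext)
    fix p :: "real \<times> ('s \<Rightarrow> real)"
    have "g ((\<lambda>(v, x). (v, s, embed x)) p) = 0" if "p \<notin> mark_domain"
      by (rule g_outside) (use that in \<open>auto simp: mark_domain_def topspace_mark_space\<close>)
    then show "(if p \<in> mark_domain then g ((\<lambda>(v, x). (v, s, embed x)) p) else 0) = (\<lambda>(v, x). g (v, s, embed x)) p"
      by (auto simp: case_prod_beta')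
  qed
  ultimately show ?thesis by (simp only: borel_prod)
qed

lemma site_sum_nonneg: "0 \<le> site_sum g v x"
  unfolding site_sum_def using g_nonneg by (intro sum_nonneg) auto

lemma site_sum_zero: "maxnorm x \<le> 1 \<Longrightarrow> site_sum g v x = 0"
  unfolding site_sum_def using exceed_norm by (intro sum.neutral) force

lemma site_sum_measurable: "(\<lambda>(v, x). site_sum g v x) \<in> borel_measurable (borel \<Otimes>\<^sub>M borel)"
proof -
  have "(\<lambda>p. if snd p \<in> exceed s then (\<lambda>(v, x). g (v, s, embed x)) p else 0) \<in> borel_measurable (borel \<Otimes>\<^sub>M borel)" for s
    using site_measurable[of s] by measurable
  then have "(\<lambda>p. \<Sum>s\<in>UNIV. if snd p \<in> exceed s then (\<lambda>(v, x). g (v, s, embed x)) p else 0) \<in> borel_measurable (borel \<Otimes>\<^sub>M borel)"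
    by (rule borel_measurable_sum)
  then show ?thesis unfolding site_sum_def split_beta by simp
qed

lemma cluster_sum_measurable: "cluster_sum g \<in> borel_measurable cluster_space"
proof -
  have "(\<lambda>w. site_sum g (fst w) (snd w (int k))) \<in> borel_measurable cluster_space" for k
    using measurable_compose[OF measurable_Pair[of fst cluster_space borel "\<lambda>w. snd w (int k)" borel] site_sum_measurable]
    by (simp add: measurable_compose[OF measurable_snd])
  then show ?thesis unfolding cluster_sum_def by (rule borel_measurable_suminf)
qed

lemma cluster_sum_finite:
  assumes "\<And>j. int m \<le> \<bar>j\<bar> \<Longrightarrow> maxnorm (snd w j) \<le> 1"
  shows "cluster_sum g w = (\<Sum>k\<le>m. site_sum g (fst w) (snd w (int k)))"
  unfolding cluster_sum_def
  by (rule suminf_finite) (auto intro!: site_sum_zero assms)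

lemma cluster_sum_nonneg:
  assumes "w \<in> tame"
  shows "0 \<le> cluster_sum g w"
proof -
  obtain m where m: "\<And>j. int m \<le> \<bar>j\<bar> \<Longrightarrow> maxnorm (snd w j) \<le> 1"
    using assms unfolding tame_def split_beta by blast
  have "cluster_sum g w = (\<Sum>k\<le>m. site_sum g (fst w) (snd w (int k)))"
    by (rule cluster_sum_finite) (rule m)
  then show ?thesis by (simp add: sum_nonneg site_sum_nonneg)
qed

text \<open>
  If \<open>r s y > u\<close>, then nearby vectors also exceed and \<open>g\<close> is continuous at the mark; if \<open>r s y < u\<close>,
  then nearby vectors do not exceed and both sides vanish. The boundary case is excluded.
\<close>

lemma site_sum_continuous:
  assumes v: "0 < v" "v < 1" and y: "y \<in> nonneg_cone"
    and cont: "\<And>s. continuous (at y within nonneg_cone) (r s)" and neq: "\<And>s. r s y \<noteq> u"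
  shows "((\<lambda>(w, x). site_sum g w x) \<longlongrightarrow> site_sum g v y) (nhds v \<times>\<^sub>F inf (nhds y) (principal nonneg_cone))"
proof -
  let ?F = "nhds v \<times>\<^sub>F inf (nhds y) (principal nonneg_cone)"
  have fst: "filterlim fst (nhds v) ?F" by (rule filterlim_fst)
  have snd': "filterlim snd (inf (nhds y) (principal nonneg_cone)) ?F" by (rule filterlim_snd)
  then have snd: "(snd \<longlongrightarrow> y) ?F" and cone: "\<forall>\<^sub>F p in ?F. snd p \<in> nonneg_cone"
    by (auto simp: filterlim_inf filterlim_principal)
  have "((\<lambda>p. if snd p \<in> exceed s then g (fst p, s, embed (snd p)) else 0) \<longlongrightarrow>
      (if y \<in> exceed s then g (v, s, embed y) else 0)) ?F" for s
  proof -
    have r_lim: "((\<lambda>p. r s (snd p)) \<longlongrightarrow> r s y) ?F"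
      by (rule continuous_within_tendsto_compose[OF cont cone snd])
    show ?thesis
    proof (cases "u < r s y")
      case True
      from order_tendstoD(1)[OF r_lim True] cone
      have ev: "\<forall>\<^sub>F p in ?F. snd p \<in> exceed s" by eventually_elim (simp add: exceed_def)
      have v_ev: "\<forall>\<^sub>F p in ?F. 0 < fst p \<and> fst p < 1"
        using order_tendstoD(1)[OF fst v(1)] order_tendstoD(2)[OF fst v(2)] by eventually_elim simp
      have "continuous_map (top_of_set mark_domain) euclideanreal (g \<circ> (\<lambda>(v, x). (v, s, embed x)))"
        by (rule continuous_map_compose[OF continuous_map_mark g_cont])
      then have g_on: "continuous_on mark_domain (\<lambda>p. g (fst p, s, embed (snd p)))"
        by (simp add: comp_def case_prod_beta')
      have y_ex: "y \<in> exceed s" using True y by (simp add: exceed_def)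
      have "((\<lambda>p. g (fst (fst p, snd p), s, embed (snd (fst p, snd p)))) \<longlongrightarrow> g (fst (v, y), s, embed (snd (v, y)))) ?F"
      proof (rule continuous_on_tendsto_compose[OF g_on])
        show "((\<lambda>p. (fst p, snd p)) \<longlongrightarrow> (v, y)) ?F" by (rule tendsto_Pair[OF fst snd])
        show "(v, y) \<in> mark_domain" using v exceed_embed[OF y_ex] by (simp add: mark_domain_def)
        show "\<forall>\<^sub>F p in ?F. (fst p, snd p) \<in> mark_domain"
          using v_ev ev by eventually_elim (simp add: mark_domain_def split_beta exceed_embed)
      qed
      then have "((\<lambda>p. g (fst p, s, embed (snd p))) \<longlongrightarrow> g (v, s, embed y)) ?F" by simp
      then have "((\<lambda>p. if snd p \<in> exceed s then g (fst p, s, embed (snd p)) else 0) \<longlongrightarrow> g (v, s, embed y)) ?F"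
        by (rule Lim_transform_eventually) (use ev in eventually_elim, simp)
      then show ?thesis using y_ex by simp
    next
      case False
      then have "r s y < u" using neq[of s] by simp
      from order_tendstoD(2)[OF r_lim this]
      have "\<forall>\<^sub>F p in ?F. (if snd p \<in> exceed s then g (fst p, s, embed (snd p)) else 0) = 0"
        by eventually_elim (simp add: exceed_def)
      moreover have "y \<notin> exceed s" using False by (simp add: exceed_def)
      ultimately show ?thesis by (simp add: tendsto_eventually)
    qed
  qed
  then have "((\<lambda>p. \<Sum>s\<in>UNIV. if snd p \<in> exceed s then g (fst p, s, embed (snd p)) else 0) \<longlongrightarrow>
      (\<Sum>s\<in>UNIV. if y \<in> exceed s then g (v, s, embed y) else 0)) ?F"
    by (rule tendsto_sum)
  then show ?thesis unfolding site_sum_def split_beta .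
qed

text \<open>
  The test function for the mixing condition, in general discontinuous at the boundary of the region.
\<close>

definition masked :: "real \<times> 's \<times> ('s \<Rightarrow> ennreal) \<Rightarrow> real" where
  "masked p = g p * indicator (exceedance_region r u) p"

lemma masked_admissible:
  "masked \<in> borel_measurable (borel_of mark_space)" "0 \<le> masked p" "bounded (range masked)"
  "compactly_supported mark_space masked"
proof -
  show "masked \<in> borel_measurable (borel_of mark_space)"
    unfolding masked_def using g_measurable region_measurable by measurable
  show "0 \<le> masked p" using g_nonneg[rule_format, of p] by (simp add: masked_def)
  show "bounded (range masked)"
  proof -
    obtain B where B: "\<And>p. \<bar>g p\<bar> \<le> B"
      using g_bounded unfolding bounded_iff real_norm_def by blast
    have "\<bar>masked p\<bar> \<le> B" for p
      using B[of p] order_trans[OF abs_ge_zero B[of p]] unfolding masked_def indicator_def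
      by (simp split: if_split)
    then show ?thesis unfolding bounded_iff real_norm_def by blast
  qed
  show "compactly_supported mark_space masked"
    using g_support by (auto simp: compactly_supported_def masked_def)
qed

lemma sum_masked:
  assumes "x \<in> nonneg_cone"
  shows "(\<Sum>s\<in>UNIV. masked (v, s, embed x)) = site_sum g v x"
  unfolding site_sum_def
proof (rule sum.cong)
  fix s
  show "masked (v, s, embed x) = (if x \<in> exceed s then g (v, s, embed x) else 0)"
  proof (cases "v \<in> {0..1}")
    case True then show ?thesis by (simp add: masked_def embed_in_region_iff[OF assms])
  next
    case False
    then have "g (v, s, embed x) = 0" by (intro g_outside) (auto simp: topspace_mark_space)
    then show ?thesis by (simp add: masked_def)
  qed
qed simp

end

section \<open>The Laplace functional of the exceedance process\<close>

locale marked_tail = clustered_tail M X \<alpha> M' \<Theta> P Y a b + risk_setting r u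
  for M :: "'w measure" and X :: "int \<Rightarrow> 'w \<Rightarrow> 's::finite \<Rightarrow> real" and \<alpha> :: real
    and M' :: "'p measure" and \<Theta> :: "int \<Rightarrow> 'p \<Rightarrow> 's \<Rightarrow> real" and P :: "'p \<Rightarrow> real"
    and Y :: "int \<Rightarrow> 'p \<Rightarrow> 's \<Rightarrow> real" and a :: "nat \<Rightarrow> real" and b :: "nat \<Rightarrow> nat"
    and r :: "'s \<Rightarrow> ('s \<Rightarrow> real) \<Rightarrow> real" and u :: real +
  assumes mixing: "mixing_condition M X a b"
    and ae_continuous: "\<forall>s. ae_continuous_along M' Y (r s)"
begin

lemma AE_risk_neq: "AE \<omega> in M'. \<forall>t s. r s (Y t \<omega>) \<noteq> u"
proof -
  have "AE \<omega> in M'. r s (Y t \<omega>) \<noteq> u" for s t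
  proof -
    have "(\<lambda>x. if x \<in> nonneg_cone then r s x else 0) \<in> borel_measurable borel"
      by (rule measurable_restrict_space_iff[THEN iffD1]) (use risk_restrict_measurable in auto)
    then have "(\<lambda>z. if z t \<in> nonneg_cone then r s (z t) else 0) \<in> borel_measurable borel"
      by (rule measurable_compose[OF path_coordinate_measurable])
    from AE_radial_neq[OF this, of u] have "AE \<omega> in M'. P \<omega> * (if \<Theta> t \<omega> \<in> nonneg_cone then r s (\<Theta> t \<omega>) else 0) \<noteq> u"
      using u_pos by simp
    then show ?thesis
      using P_gt_1 AE_space
    proof eventually_elim
      case (elim \<omega>)
      have cone: "\<Theta> t \<omega> \<in> nonneg_cone" by (rule \<Theta>_cone[OF elim(3)])
      have "r s (\<lambda>s'. P \<omega> * \<Theta> t \<omega> s') = P \<omega> * r s (\<Theta> t \<omega>)"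
        using risk cone elim(2) by (auto simp: risk_functional_def)
      then show ?case using elim cone tail by simp
    qed
  qed
  then have "AE \<omega> in M'. \<forall>s. r s (Y t \<omega>) \<noteq> u" for t by (subst AE_all_countable) blast
  then show ?thesis by (subst AE_all_countable) blast
qed

lemma scaled_exceed_iff:
  assumes "0 < c" "\<omega> \<in> space M"
  shows "scaled c \<omega> t \<in> exceed s \<longleftrightarrow> c * u < r s (X t \<omega>)"
proof -
  have "scaled c \<omega> t \<in> nonneg_cone"
    unfolding scaled_def using assms X_cone by (intro divide_in_cone) auto
  moreover have "r s (scaled c \<omega> t) = r s (X t \<omega>) / c"
    unfolding scaled_def by (rule risk_scale[OF assms(1) X_cone[OF assms(2)]])
  ultimately show ?thesis using assms(1) by (simp add: exceed_def pos_less_divide_eq mult.commute)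
qed

context
  fixes g :: "real \<times> 's \<times> ('s \<Rightarrow> ennreal) \<Rightarrow> real"
  assumes g: "test_function r u g"
begin

interpretation test_function r u g by (rule g)

lemma cluster_functional_site_sum: "cluster_functional M X \<alpha> M' \<Theta> P Y a b (site_sum g)"
proof
  show "0 \<le> site_sum g v x" for v x by (rule site_sum_nonneg)
  show "site_sum g v x = 0" if "maxnorm x \<le> 1" for v x using that by (rule site_sum_zero)
  show "(\<lambda>(v, x). site_sum g v x) \<in> borel_measurable (borel \<Otimes>\<^sub>M borel)" by (rule site_sum_measurable)
  fix v :: real and t :: int assume v: "0 < v" "v < 1" and t: "0 \<le> t"
  have "AE \<omega> in M'. \<forall>s. continuous (at (Y t \<omega>) within nonneg_cone) (r s)"
    using ae_continuous t by (subst AE_all_countable) (auto simp: ae_continuous_along_def)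
  then show "AE \<omega> in M'. ((\<lambda>(w, x). site_sum g w x) \<longlongrightarrow> site_sum g v (Y t \<omega>))
      (nhds v \<times>\<^sub>F inf (nhds (Y t \<omega>)) (principal nonneg_cone))"
    using AE_risk_neq Y_paths
  proof eventually_elim
    case (elim \<omega>)
    show ?case
      by (rule site_sum_continuous[OF v]) (use elim in \<open>auto simp: nonneg_paths_def\<close>)
  qed
qed

interpretation cluster_functional M X \<alpha> M' \<Theta> P Y a b "site_sum g"
  by (rule cluster_functional_site_sum)

lemma exceedance_process_integral:
  assumes n: "0 < n" "0 < a n" and \<omega>: "\<omega> \<in> space M"
  shows "(\<integral>p. g p \<partial>exceedance_process X a r u n \<omega>) =
    (\<Sum>j\<in>{1..n}. site_sum g (real j / real n) (scaled (a n) \<omega> (int j)))"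
proof -
  let ?I = "{(s, j). j \<in> {1..n} \<and> a n * u < r s (X (int j) \<omega>)}"
  let ?p = "\<lambda>(s, j). (real j / real n, s, embed (\<lambda>s'. X (int j) \<omega> s' / a n))"
  have I: "(s, j) \<in> ?I \<longleftrightarrow> j \<in> {1..n} \<and> scaled (a n) \<omega> (int j) \<in> exceed s" for s j
    using scaled_exceed_iff[OF n(2) \<omega>] by simp
  have p_meas: "?p \<in> count_space ?I \<rightarrow>\<^sub>M borel_of mark_space"
  proof (subst measurable_count_space_eq1, rule funcsetI, clarify)
    fix s j assume "j \<in> {1..n}" "a n * u < r s (X (int j) \<omega>)"
    then have "(real j / real n, s, embed (scaled (a n) \<omega> (int j))) \<in> topspace mark_space"
      using scaled_exceed_iff[OF n(2) \<omega>] by (intro mark_in_topspace) auto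
    then show "(real j / real n, s, embed (\<lambda>s'. X (int j) \<omega> s' / a n)) \<in> space (borel_of mark_space)"
      by (simp add: scaled_def)
  qed
  have fin: "finite ?I"
    by (rule finite_subset[of _ "UNIV \<times> {1..n}"]) auto
  have "(\<integral>p. g p \<partial>exceedance_process X a r u n \<omega>) = (\<Sum>i\<in>?I. g (?p i))"
    unfolding exceedance_process_def Defs.point_measure_def
    by (subst integral_distr[OF p_meas g_measurable]) (rule lebesgue_integral_count_space_finite[OF fin])
  also have "\<dots> = (\<Sum>i\<in>UNIV \<times> {1..n}. if i \<in> ?I then g (?p i) else 0)"
    by (subst sum.inter_filter[symmetric]) (auto intro!: sum.cong)
  also have "\<dots> = (\<Sum>s\<in>UNIV. \<Sum>j\<in>{1..n}. if (s, j) \<in> ?I then g (?p (s, j)) else 0)"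
    by (rule sum.cartesian_product')
  also have "\<dots> = (\<Sum>j\<in>{1..n}. \<Sum>s\<in>UNIV. if (s, j) \<in> ?I then g (?p (s, j)) else 0)"
    by (rule sum.swap)
  also have "\<dots> = (\<Sum>j\<in>{1..n}. site_sum g (real j / real n) (scaled (a n) \<omega> (int j)))"
    unfolding site_sum_def
    using scaled_exceed_iff[OF n(2) \<omega>, unfolded scaled_def]
    by (intro sum.cong refl) (auto simp: scaled_def)
  finally show ?thesis .
qed

lemma masked_sum:
  assumes "0 < a n" "\<omega> \<in> space M"
  shows "(\<Sum>s\<in>UNIV. \<Sum>j\<in>J. masked (real j / real n, s, embed (\<lambda>s'. X (int j) \<omega> s' / a n))) =
    (\<Sum>j\<in>J. site_sum g (real j / real n) (scaled (a n) \<omega> (int j)))"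
proof -
  have "scaled (a n) \<omega> t \<in> nonneg_cone" for t
    using scaled_paths[OF assms] by (auto simp: nonneg_paths_def)
  from sum_masked[OF this] show ?thesis
    by (subst sum.swap) (simp add: scaled_def)
qed

text \<open>
  The mixing condition factorises the Laplace functional over the blocks, and
  \<open>block_product_tendsto\<close> gives the limit of the product.
\<close>

theorem exceedance_laplace_limit:
  "(\<lambda>n. \<integral>\<omega>. exp (- (\<integral>p. g p \<partial>exceedance_process X a r u n \<omega>)) \<partial>M) \<longlonglongrightarrow> exp (- intensity)"
proof -
  let ?whole = "\<lambda>n. \<integral>\<omega>. exp (- (\<Sum>s\<in>UNIV. \<Sum>j=1..n.
                  masked (real j / real n, s, embed (\<lambda>s'. X (int j) \<omega> s' / a n)))) \<partial>M"
  let ?blocks = "\<lambda>n. \<Prod>i=1..n div b n. \<integral>\<omega>. exp (- (\<Sum>s\<in>UNIV. \<Sum>j=(i - 1) * b n + 1..i * b n.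
                  masked (real j / real n, s, embed (\<lambda>s'. X (int j) \<omega> s' / a n)))) \<partial>M"
  have mix: "(\<lambda>n. ?whole n - ?blocks n) \<longlonglongrightarrow> 0"
    using mixing masked_admissible unfolding mixing_condition_def by blast
  have "?blocks \<longlonglongrightarrow> exp (- intensity)"
  proof (rule Lim_transform_eventually[OF block_product_tendsto])
    show "\<forall>\<^sub>F n in sequentially. (\<Prod>i\<in>{1..n div b n}. \<integral>\<omega>. exp (- block n ((i - 1) * b n) \<omega>) \<partial>M) = ?blocks n"
      using eventually_ge_at_top[of 1]
    proof eventually_elim
      case (elim n)
      then have n: "0 < a n" using a_pos by simp
      show ?case
      proof (rule prod.cong[OF refl], rule Bochner_Integration.integral_cong[OF refl])
        fix i \<omega> assume i: "i \<in> {1..n div b n}" and \<omega>: "\<omega> \<in> space M"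
        have "(i - 1) * b n + b n = i * b n" using i by (cases i) auto
        then have "{(i - 1) * b n<..(i - 1) * b n + b n} = {(i - 1) * b n + 1..i * b n}" by auto
        then show "exp (- block n ((i - 1) * b n) \<omega>) = exp (- (\<Sum>s\<in>UNIV. \<Sum>j=(i - 1) * b n + 1..i * b n.
                  masked (real j / real n, s, embed (\<lambda>s'. X (int j) \<omega> s' / a n))))"
          by (simp only: masked_sum[OF n \<omega>] block_def)
      qed
    qed
  qed
  from tendsto_add[OF mix this] have "?whole \<longlonglongrightarrow> exp (- intensity)" by simp
  then show ?thesis
  proof (rule Lim_transform_eventually)
    show "\<forall>\<^sub>F n in sequentially. ?whole n = (\<integral>\<omega>. exp (- (\<integral>p. g p \<partial>exceedance_process X a r u n \<omega>)) \<partial>M)"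
      using eventually_ge_at_top[of 1]
    proof eventually_elim
      case (elim n)
      then have n: "0 < n" "0 < a n" using a_pos by auto
      show ?case
        by (rule Bochner_Integration.integral_cong[OF refl])
          (simp only: masked_sum[OF n(2)] exceedance_process_integral[OF n])
    qed
  qed
qed

end

end

section \<open>Poisson superpositions of clusters\<close>

lemma measurable_measures_algebra:
  assumes "\<And>\<omega>. \<omega> \<in> space Q \<Longrightarrow> sets (N \<omega>) = sets K"
    and "\<And>A. A \<in> sets K \<Longrightarrow> (\<lambda>\<omega>. emeasure (N \<omega>) A) \<in> borel_measurable Q"
  shows "N \<in> Q \<rightarrow>\<^sub>M measures_algebra K"
  unfolding measures_algebra_def
  by (rule measurable_SUP2) (use assms in \<open>auto intro!: measurable_vimage_algebra2\<close>)

lemma emeasure_count_space_eq_nn_integral: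
  "emeasure (count_space UNIV) {x \<in> A. R x} = (\<integral>\<^sup>+x. (if x \<in> A \<and> R x then 1 else 0) \<partial>count_space UNIV)"
proof -
  have "emeasure (count_space UNIV) {x \<in> A. R x} = (\<integral>\<^sup>+x. indicator {x \<in> A. R x} x \<partial>count_space UNIV)"
    by (rule nn_integral_indicator[symmetric]) simp
  then show ?thesis by (simp add: indicator_def of_bool_def)
qed

text \<open>
  The sample space is the product of a Poisson law and countably many copies of the cluster law
  \<open>C\<close>.
\<close>

locale cluster_sampling = risk_setting r u
  for r :: "'s::finite \<Rightarrow> ('s \<Rightarrow> real) \<Rightarrow> real" and u :: real +
  fixes C :: "(real \<times> (int \<Rightarrow> 's \<Rightarrow> real)) measure" and \<theta> :: real
  assumes C_prob: "prob_space C" and C_sets: "sets C = sets cluster_space"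
    and C_tame: "AE w in C. w \<in> tame" and \<theta>_pos: "0 < \<theta>"
begin

abbreviation samples :: "(nat \<Rightarrow> real \<times> (int \<Rightarrow> 's \<Rightarrow> real)) measure" where
  "samples \<equiv> \<Pi>\<^sub>M i\<in>UNIV. C"

definition Q :: "(nat \<times> (nat \<Rightarrow> real \<times> (int \<Rightarrow> 's \<Rightarrow> real))) measure" where
  "Q = measure_pmf (poisson_pmf \<theta>) \<Otimes>\<^sub>M samples"

definition cluster :: "nat \<Rightarrow> nat \<times> (nat \<Rightarrow> real \<times> (int \<Rightarrow> 's \<Rightarrow> real)) \<Rightarrow> real \<times> (int \<Rightarrow> 's \<Rightarrow> real)" where
  "cluster i \<omega> = make_tame (snd \<omega> i)"

definition V where "V i \<omega> = fst (cluster i \<omega>)"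
definition Z where "Z i j \<omega> = snd (cluster i \<omega>) j"

sublocale C: prob_space C by (rule C_prob)

sublocale samples: prob_space samples
  by (rule prob_space_PiM) (rule C_prob)

sublocale pair_prob_space "measure_pmf (poisson_pmf \<theta>)" samples ..

sublocale Q: prob_space Q
  unfolding Q_def by (rule prob_space_axioms)

lemma C_make_tame: "AE w in C. make_tame w = w"
  using C_tame by eventually_elim (simp add: make_tame_def)

lemma sample_component: "(\<lambda>x. x i) \<in> samples \<rightarrow>\<^sub>M cluster_space"
proof -
  have "(\<lambda>x. x i) \<in> samples \<rightarrow>\<^sub>M C" by (rule measurable_component_singleton) simp
  then show ?thesis using measurable_cong_sets[OF refl C_sets] by blast
qed

lemma cluster_measurable: "cluster i \<in> Q \<rightarrow>\<^sub>M cluster_space"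
proof -
  have "(\<lambda>\<omega>. make_tame (snd \<omega> i)) \<in> Q \<rightarrow>\<^sub>M cluster_space"
    unfolding Q_def
    by (rule measurable_compose[OF measurable_compose[OF measurable_snd sample_component] make_tame_measurable])
  then show ?thesis by (simp add: cluster_def[abs_def])
qed

lemma VZ_eq: "(V i \<omega>, \<lambda>j. Z i j \<omega>) = cluster i \<omega>"
  by (simp add: V_def Z_def)

lemma VZ_tame: "(V i \<omega>, \<lambda>j. Z i j \<omega>) \<in> tame"
  unfolding VZ_eq cluster_def by (rule make_tame_in)

lemma T_measurable: "fst \<in> Q \<rightarrow>\<^sub>M count_space UNIV"
proof -
  have "fst \<in> Q \<rightarrow>\<^sub>M measure_pmf (poisson_pmf \<theta>)" unfolding Q_def by (rule measurable_fst)
  then show ?thesis by (simp cong: measurable_cong_sets)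
qed

lemma distr_snd: "distr Q samples snd = samples"
proof (rule measure_eqI)
  fix A assume "A \<in> sets (distr Q samples snd)"
  then have A: "A \<in> sets samples" by simp
  have "snd -` A \<inter> space Q = UNIV \<times> A"
    using sets.sets_into_space[OF A] by (auto simp: Q_def space_pair_measure)
  then show "emeasure (distr Q samples snd) A = emeasure samples A"
    using A unfolding Q_def
    by (subst emeasure_distr[OF measurable_snd A])
      (simp add: samples.emeasure_pair_measure_Times measure_pmf.emeasure_space_1[simplified])
qed simp

lemma distr_fst: "distr Q (count_space UNIV) fst = measure_pmf (poisson_pmf \<theta>)"
proof -
  have "distr Q (count_space UNIV) fst = distr Q (measure_pmf (poisson_pmf \<theta>)) fst"
    by (rule distr_cong) simp_all
  also have "\<dots> = measure_pmf (poisson_pmf \<theta>)"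
    unfolding Q_def by (rule samples.distr_pair_fst)
  finally show ?thesis .
qed

lemma samples_make_tame: "AE x in samples. \<forall>i. make_tame (x i) = x i"
proof (subst AE_all_countable, rule allI)
  fix i
  show "AE x in samples. make_tame (x i) = x i"
    by (rule AE_PiM_component[of UNIV "\<lambda>_. C" i "\<lambda>w. make_tame w = w"]) (use C_prob C_make_tame in auto)
qed

lemma cluster_distr: "distr Q cluster_space (cluster i) = C"
proof -
  have "distr Q cluster_space (cluster i) = distr (distr Q samples snd) cluster_space (\<lambda>x. make_tame (x i))"
    unfolding cluster_def[abs_def]
    by (subst distr_distr) (auto simp: Q_def comp_def intro!: measurable_compose[OF sample_component make_tame_measurable])
  also have "\<dots> = distr samples cluster_space (\<lambda>x. x i)"
    unfolding distr_snd
    by (rule distr_cong_AE)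
      (use samples_make_tame in \<open>auto intro: measurable_compose[OF sample_component make_tame_measurable] sample_component\<close>)
  also have "\<dots> = distr samples C (\<lambda>x. x i)"
    by (rule distr_cong) (simp_all add: C_sets)
  also have "\<dots> = C"
    by (rule distr_PiM_component) (simp_all add: C_prob)
  finally show ?thesis .
qed

lemma cluster_family_measurable: "(\<lambda>x. \<lambda>i\<in>{1..}. make_tame (x i)) \<in> samples \<rightarrow>\<^sub>M (\<Pi>\<^sub>M i\<in>{1..}. cluster_space)"
  by (rule measurable_restrict) (rule measurable_compose[OF sample_component make_tame_measurable])

lemma clusters_indep: "Q.indep_vars (\<lambda>_. cluster_space) cluster {1..}"
proof (subst Q.indep_vars_iff_distr_eq_PiM)
  show "cluster i \<in> Q \<rightarrow>\<^sub>M cluster_space" for i by (rule cluster_measurable)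
  have "distr Q (\<Pi>\<^sub>M i\<in>{1..}. cluster_space) (\<lambda>\<omega>. \<lambda>i\<in>{1..}. cluster i \<omega>) =
      distr (distr Q samples snd) (\<Pi>\<^sub>M i\<in>{1..}. cluster_space) (\<lambda>x. \<lambda>i\<in>{1..}. make_tame (x i))"
    unfolding cluster_def[abs_def]
    by (subst distr_distr[OF cluster_family_measurable]) (auto simp: Q_def comp_def)
  also have "\<dots> = distr samples (\<Pi>\<^sub>M i\<in>{1..}. cluster_space) (\<lambda>x. \<lambda>i\<in>{1..}. x i)"
    unfolding distr_snd
  proof (rule distr_cong_AE)
    show "AE x in samples. (\<lambda>i\<in>{1..}. make_tame (x i)) = (\<lambda>i\<in>{1..}. x i)"
      using samples_make_tame by eventually_elim auto
    show "(\<lambda>x. \<lambda>i\<in>{1..}. make_tame (x i)) \<in> samples \<rightarrow>\<^sub>M (\<Pi>\<^sub>M i\<in>{1..}. cluster_space)" by (rule cluster_family_measurable)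
    show "(\<lambda>x. \<lambda>i\<in>{1..}. x i) \<in> samples \<rightarrow>\<^sub>M (\<Pi>\<^sub>M i\<in>{1..}. cluster_space)"
      by (rule measurable_restrict) (rule sample_component)
  qed (rule refl)+
  also have "\<dots> = distr samples (\<Pi>\<^sub>M i\<in>{1..}. C) (\<lambda>x. \<lambda>i\<in>{1..}. x i)"
    by (rule distr_cong) (simp_all add: C_sets cong: sets_PiM_cong)
  also have "\<dots> = (\<Pi>\<^sub>M i\<in>{1..}. C)"
    by (rule distr_PiM_reindex[of UNIV "\<lambda>_. C" "\<lambda>i. i" "{1..}", simplified]) (simp_all add: C_prob)
  finally show "distr Q (\<Pi>\<^sub>M i\<in>{1..}. cluster_space) (\<lambda>\<omega>. \<lambda>i\<in>{1..}. cluster i \<omega>) =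
      (\<Pi>\<^sub>M i\<in>{1..}. distr Q cluster_space (cluster i))"
    by (simp add: cluster_distr)
qed simp

lemma count_clusters_indep:
  "independent Q (count_space UNIV) fst (\<Pi>\<^sub>M i\<in>{1..}. cluster_space) (\<lambda>\<omega>. \<lambda>i\<in>{1..}. cluster i \<omega>)"
proof -
  let ?F = "\<lambda>x. \<lambda>i\<in>{1..}. make_tame (x i)"
  have snd_meas: "snd \<in> Q \<rightarrow>\<^sub>M samples" unfolding Q_def by (rule measurable_snd)
  have W: "(\<lambda>\<omega>. \<lambda>i\<in>{1..}. cluster i \<omega>) = (\<lambda>\<omega>. ?F (snd \<omega>))"
    by (simp add: cluster_def)
  have W_meas: "(\<lambda>\<omega>. ?F (snd \<omega>)) \<in> Q \<rightarrow>\<^sub>M (\<Pi>\<^sub>M i\<in>{1..}. cluster_space)"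
    by (rule measurable_compose[OF snd_meas cluster_family_measurable])
  have times: "measure Q (A \<times> B) = measure (measure_pmf (poisson_pmf \<theta>)) A * measure samples B"
    if "B \<in> sets samples" for A B
    unfolding Q_def using that
    by (simp add: measure_def samples.emeasure_pair_measure_Times enn2real_mult)
  have "Q.indep_set {fst -` A \<inter> space Q |A. A \<in> sets (count_space UNIV)}
      {(\<lambda>\<omega>. ?F (snd \<omega>)) -` B \<inter> space Q |B. B \<in> sets (\<Pi>\<^sub>M i\<in>{1..}. cluster_space)}"
    unfolding Q.indep_sets2_eq
  proof (intro conjI ballI)
    show "{fst -` A \<inter> space Q |A. A \<in> sets (count_space UNIV)} \<subseteq> Q.events"
      using measurable_sets[OF T_measurable] by blast
    show "{(\<lambda>\<omega>. ?F (snd \<omega>)) -` B \<inter> space Q |B. B \<in> sets (\<Pi>\<^sub>M i\<in>{1..}. cluster_space)} \<subseteq> Q.events"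
      using measurable_sets[OF W_meas] by blast
    fix A' B' assume A': "A' \<in> {fst -` A \<inter> space Q |A. A \<in> sets (count_space UNIV)}"
      and B': "B' \<in> {(\<lambda>\<omega>. ?F (snd \<omega>)) -` B \<inter> space Q |B. B \<in> sets (\<Pi>\<^sub>M i\<in>{1..}. cluster_space)}"
    from A' obtain A where A: "A' = fst -` A \<inter> space Q" by blast
    from B' obtain B where B: "B' = (\<lambda>\<omega>. ?F (snd \<omega>)) -` B \<inter> space Q" "B \<in> sets (\<Pi>\<^sub>M i\<in>{1..}. cluster_space)" by blast
    define B0 where "B0 = ?F -` B \<inter> space samples"
    have B0: "B0 \<in> sets samples" unfolding B0_def by (rule measurable_sets[OF cluster_family_measurable B(2)])
    have "A' = A \<times> space samples" "B' = UNIV \<times> B0" "A' \<inter> B' = A \<times> B0"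
      unfolding A B(1) B0_def by (auto simp: Q_def space_pair_measure)
    then show "Q.prob (A' \<inter> B') = Q.prob A' * Q.prob B'"
      using B0 by (simp add: times samples.prob_space measure_pmf.prob_space[simplified])
  qed
  then show ?thesis
    unfolding independent_def W using T_measurable W_meas by blast
qed

abbreviation N where "N \<equiv> cluster_superposition r u fst V Z"

abbreviation index_set :: "nat \<times> (nat \<Rightarrow> real \<times> (int \<Rightarrow> 's \<Rightarrow> real)) \<Rightarrow> (nat \<times> 's \<times> int) set" where
  "index_set \<omega> \<equiv> {(i, s, j). i \<in> {1..fst \<omega>} \<and> 0 \<le> j \<and> r s (Z i j \<omega>) > u}"

abbreviation mark_of where
  "mark_of \<omega> \<equiv> (\<lambda>(i, s, j). (V i \<omega>, s :: 's, embed (Z i j \<omega>)))"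

lemma Z_cone: "Z i j \<omega> \<in> nonneg_cone"
  using VZ_tame[of i \<omega>] by (auto simp: tame_def nonneg_paths_def)

lemma Z_exceed: "r s (Z i j \<omega>) > u \<longleftrightarrow> Z i j \<omega> \<in> exceed s"
  using Z_cone by (simp add: exceed_def)

lemma V_range: "0 < V i \<omega>" "V i \<omega> < 1"
  using VZ_tame[of i \<omega>] by (auto simp: tame_def)

lemma mark_region: "x \<in> index_set \<omega> \<Longrightarrow> mark_of \<omega> x \<in> exceedance_region r u"
  using V_range[of "fst x" \<omega>] by (auto simp: Z_exceed less_imp_le intro!: mark_in_region)

lemma mark_of_measurable: "mark_of \<omega> \<in> count_space (index_set \<omega>) \<rightarrow>\<^sub>M borel_of mark_space"
proof (subst measurable_count_space_eq1, rule funcsetI)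
  fix x assume "x \<in> index_set \<omega>"
  from mark_region[OF this] show "mark_of \<omega> x \<in> space (borel_of mark_space)"
    by (simp add: exceedance_region_eq)
qed

lemma superposition_emeasure:
  assumes "A \<in> sets (borel_of mark_space)"
  shows "emeasure (N \<omega>) A = emeasure (count_space UNIV) {x \<in> index_set \<omega>. mark_of \<omega> x \<in> A}"
proof -
  have "mark_of \<omega> -` A \<inter> space (count_space (index_set \<omega>)) = {x \<in> index_set \<omega>. mark_of \<omega> x \<in> A}" by auto
  moreover have "{x \<in> index_set \<omega>. mark_of \<omega> x \<in> A} \<subseteq> index_set \<omega>" by blast
  ultimately show ?thesis
    unfolding cluster_superposition_def Defs.point_measure_def
    by (subst emeasure_distr[OF mark_of_measurable assms]) (simp only: emeasure_count_space subset_UNIV)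
qed

text \<open>
  The mass of a set is a count over the countable set of all possible labels, each of
  which is present on a measurable event.
\<close>

lemma superposition_measurable: "N \<in> Q \<rightarrow>\<^sub>M measures_algebra (borel_of mark_space)"
proof (rule measurable_measures_algebra)
  show "sets (N \<omega>) = sets (borel_of mark_space)" for \<omega>
    by (simp add: cluster_superposition_def Defs.point_measure_def)
  fix A :: "(real \<times> 's \<times> ('s \<Rightarrow> ennreal)) set" assume A: "A \<in> sets (borel_of mark_space)"
  interpret S: sigma_finite_measure "count_space (UNIV :: (nat \<times> 's \<times> int) set)"
    by (rule sigma_finite_measure_count_space_countable) simp
  define R where "R \<omega> x \<longleftrightarrow> x \<in> index_set \<omega> \<and> mark_of \<omega> x \<in> A" for \<omega> x
  have pred: "Measurable.pred Q (\<lambda>\<omega>. R \<omega> x)" for x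
  proof -
    obtain i s j where x: "x = (i, s, j)" by (cases x)
    note [measurable] = T_measurable cluster_measurable
    have V: "V i \<in> borel_measurable Q" unfolding V_def[abs_def] by measurable
    have Z: "Z i j \<in> borel_measurable Q" unfolding Z_def[abs_def] by measurable
    have VZ: "(\<lambda>\<omega>. (V i \<omega>, Z i j \<omega>)) \<in> Q \<rightarrow>\<^sub>M borel \<Otimes>\<^sub>M borel"
      by (rule measurable_Pair[OF V Z])
    have "(\<lambda>\<omega>. (V i \<omega>, Z i j \<omega>)) -` {(v, x). (v, s, embed x) \<in> A} \<inter> space Q \<in> sets Q"
      by (rule measurable_sets[OF VZ mark_preimage_measurable[OF A]])
    also have "(\<lambda>\<omega>. (V i \<omega>, Z i j \<omega>)) -` {(v, x). (v, s, embed x) \<in> A} \<inter> space Q =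
        {\<omega> \<in> space Q. (V i \<omega>, s, embed (Z i j \<omega>)) \<in> A}" by auto
    finally have [measurable]: "Measurable.pred Q (\<lambda>\<omega>. (V i \<omega>, s, embed (Z i j \<omega>)) \<in> A)"
      by (simp add: pred_def)
    note [measurable] = Z
    have "Measurable.pred Q (\<lambda>\<omega>. (1 \<le> i \<and> i \<le> fst \<omega> \<and> 0 \<le> j \<and> Z i j \<omega> \<in> exceed s) \<and> (V i \<omega>, s, embed (Z i j \<omega>)) \<in> A)"
      by measurable
    then show ?thesis by (simp add: R_def x Z_exceed)
  qed
  have if_pred: "(\<lambda>\<omega>. if R \<omega> x then 1 else 0 :: ennreal) \<in> borel_measurable Q" for x
    by (rule measurable_If) (use pred[of x] in \<open>simp_all add: pred_def\<close>)
  have "(\<lambda>(x, \<omega>). if R \<omega> x then 1 else 0 :: ennreal) \<in> borel_measurable (count_space UNIV \<Otimes>\<^sub>M Q)"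
    by (rule measurable_pair_measure_countable1) (simp_all only: split if_pred uncountable_def[symmetric] countableI_type)
  from measurable_pair_swap[OF this]
  have "(\<lambda>(\<omega>, x). if R \<omega> x then 1 else 0 :: ennreal) \<in> borel_measurable (Q \<Otimes>\<^sub>M count_space UNIV)"
    by (simp only: case_prod_beta' fst_conv snd_conv)
  then have "(\<lambda>\<omega>. \<integral>\<^sup>+x. (if R \<omega> x then 1 else 0) \<partial>count_space UNIV) \<in> borel_measurable Q"
    by (rule S.borel_measurable_nn_integral)
  moreover have "emeasure (N \<omega>) A = (\<integral>\<^sup>+x. (if R \<omega> x then 1 else 0) \<partial>count_space UNIV)" for \<omega>
    unfolding superposition_emeasure[OF A] R_def by (rule emeasure_count_space_eq_nn_integral)
  ultimately show "(\<lambda>\<omega>. emeasure (N \<omega>) A) \<in> borel_measurable Q"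
    by (simp only:)
qed

lemma cluster_finite: "\<exists>m. \<forall>j. int m \<le> \<bar>j\<bar> \<longrightarrow> maxnorm (Z i j \<omega>) \<le> 1"
  using VZ_tame[of i \<omega>] by (auto simp: tame_def)

lemma exceedances_bounded:
  "\<exists>m. \<forall>i\<in>{1..n}. \<forall>j. int m \<le> \<bar>j\<bar> \<longrightarrow> maxnorm (Z i j \<omega>) \<le> 1"
proof -
  have "\<forall>i. \<exists>m. \<forall>j. int m \<le> \<bar>j\<bar> \<longrightarrow> maxnorm (Z i j \<omega>) \<le> 1"
    using cluster_finite by blast
  from choice[OF this] obtain m where m: "\<And>i j. int (m i) \<le> \<bar>j\<bar> \<Longrightarrow> maxnorm (Z i j \<omega>) \<le> 1"
    by blast
  have "m i \<le> (\<Sum>i\<in>{1..n}. m i)" if "i \<in> {1..n}" for i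
    by (rule member_le_sum[OF that]) auto
  then show ?thesis
    by (intro exI[of _ "\<Sum>i\<in>{1..n}. m i"]) (meson m of_nat_mono order_trans)
qed

lemma index_set_subset:
  assumes "\<forall>i\<in>{1..fst \<omega>}. \<forall>j. int m \<le> \<bar>j\<bar> \<longrightarrow> maxnorm (Z i j \<omega>) \<le> 1"
  shows "index_set \<omega> \<subseteq> {1..fst \<omega>} \<times> UNIV \<times> int ` {..m}"
proof (rule subsetI)
  fix x assume "x \<in> index_set \<omega>"
  then obtain i s j where x: "x = (i, s, j)" and *: "i \<in> {1..fst \<omega>}" "0 \<le> j" "u < r s (Z i j \<omega>)"
    by blast
  then have "1 < maxnorm (Z i j \<omega>)" using exceed_norm by (simp add: Z_exceed)
  then have "\<not> int m \<le> \<bar>j\<bar>" using assms *(1) by force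
  then have "j = int (nat j) \<and> nat j \<in> {..m}" using *(2) by auto
  then have "j \<in> int ` {..m}" by blast
  then show "x \<in> {1..fst \<omega>} \<times> UNIV \<times> int ` {..m}" using *(1) x by blast
qed

lemma index_set_finite: "finite (index_set \<omega>)"
proof -
  obtain m where "\<forall>i\<in>{1..fst \<omega>}. \<forall>j. int m \<le> \<bar>j\<bar> \<longrightarrow> maxnorm (Z i j \<omega>) \<le> 1"
    using exceedances_bounded by blast
  from index_set_subset[OF this] show ?thesis by (rule finite_subset) simp
qed

lemma superposition_point_process: "point_process Q mark_space N"
  unfolding point_process_def
proof (intro conjI AE_I2 ballI allI impI)
  show "prob_space Q" by (rule Q.prob_space_axioms)
  show "N \<in> Q \<rightarrow>\<^sub>M measures_algebra (borel_of mark_space)" by (rule superposition_measurable)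
  have count: "emeasure (N \<omega>) B \<in> range of_nat" if "B \<in> sets (borel_of mark_space)" for \<omega> B
    using finite_subset[OF _ index_set_finite[of \<omega>], of "{x \<in> index_set \<omega>. mark_of \<omega> x \<in> B}"]
    unfolding superposition_emeasure[OF that] by (subst emeasure_count_space) auto
  fix \<omega>
  show "emeasure (N \<omega>) B \<in> insert \<infinity> (range of_nat)" if "B \<in> sets (borel_of mark_space)" for B
    using count[OF that] by blast
  show "emeasure (N \<omega>) K < \<infinity>" for K
  proof (cases "K \<in> sets (borel_of mark_space)")
    case True
    from count[OF this, of \<omega>] show ?thesis by (auto simp: less_top[symmetric])
  next
    case False
    then have "K \<notin> sets (N \<omega>)" by (simp add: cluster_superposition_def Defs.point_measure_def)
    then show ?thesis by (simp add: emeasure_notin_sets)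
  qed
qed

lemma superposition_in_region: "AE p in N \<omega>. p \<in> exceedance_region r u"
proof -
  have "{p \<in> space (borel_of mark_space). p \<in> exceedance_region r u} = exceedance_region r u"
    by (auto simp: exceedance_region_eq)
  then have "{p \<in> space (borel_of mark_space). p \<in> exceedance_region r u} \<in> sets (borel_of mark_space)"
    using region_measurable by simp
  then show ?thesis
    unfolding cluster_superposition_def Defs.point_measure_def
    by (subst AE_distr_iff[OF mark_of_measurable]) (simp_all add: AE_count_space mark_region)
qed

lemma superposition_integral:
  assumes g: "test_function r u g"
  shows "(\<integral>p. g p \<partial>N \<omega>) = (\<Sum>i\<in>{1..fst \<omega>}. cluster_sum g (cluster i \<omega>))"
proof -
  interpret test_function r u g by (rule g)
  obtain m where m: "\<forall>i\<in>{1..fst \<omega>}. \<forall>j. int m \<le> \<bar>j\<bar> \<longrightarrow> maxnorm (Z i j \<omega>) \<le> 1"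
    using exceedances_bounded by blast
  let ?h = "\<lambda>i s j. if Z i j \<omega> \<in> exceed s then g (V i \<omega>, s, embed (Z i j \<omega>)) else 0"
  have "(\<integral>p. g p \<partial>N \<omega>) = (\<Sum>x\<in>index_set \<omega>. g (mark_of \<omega> x))"
    unfolding cluster_superposition_def Defs.point_measure_def
    by (subst integral_distr[OF mark_of_measurable g_measurable])
      (rule lebesgue_integral_count_space_finite[OF index_set_finite])
  also have "\<dots> = (\<Sum>(i, s, j)\<in>{1..fst \<omega>} \<times> UNIV \<times> int ` {..m}. ?h i s j)"
    by (rule sum.mono_neutral_cong_left) (use index_set_subset[OF m] in \<open>auto simp: Z_exceed\<close>)
  also have "\<dots> = (\<Sum>i\<in>{1..fst \<omega>}. \<Sum>s\<in>UNIV. \<Sum>j\<in>int ` {..m}. ?h i s j)"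
    by (simp only: sum.cartesian_product' split)
  also have "\<dots> = (\<Sum>i\<in>{1..fst \<omega>}. cluster_sum g (cluster i \<omega>))"
  proof (rule sum.cong[OF refl])
    fix i assume i: "i \<in> {1..fst \<omega>}"
    have "(\<Sum>s\<in>UNIV. \<Sum>j\<in>int ` {..m}. ?h i s j) = (\<Sum>j\<in>int ` {..m}. \<Sum>s\<in>UNIV. ?h i s j)"
      by (rule sum.swap)
    also have "\<dots> = (\<Sum>k\<le>m. site_sum g (V i \<omega>) (Z i (int k) \<omega>))"
      by (subst sum.reindex) (auto simp: site_sum_def)
    also have "\<dots> = cluster_sum g (cluster i \<omega>)"
      using cluster_sum_finite[of m "cluster i \<omega>"] m i by (simp add: V_def Z_def)
    finally show "(\<Sum>s\<in>UNIV. \<Sum>j\<in>int ` {..m}. ?h i s j) = cluster_sum g (cluster i \<omega>)" .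
  qed
  finally show ?thesis .
qed

lemma poisson_power_expectation:
  assumes "\<bar>L\<bar> \<le> (1::real)"
  shows "(\<integral>k. L ^ k \<partial>measure_pmf (poisson_pmf \<theta>)) = exp (\<theta> * (L - 1))"
proof -
  have sums: "(\<lambda>k. pmf (poisson_pmf \<theta>) k * L ^ k) sums (exp (- \<theta>) * exp (\<theta> * L))"
  proof -
    have "(\<lambda>k. exp (- \<theta>) * ((\<theta> * L) ^ k /\<^sub>R fact k)) sums (exp (- \<theta>) * exp (\<theta> * L))"
      by (intro sums_mult exp_converges)
    then show ?thesis
      by (simp add: pmf_poisson[OF \<theta>_pos] power_mult_distrib divide_inverse mult_ac)
  qed
  have "summable (\<lambda>k. \<bar>pmf (poisson_pmf \<theta>) k * L ^ k\<bar>)"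
  proof -
    have "summable (\<lambda>k. exp (- \<theta>) * ((\<theta> * \<bar>L\<bar>) ^ k /\<^sub>R fact k))"
      by (intro summable_mult sums_summable[OF exp_converges])
    then show ?thesis
      using \<theta>_pos
      by (simp add: pmf_poisson[OF \<theta>_pos] power_mult_distrib divide_inverse mult_ac abs_mult power_abs)
  qed
  then have int: "integrable (count_space UNIV) (\<lambda>k. pmf (poisson_pmf \<theta>) k * L ^ k)"
    by (simp add: integrable_count_space_nat_iff)
  have "(\<integral>k. L ^ k \<partial>measure_pmf (poisson_pmf \<theta>)) = (\<integral>k. pmf (poisson_pmf \<theta>) k * L ^ k \<partial>count_space UNIV)"
    unfolding measure_pmf_eq_density by (subst integral_density) auto
  also have "\<dots> = exp (- \<theta>) * exp (\<theta> * L)"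
    using integral_count_space_nat[OF int] sums_unique[OF sums] by simp
  also have "\<dots> = exp (\<theta> * (L - 1))"
    by (simp add: exp_add[symmetric] algebra_simps)
  finally show ?thesis .
qed

text \<open>
  Given the number \<open>k\<close> of clusters, independence makes the conditional expectation a \<open>k\<close>-th power;
  averaging over \<open>k\<close> is the Poisson generating function.
\<close>

theorem superposition_laplace:
  assumes g: "test_function r u g"
  shows "(\<integral>\<omega>. exp (- (\<integral>p. g p \<partial>N \<omega>)) \<partial>Q) = exp (\<theta> * ((\<integral>w. exp (- cluster_sum g w) \<partial>C) - 1))"
proof -
  interpret test_function r u g by (rule g)
  note [measurable] = cluster_sum_measurable
  let ?\<phi> = "\<lambda>w. exp (- cluster_sum g (make_tame w))"
  have \<phi>_meas [measurable]: "?\<phi> \<in> borel_measurable cluster_space" by measurable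
  have \<phi>_bounds: "0 \<le> ?\<phi> w" "?\<phi> w \<le> 1" for w using cluster_sum_nonneg[OF make_tame_in] by auto
  let ?L = "\<integral>w. exp (- cluster_sum g w) \<partial>C"
  have C_meas: "borel_measurable C = (borel_measurable cluster_space :: (_ \<Rightarrow> real) set)"
    by (rule measurable_cong_sets[OF C_sets refl])
  have \<phi>C: "?\<phi> \<in> borel_measurable C" unfolding C_meas by measurable
  have L: "(\<integral>w. ?\<phi> w \<partial>C) = ?L"
    by (rule integral_cong_AE) (use C_make_tame \<phi>C in \<open>auto simp: C_meas\<close>)
  have L_bound: "\<bar>?L\<bar> \<le> 1"
  proof -
    have "0 \<le> (\<integral>w. ?\<phi> w \<partial>C)" by (intro Bochner_Integration.integral_nonneg \<phi>_bounds)
    moreover have "(\<integral>w. ?\<phi> w \<partial>C) \<le> 1"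
      by (intro C.integral_le_const C.integrable_const_bound[where B=1]) (use \<phi>_bounds \<phi>C in auto)
    ultimately show ?thesis by (simp add: L)
  qed
  have coord_meas: "(\<lambda>x. ?\<phi> (x i)) \<in> borel_measurable samples" for i
    by (rule measurable_compose[OF sample_component \<phi>_meas])
  have prod_exp: "(\<integral>x. (\<Prod>i\<in>{1..k}. ?\<phi> (x i)) \<partial>samples) = ?L ^ k" for k
  proof -
    have C_int: "(\<integral>x. ?\<phi> (x i) \<partial>samples) = ?L" for i
    proof -
      have "(\<integral>x. ?\<phi> (x i) \<partial>samples) = (\<integral>w. ?\<phi> w \<partial>distr samples C (\<lambda>x. x i))"
        by (rule integral_distr[symmetric, OF _ \<phi>C]) (rule measurable_component_singleton, simp)
      also have "distr samples C (\<lambda>x. x i) = C"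
        by (rule distr_PiM_component) (simp_all add: C_prob)
      finally show ?thesis by (simp add: L)
    qed
    show ?thesis
    proof (cases "k = 0")
      case True then show ?thesis by (simp add: samples.prob_space)
    next
      case False
      have coord: "(\<lambda>x. x i) \<in> samples \<rightarrow>\<^sub>M C" for i by (rule measurable_component_singleton) simp
      have "distr samples (\<Pi>\<^sub>M i\<in>{1..k}. C) (\<lambda>x. \<lambda>i\<in>{1..k}. x i) = (\<Pi>\<^sub>M i\<in>{1..k}. C)"
        using distr_PiM_reindex[of UNIV "\<lambda>_. C" "\<lambda>i. i" "{1..k}"] C_prob by simp
      moreover have "distr samples C (\<lambda>x. x i) = C" for i
        by (rule distr_PiM_component) (simp_all add: C_prob)
      ultimately have "samples.indep_vars (\<lambda>_. C) (\<lambda>i x. x i) {1..k}"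
        using False by (subst samples.indep_vars_iff_distr_eq_PiM) (auto intro: coord)
      then have "samples.indep_vars (\<lambda>_. borel) (\<lambda>i x. ?\<phi> (x i)) {1..k}"
        by (rule samples.indep_vars_compose2) (rule \<phi>C)
      then have "(\<integral>x. (\<Prod>i\<in>{1..k}. ?\<phi> (x i)) \<partial>samples) = (\<Prod>i\<in>{1..k}. \<integral>x. ?\<phi> (x i) \<partial>samples)"
        by (intro samples.indep_vars_lebesgue_integral samples.integrable_const_bound[where B=1])
          (use \<phi>_bounds coord_meas in auto)
      then show ?thesis by (simp add: C_int)
    qed
  qed
  have meas: "(\<lambda>(k, x). \<Prod>i\<in>{1..k}. ?\<phi> (x i)) \<in> borel_measurable (measure_pmf (poisson_pmf \<theta>) \<Otimes>\<^sub>M samples)"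
  proof -
    have "(\<lambda>(k, x). \<Prod>i\<in>{1..k}. ?\<phi> (x i)) \<in> borel_measurable (count_space UNIV \<Otimes>\<^sub>M samples)"
      by (rule measurable_pair_measure_countable1) (use coord_meas in \<open>auto intro: borel_measurable_prod\<close>)
    moreover have "sets (count_space UNIV \<Otimes>\<^sub>M samples) = sets (measure_pmf (poisson_pmf \<theta>) \<Otimes>\<^sub>M samples)"
      by (intro sets_pair_measure_cong) simp_all
    ultimately show ?thesis using measurable_cong_sets by blast
  qed
  have "(\<integral>\<omega>. exp (- (\<integral>p. g p \<partial>N \<omega>)) \<partial>Q) = (\<integral>\<omega>. (\<lambda>(k, x). \<Prod>i\<in>{1..k}. ?\<phi> (x i)) \<omega> \<partial>Q)"
    by (rule Bochner_Integration.integral_cong[OF refl])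
      (simp add: superposition_integral[OF g] cluster_def case_prod_beta' exp_sum sum_negf[symmetric])
  also have "\<dots> = (\<integral>k. (\<integral>x. (\<Prod>i\<in>{1..k}. ?\<phi> (x i)) \<partial>samples) \<partial>measure_pmf (poisson_pmf \<theta>))"
    unfolding Q_def
  proof (rule integral_fst'[symmetric, THEN trans, OF _ ])
    show "integrable (measure_pmf (poisson_pmf \<theta>) \<Otimes>\<^sub>M samples) (\<lambda>(k, x). \<Prod>i\<in>{1..k}. ?\<phi> (x i))"
    proof (rule integrable_const_bound[where B=1, OF AE_I2 meas])
      fix \<omega> :: "nat \<times> (nat \<Rightarrow> real \<times> (int \<Rightarrow> 's \<Rightarrow> real))"
      obtain k x where \<omega>: "\<omega> = (k, x)" by (cases \<omega>)
      have "0 \<le> (\<Prod>i\<in>{1..k}. ?\<phi> (x i))" by (intro prod_nonneg \<phi>_bounds)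
      moreover have "(\<Prod>i\<in>{1..k}. ?\<phi> (x i)) \<le> 1" by (intro prod_le_1 conjI \<phi>_bounds)
      ultimately show "norm (case \<omega> of (k, x) \<Rightarrow> \<Prod>i\<in>{1..k}. ?\<phi> (x i)) \<le> 1"
        unfolding \<omega> split real_norm_def by linarith
    qed
  qed simp
  also have "\<dots> = exp (\<theta> * (?L - 1))"
    by (simp only: prod_exp poisson_power_expectation[OF L_bound])
  finally show ?thesis .
qed

end

section \<open>Identification of the limit\<close>

context marked_tail
begin

abbreviation cluster_rate :: real where
  "cluster_rate \<equiv> measure M' past_event"

abbreviation time_law :: "real measure" where
  "time_law \<equiv> uniform_measure lborel {0<..<1}"

abbreviation conditioned_law :: "'p measure" where
  "conditioned_law \<equiv> uniform_measure M' past_event"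

abbreviation sequence_law :: "(int \<Rightarrow> 's \<Rightarrow> real) measure" where
  "sequence_law \<equiv> distr conditioned_law path_space (\<lambda>\<omega> j. Y j \<omega>)"

lemma cluster_law_eq: "cluster_law M' Y = time_law \<Otimes>\<^sub>M sequence_law"
  by (simp add: cluster_law_def past_event_def)

lemma Y_path_space: "(\<lambda>\<omega> j. Y j \<omega>) \<in> M' \<rightarrow>\<^sub>M path_space"
  using Y_path_measurable measurable_cong_sets[OF refl sets_PiM_equal_borel] by blast

lemma Y_conditioned: "(\<lambda>\<omega> j. Y j \<omega>) \<in> conditioned_law \<rightarrow>\<^sub>M path_space"
  using Y_path_space by (simp cong: measurable_cong_sets)

sublocale time: prob_space time_law
  by (rule prob_space_uniform_measure) simp_all

sublocale conditioned: prob_space conditioned_law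
  by (rule prob_space_uniform_measure)
    (use past_event_pos in \<open>auto simp: M'.emeasure_eq_measure\<close>)

sublocale sequence: prob_space sequence_law
  by (rule conditioned.prob_space_distr[OF Y_conditioned])

sublocale law: pair_prob_space time_law sequence_law ..

lemma cluster_law_sets: "sets (cluster_law M' Y) = sets cluster_space"
  unfolding cluster_law_eq by (rule sets_pair_measure_cong) simp_all

lemma cluster_law_tame: "AE w in cluster_law M' Y. w \<in> tame"
  unfolding cluster_law_eq
proof (rule law.AE_pair_measure)
  have "tame \<in> sets (time_law \<Otimes>\<^sub>M sequence_law)"
    using tame_measurable cluster_law_sets unfolding cluster_law_eq by blast
  from sets.Int[OF this sets.top] show "{w \<in> space (time_law \<Otimes>\<^sub>M sequence_law). w \<in> tame} \<in> sets (time_law \<Otimes>\<^sub>M sequence_law)"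
    by (simp add: Int_def conj_commute)
  let ?S = "\<lambda>z :: int \<Rightarrow> 's \<Rightarrow> real. (\<forall>t. z t \<in> nonneg_cone) \<and> (\<exists>m. \<forall>j. int m \<le> \<bar>j\<bar> \<longrightarrow> maxnorm (z j) \<le> 1)"
  have "AE \<omega> in conditioned_law. ?S (\<lambda>j. Y j \<omega>)"
  proof (rule AE_uniform_measureI)
    show "AE \<omega> in M'. \<omega> \<in> past_event \<longrightarrow> ?S (\<lambda>j. Y j \<omega>)"
      using Y_paths finitely_many_exceedances by eventually_elim (auto simp: nonneg_paths_def)
  qed simp
  then have seq: "AE z in sequence_law. ?S z"
    by (subst AE_distr_iff[OF Y_conditioned]) (auto intro: measurable_sets)
  have "AE v in time_law. v \<in> {0<..<1}"
    by (rule AE_uniform_measureI) auto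
  then show "AE v in time_law. AE z in sequence_law. (v, z) \<in> tame"
  proof eventually_elim
    case (elim v)
    from seq show ?case by eventually_elim (use elim in \<open>auto simp: tame_def nonneg_paths_def\<close>)
  qed
qed

lemma sampling: "cluster_sampling r u (cluster_law M' Y) cluster_rate"
proof (intro cluster_sampling.intro cluster_sampling_axioms.intro)
  show "risk_setting r u" by (rule risk_setting_axioms)
  show "prob_space (cluster_law M' Y)"
    unfolding cluster_law_eq by (rule law.prob_space_axioms)
qed (rule cluster_law_sets cluster_law_tame past_event_pos)+

sublocale sampling: cluster_sampling r u "cluster_law M' Y" cluster_rate
  by (rule sampling)

text \<open>
  The intensity integrates \<open>1 - exp (- cluster sum)\<close> over the event that \<open>Y\<close> has no earlier
  exceedance. This event has probability \<open>\<theta>\<close>, and the cluster law is the law of a uniform mark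
  together with \<open>Y\<close> conditioned on it.
\<close>

lemma intensity_eq:
  assumes g: "test_function r u g"
  shows "cluster_functional.intensity M' Y (site_sum g) =
    cluster_rate * (1 - (\<integral>w. exp (- cluster_sum g w) \<partial>cluster_law M' Y))"
proof -
  interpret test_function r u g by (rule g)
  interpret cluster_functional M X \<alpha> M' \<Theta> P Y a b "site_sum g"
    by (rule cluster_functional_site_sum[OF g])
  let ?h = "\<lambda>w. exp (- cluster_sum g w)"
  have total: "cluster_sum g (v, \<lambda>j. Y j \<omega>) = cluster_total v (\<lambda>t. Y t \<omega>)" for v \<omega>
    by (simp add: cluster_sum_def cluster_total_def)
  define K where "K v = (\<integral>\<omega>. exp (- cluster_total v (\<lambda>t. Y t \<omega>)) * indicator past_event \<omega> \<partial>M')" for v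
  have joint: "(\<lambda>(v, \<omega>). exp (- cluster_total v (\<lambda>t. Y t \<omega>)) * indicator past_event \<omega>) \<in> borel_measurable (borel \<Otimes>\<^sub>M M')"
    unfolding cluster_total_def by measurable
  have K_meas: "K \<in> borel_measurable borel"
    unfolding K_def[abs_def] by (rule M'.borel_measurable_lebesgue_integral) (use joint in simp)
  have section_meas: "(\<lambda>\<omega>. exp (- cluster_total v (\<lambda>t. Y t \<omega>))) \<in> borel_measurable M'" for v
    unfolding cluster_total_def by measurable
  have nonneg: "AE \<omega> in M'. \<forall>v. 0 \<le> cluster_total v (\<lambda>t. Y t \<omega>)"
    using finitely_many_exceedances
  proof eventually_elim
    case (elim \<omega>)
    then obtain m where m: "\<And>t. int m \<le> \<bar>t\<bar> \<Longrightarrow> maxnorm (Y t \<omega>) \<le> 1" by blast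
    have "cluster_total v (\<lambda>t. Y t \<omega>) = (\<Sum>k\<le>m. site_sum g v (Y (int k) \<omega>))" for v
      using cluster_sum_finite[of m "(v, \<lambda>j. Y j \<omega>)"] m by (simp add: total)
    then show ?case by (simp add: sum_nonneg site_sum_nonneg)
  qed
  have int: "integrable M' (\<lambda>\<omega>. exp (- cluster_total v (\<lambda>t. Y t \<omega>)) * indicator past_event \<omega>)" for v
  proof (rule M'.integrable_const_bound[where B=1])
    show "AE \<omega> in M'. norm (exp (- cluster_total v (\<lambda>t. Y t \<omega>)) * indicator past_event \<omega>) \<le> 1"
      using nonneg by eventually_elim (auto split: split_indicator)
    show "(\<lambda>\<omega>. exp (- cluster_total v (\<lambda>t. Y t \<omega>)) * indicator past_event \<omega>) \<in> borel_measurable M'"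
      using section_meas[of v] by measurable
  qed
  have int_past: "integrable M' (indicator past_event :: 'p \<Rightarrow> real)"
    by (intro integrable_real_indicator) (auto simp: M'.emeasure_eq_measure)
  have loss: "(\<integral>\<omega>. cluster_loss v (\<lambda>t. Y t \<omega>) \<partial>M') = cluster_rate - K v" for v
  proof -
    have "(\<integral>\<omega>. cluster_loss v (\<lambda>t. Y t \<omega>) \<partial>M') =
        (\<integral>\<omega>. indicator past_event \<omega> - exp (- cluster_total v (\<lambda>t. Y t \<omega>)) * indicator past_event \<omega> \<partial>M')"
      by (rule Bochner_Integration.integral_cong) (auto simp: cluster_loss_def past_event_def)
    also have "\<dots> = cluster_rate - K v"
      unfolding K_def by (subst Bochner_Integration.integral_diff[OF int_past int]) simp
    finally show ?thesis .
  qed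
  have K_bounds: "0 \<le> K v" "K v \<le> 1" for v
  proof -
    show "0 \<le> K v" unfolding K_def by (rule Bochner_Integration.integral_nonneg) simp
    have "0 \<le> (\<integral>\<omega>. cluster_loss v (\<lambda>t. Y t \<omega>) \<partial>M')"
    proof (rule integral_nonneg_AE)
      show "AE \<omega> in M'. 0 \<le> cluster_loss v (\<lambda>t. Y t \<omega>)"
        using nonneg by eventually_elim (simp add: cluster_loss_def)
    qed
    then show "K v \<le> 1" using loss[of v] M'.prob_le_1[of past_event] by linarith
  qed
  have h_meas: "?h \<in> borel_measurable (time_law \<Otimes>\<^sub>M sequence_law)"
  proof -
    have "?h \<in> borel_measurable cluster_space"
      using cluster_sum_measurable by measurable
    then show ?thesis
      using measurable_cong_sets[OF cluster_law_sets refl] unfolding cluster_law_eq by blast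
  qed
  have h_int: "integrable (time_law \<Otimes>\<^sub>M sequence_law) ?h"
  proof (rule law.integrable_const_bound[where B=1, OF _ h_meas])
    show "AE w in time_law \<Otimes>\<^sub>M sequence_law. norm (?h w) \<le> 1"
      using cluster_law_tame unfolding cluster_law_eq
    proof eventually_elim
      case (elim w)
      then show ?case using cluster_sum_nonneg by simp
    qed
  qed
  have inner: "(\<integral>z. ?h (v, z) \<partial>sequence_law) = K v / cluster_rate" for v
  proof -
    have sec: "(\<lambda>z. ?h (v, z)) \<in> borel_measurable path_space"
      using measurable_compose[OF measurable_Pair1' h_meas, of v] by (simp cong: measurable_cong_sets)
    have "(\<integral>z. ?h (v, z) \<partial>sequence_law) = (\<integral>\<omega>. ?h (v, \<lambda>j. Y j \<omega>) \<partial>conditioned_law)"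
      by (rule integral_distr[OF Y_conditioned sec])
    also have "\<dots> = K v / cluster_rate"
      unfolding K_def total
      by (rule integral_uniform_measure)
        (use past_event_pos section_meas in \<open>auto simp: M'.emeasure_eq_measure\<close>)
    finally show ?thesis .
  qed
  have K_int: "integrable lborel (\<lambda>v. K v * indicator {0<..<1} v)"
  proof (rule Bochner_Integration.integrable_bound)
    show "integrable lborel (indicator {0<..<1} :: real \<Rightarrow> real)"
      by (intro integrable_real_indicator) auto
    show "(\<lambda>v. K v * indicator {0<..<1} v) \<in> borel_measurable lborel"
      unfolding measurable_lborel2
      by (rule borel_measurable_times[OF K_meas borel_measurable_indicator]) auto
    show "AE v in lborel. norm (K v * indicator {0<..<1} v) \<le> norm (indicator {0<..<1} v :: real)"
      using K_bounds by (intro AE_I2) (auto split: split_indicator)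
  qed
  have "(\<integral>w. ?h w \<partial>cluster_law M' Y) = (\<integral>v. K v / cluster_rate \<partial>time_law)"
    unfolding cluster_law_eq by (subst law.integral_fst'[OF h_int, symmetric]) (simp only: inner)
  also have "\<dots> = (\<integral>v. K v / cluster_rate * indicator {0<..<1} v \<partial>lborel)"
    by (subst integral_uniform_measure) (use K_meas in auto)
  also have "\<dots> = (\<integral>v. K v * indicator {0<..<1} v \<partial>lborel) / cluster_rate"
    by simp
  finally have h_eq: "(\<integral>w. ?h w \<partial>cluster_law M' Y) = (\<integral>v. K v * indicator {0<..<1} v \<partial>lborel) / cluster_rate" .
  have "intensity = (\<integral>v. cluster_rate * indicator {0<..<1} v - K v * indicator {0<..<1} v \<partial>lborel)"
    unfolding intensity_def loss by (simp only: left_diff_distrib)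
  also have "\<dots> = cluster_rate - (\<integral>v. K v * indicator {0<..<1} v \<partial>lborel)"
    by (subst Bochner_Integration.integral_diff[OF _ K_int])
      (auto intro!: integrable_mult_right integrable_real_indicator)
  also have "\<dots> = cluster_rate * (1 - (\<integral>w. ?h w \<partial>cluster_law M' Y))"
    using past_event_pos by (simp add: h_eq algebra_simps)
  finally show ?thesis .
qed

lemma exceedance_process_converges:
  "converges_weakly mark_space M (exceedance_process X a r u) sampling.Q sampling.N"
  unfolding converges_weakly_def
proof (intro allI impI)
  fix g :: "real \<times> 's \<times> ('s \<Rightarrow> ennreal) \<Rightarrow> real"
  assume "continuous_map mark_space euclideanreal g \<and> (\<forall>p. 0 \<le> g p) \<and> compactly_supported mark_space g"
  then have g: "test_function r u g" by unfold_locales auto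
  from exceedance_laplace_limit[OF g]
  show "(\<lambda>n. \<integral>\<omega>. exp (- (\<integral>p. g p \<partial>exceedance_process X a r u n \<omega>)) \<partial>M) \<longlonglongrightarrow>
      (\<integral>\<omega>. exp (- (\<integral>p. g p \<partial>sampling.N \<omega>)) \<partial>sampling.Q)"
    unfolding sampling.superposition_laplace[OF g] intensity_eq[OF g] by (simp add: algebra_simps)
qed

lemma sampled_clusters:
  "poisson_clusters M' Y (extremal_index M X b) sampling.Q fst sampling.V sampling.Z"
  unfolding poisson_clusters_def sampling.VZ_eq extremal_index_eq[OF b_top]
  using sampling.Q.prob_space_axioms sampling.T_measurable sampling.distr_fst sampling.clusters_indep
    sampling.cluster_distr sampling.count_clusters_indep
  by blast

end

theorem theorem3:
  fixes M :: "'w measure" and X :: "int \<Rightarrow> 'w \<Rightarrow> 's::finite \<Rightarrow> real" and \<alpha> :: real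
    and M' :: "'p measure" and Y :: "int \<Rightarrow> 'p \<Rightarrow> 's \<Rightarrow> real"
    and a :: "nat \<Rightarrow> real" and b :: "nat \<Rightarrow> nat"
    and r :: "'s \<Rightarrow> ('s \<Rightarrow> real) \<Rightarrow> real" and u :: real
  assumes "time_series M X"
    and "strictly_stationary M X"
    and "jointly_regularly_varying M X \<alpha>"
    and "tail_process M X \<alpha> M' Y"
    and "\<forall>n\<ge>1. 0 < a n"
    and "(\<lambda>n. real n * \<P>(\<omega> in M. maxnorm (X 0 \<omega>) > a n)) \<longlonglongrightarrow> 1"
    and "\<forall>n\<ge>1. 0 < b n"
    and "filterlim b at_top sequentially"
    and "(\<lambda>n. real (b n) / real n) \<longlonglongrightarrow> 0"
    and "mixing_condition M X a b"
    and "anticlustering_condition M X a b"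
    and "\<forall>s. risk_functional (r s)"
    and "\<forall>s. ae_continuous_along M' Y (r s)"
    and "0 < u"
    and "\<forall>s. \<forall>x\<in>nonneg_cone. r s x \<le> u * maxnorm x"
  shows "\<exists>(Q :: (nat \<times> (nat \<Rightarrow> real \<times> (int \<Rightarrow> 's \<Rightarrow> real))) measure) N T V Z.
           point_process Q mark_space N \<and>
           (AE \<omega> in Q. AE p in N \<omega>. p \<in> exceedance_region r u) \<and>
           converges_weakly mark_space M (exceedance_process X a r u) Q N \<and>
           poisson_clusters M' Y (extremal_index M X b) Q T V Z \<and>
           same_law mark_space Q N Q (cluster_superposition r u T V Z)"
proof -
  obtain \<Theta> P where "spectral_tail_process M X M' \<Theta>" "pareto \<alpha> M' P"
    "independent M' borel P path_space (\<lambda>\<omega> t. \<Theta> t \<omega>)"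
    "\<forall>t. \<forall>\<omega>\<in>space M'. Y t \<omega> = (\<lambda>s. P \<omega> * \<Theta> t \<omega> s)"
    using assms(4) unfolding tail_process_def by blast
  then interpret marked_tail M X \<alpha> M' \<Theta> P Y a b r u
    using assms by unfold_locales
  \<comment> \<open>The limit process may be taken to be the superposition itself.\<close>
  have same: "same_law mark_space sampling.Q sampling.N sampling.Q sampling.N"
    using sampling.superposition_measurable by (simp add: same_law_def)
  have region: "AE \<omega> in sampling.Q. AE p in sampling.N \<omega>. p \<in> exceedance_region r u"
    by (rule AE_I2) (rule sampling.superposition_in_region)
  show ?thesis
    by (intro exI[of _ sampling.Q] exI[of _ sampling.N] exI[of _ fst] exI[of _ sampling.V]
        exI[of _ sampling.Z] conjI sampling.superposition_point_process region
        exceedance_process_converges sampled_clusters same)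
qed

end
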